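(* Let $\lambda$ be a cardinal such that for every cardinal $\mu<\lambda$ with $\mu>\mathrm{cf}(\mu)=\omega$ we have: (i) $\mathrm{cof}([\mu]^{\aleph_0},\subseteq)=\mu^+$; and (ii) $\Box^{***}_{\aleph_1,\mu}$ holds. Let $\kappa$ be a cardinal with $\omega\leq\kappa<\lambda$. Then the following are equivalent: (0) $(\mathcal{P}(\omega),\subseteq)$ has the weak Freese-Nation property; (1) $\mathbb{C}(\kappa)$ has the weak Freese-Nation property; (2) $\mathbb{R}(\kappa)$ has the weak Freese-Nation property.
   Context: A quasi-ordering $(P,\leq)$ has the weak Freese-Nation property if there is a mapping $f:P\to[P]^{\leq\aleph_0}$ (assigning to each element of $P$ a countable subset of $P$) such that for all $p,q\in P$ with $p\leq q$ there is $r\in f(p)\cap f(q)$ with $p\leq r\leq q$. A Boolean algebra has the property if it does with respect to its Boolean ordering. $\mathbb{C}(\kappa)$ and $\mathbb{R}(\kappa)$ denote the c.c.c. complete Boolean algebras $\mathrm{Borel}({}^{\kappa}2)/\mathrm{meager}({}^{\kappa}2)$ and $\mathrm{Borel}({}^{\kappa}2)/\mathrm{null}({}^{\kappa}2)$ (the Cohen algebra and the measure algebra on ${}^{\kappa}2$, with the product topology and the product measure) respectively. $\mathrm{cof}([\mu]^{\aleph_0},\subseteq)$ is the least cardinality of a $\subseteq$-cofinal subset of $[\mu]^{\aleph_0}$. $\Box^{***}_{\aleph_1,\mu}$ is the assertion: there exist a sequence $\langle C_\alpha:\alpha<\mu^+\rangle$ and a club set $D\subseteq\mu^+$ such that for every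 $\alpha\in D$ with $\mathrm{cf}(\alpha)\geq\omega_1$: (y1) $C_\alpha\subseteq\alpha$ and $C_\alpha$ is unbounded in $\alpha$; (y2) $[\alpha]^{<\omega_1}\cap\{C_{\alpha'}:\alpha'<\alpha\}$ dominates $[C_\alpha]^{<\omega_1}$ with respect to $\subseteq$, i.e. for every $x\in[C_\alpha]^{<\omega_1}$ there is $y\in[\alpha]^{<\omega_1}\cap\{C_{\alpha'}:\alpha'<\alpha\}$ with $x\subseteq y$. *)

theory Defs
  imports "HOL-Probability.Probability"
begin

unbundle cardinal_syntax

section \<open>The weak Freese-Nation property\<close>

definition weak_Freese_Nation :: "'a set \<Rightarrow> ('a \<Rightarrow> 'a \<Rightarrow> bool) \<Rightarrow> bool" where
  "weak_Freese_Nation P le \<longleftrightarrow>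
    (\<exists>f. (\<forall>p\<in>P. f p \<subseteq> P \<and> countable (f p)) \<and>
         (\<forall>p\<in>P. \<forall>q\<in>P. le p q \<longrightarrow> (\<exists>r \<in> f p \<inter> f q. le p r \<and> le r q)))"


section \<open>Quotients of algebras of sets\<close>

definition mod_rel :: "'a set set \<Rightarrow> 'a set set \<Rightarrow> ('a set \<times> 'a set) set" where
  "mod_rel \<B> \<I> = {(A, B). A \<in> \<B> \<and> B \<in> \<B> \<and> sym_diff A B \<in> \<I>}"

text \<open>The members of \<open>\<I>\<close> need not belong to \<open>\<B>\<close>: the ideal divided out is \<open>\<I> \<inter> \<B>\<close>.\<close>

definition quotient_algebra :: "'a set set \<Rightarrow> 'a set set \<Rightarrow> 'a set set set" where
  "quotient_algebra \<B> \<I> = \<B> // mod_rel \<B> \<I>"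

definition quotient_le :: "'a set set \<Rightarrow> 'a set set \<Rightarrow> 'a set set \<Rightarrow> bool" where
  "quotient_le \<I> a b \<longleftrightarrow> (\<exists>A\<in>a. \<exists>B\<in>b. A - B \<in> \<I>)"

text \<open>\<open>quotient_le\<close> does not depend on representatives, and it is the Boolean ordering
  \<open>a \<le> b \<longleftrightarrow> a \<sqinter> b = a\<close> of the quotient.\<close>

lemma
  assumes sub: "\<And>A B. B \<in> \<I> \<Longrightarrow> A \<subseteq> B \<Longrightarrow> A \<in> \<I>"
    and un: "\<And>A B. A \<in> \<I> \<Longrightarrow> B \<in> \<I> \<Longrightarrow> A \<union> B \<in> \<I>"
    and emp: "{} \<in> \<I>"
    and int: "\<And>A B. A \<in> \<B> \<Longrightarrow> B \<in> \<B> \<Longrightarrow> A \<inter> B \<in> \<B>"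
    and A: "A \<in> \<B>" and B: "B \<in> \<B>"
  shows quotient_le_class:
      "quotient_le \<I> (mod_rel \<B> \<I> `` {A}) (mod_rel \<B> \<I> `` {B}) \<longleftrightarrow> A - B \<in> \<I>"
    and quotient_le_iff_meet:
      "quotient_le \<I> (mod_rel \<B> \<I> `` {A}) (mod_rel \<B> \<I> `` {B}) \<longleftrightarrow>
        mod_rel \<B> \<I> `` {A \<inter> B} = mod_rel \<B> \<I> `` {A}"
proof -
  show 1: "quotient_le \<I> (mod_rel \<B> \<I> `` {A}) (mod_rel \<B> \<I> `` {B}) \<longleftrightarrow> A - B \<in> \<I>"
  proof
    assume "quotient_le \<I> (mod_rel \<B> \<I> `` {A}) (mod_rel \<B> \<I> `` {B})"
    then obtain A' B' where "sym_diff A A' \<in> \<I>" "sym_diff B B' \<in> \<I>" "A' - B' \<in> \<I>"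
      unfolding quotient_le_def mod_rel_def by auto
    then have "sym_diff A A' \<union> sym_diff B B' \<union> (A' - B') \<in> \<I>"
      using un by meson
    then show "A - B \<in> \<I>" by (rule sub) auto
  next
    assume "A - B \<in> \<I>"
    moreover have "A \<in> mod_rel \<B> \<I> `` {A}" "B \<in> mod_rel \<B> \<I> `` {B}"
      using A B emp unfolding mod_rel_def by auto
    ultimately show "quotient_le \<I> (mod_rel \<B> \<I> `` {A}) (mod_rel \<B> \<I> `` {B})"
      unfolding quotient_le_def by blast
  qed
  have eq: "equiv \<B> (mod_rel \<B> \<I>)"
  proof (rule equivI)
    show "mod_rel \<B> \<I> \<subseteq> \<B> \<times> \<B>" unfolding mod_rel_def by auto
    show "refl_on \<B> (mod_rel \<B> \<I>)"
      using emp unfolding mod_rel_def by (auto intro: refl_onI)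
    show "sym (mod_rel \<B> \<I>)"
      unfolding mod_rel_def by (auto intro!: symI simp: Un_commute)
    show "trans (mod_rel \<B> \<I>)"
    proof (rule transI)
      fix X Y Z assume "(X, Y) \<in> mod_rel \<B> \<I>" "(Y, Z) \<in> mod_rel \<B> \<I>"
      then have h: "X \<in> \<B>" "Z \<in> \<B>" "sym_diff X Y \<union> sym_diff Y Z \<in> \<I>"
        using un unfolding mod_rel_def by auto
      have "sym_diff X Z \<in> \<I>" by (rule sub[OF h(3)]) auto
      then show "(X, Z) \<in> mod_rel \<B> \<I>" using h unfolding mod_rel_def by auto
    qed
  qed
  have "mod_rel \<B> \<I> `` {A \<inter> B} = mod_rel \<B> \<I> `` {A} \<longleftrightarrow> (A \<inter> B, A) \<in> mod_rel \<B> \<I>"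
    using eq_equiv_class_iff[OF eq int[OF A B] A] .
  also have "\<dots> \<longleftrightarrow> A - B \<in> \<I>"
  proof -
    have "sym_diff (A \<inter> B) A = A - B" by auto
    then show ?thesis using A int[OF A B] unfolding mod_rel_def by simp
  qed
  finally show "quotient_le \<I> (mod_rel \<B> \<I> `` {A}) (mod_rel \<B> \<I> `` {B}) \<longleftrightarrow>
        mod_rel \<B> \<I> `` {A \<inter> B} = mod_rel \<B> \<I> `` {A}"
    using 1 by simp
qed


section \<open>The Cohen algebra and the measure algebra\<close>

definition nowhere_dense_in :: "'a topology \<Rightarrow> 'a set \<Rightarrow> bool" where
  "nowhere_dense_in X S \<longleftrightarrow> S \<subseteq> topspace X \<and> X interior_of (X closure_of S) = {}"

definition meager_sets :: "'a topology \<Rightarrow> 'a set set" where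
  "meager_sets X = {\<Union>(range S) |S :: nat \<Rightarrow> 'a set. \<forall>n. nowhere_dense_in X (S n)}"

definition borel_sets :: "'a topology \<Rightarrow> 'a set set" where
  "borel_sets X = sigma_sets (topspace X) {U. openin X U}"

text \<open>A cardinal is a cardinal order \<open>\<kappa>\<close> (\<open>Card_order \<kappa>\<close>); its underlying set is \<open>Field \<kappa>\<close>.\<close>

definition cantor_topology :: "'a rel \<Rightarrow> ('a \<Rightarrow> bool) topology" where
  "cantor_topology \<kappa> = product_topology (\<lambda>_. discrete_topology UNIV) (Field \<kappa>)"

definition cantor_measure :: "'a rel \<Rightarrow> ('a \<Rightarrow> bool) measure" where
  "cantor_measure \<kappa> = (\<Pi>\<^sub>M i\<in>Field \<kappa>. uniform_count_measure UNIV)"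

definition Cohen_algebra :: "'a rel \<Rightarrow> ('a \<Rightarrow> bool) set set set" where
  "Cohen_algebra \<kappa> =
    quotient_algebra (borel_sets (cantor_topology \<kappa>)) (meager_sets (cantor_topology \<kappa>))"

definition Cohen_le :: "'a rel \<Rightarrow> ('a \<Rightarrow> bool) set set \<Rightarrow> ('a \<Rightarrow> bool) set set \<Rightarrow> bool" where
  "Cohen_le \<kappa> = quotient_le (meager_sets (cantor_topology \<kappa>))"

text \<open>For uncountable \<open>\<kappa>\<close> the product \<open>\<sigma>\<close>-algebra, on which \<open>cantor_measure\<close> lives, consists of the
  Baire sets and is smaller than the Borel \<open>\<sigma>\<close>-algebra of the product topology. The product measure
  is completion regular (Kakutani), so its completion measures all Borel sets; hence null
  sets are those of the completion, i.e. the subsets of null sets of the product \<open>\<sigma>\<close>-algebra.\<close>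

definition measure_algebra :: "'a rel \<Rightarrow> ('a \<Rightarrow> bool) set set set" where
  "measure_algebra \<kappa> =
    quotient_algebra (borel_sets (cantor_topology \<kappa>)) (null_sets (completion (cantor_measure \<kappa>)))"

definition measure_algebra_le :: "'a rel \<Rightarrow> ('a \<Rightarrow> bool) set set \<Rightarrow> ('a \<Rightarrow> bool) set set \<Rightarrow> bool" where
  "measure_algebra_le \<kappa> = quotient_le (null_sets (completion (cantor_measure \<kappa>)))"


section \<open>Cofinalities\<close>

text \<open>The least cardinality of a member of \<open>\<F>\<close>; meaningful only for \<open>\<F> \<noteq> {}\<close>.\<close>

definition least_card :: "'a set set \<Rightarrow> 'a rel" where
  "least_card \<F> = |(SOME K. K \<in> \<F> \<and> (\<forall>L\<in>\<F>. |K| \<le>o |L| ))|"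

lemma least_card_attained:
  assumes "\<F> \<noteq> {}"
  shows "\<exists>K\<in>\<F>. least_card \<F> = |K| \<and> (\<forall>L\<in>\<F>. |K| \<le>o |L| )"
proof -
  have "\<exists>r\<in>card_of ` \<F>. \<forall>r'\<in>card_of ` \<F>. r \<le>o r'"
    using assms by (intro exists_minim_Card_order) (auto simp: card_of_Card_order)
  then have "\<exists>K. K \<in> \<F> \<and> (\<forall>L\<in>\<F>. |K| \<le>o |L| )" by auto
  from someI_ex[OF this] show ?thesis unfolding least_card_def by blast
qed

text \<open>The comparison is not strict, unlike in the library's \<open>cofinal\<close>, so that initial segments
  with a greatest element have cofinality 1.\<close>

definition unbounded_in :: "'a rel \<Rightarrow> 'a set \<Rightarrow> 'a set \<Rightarrow> bool" where
  "unbounded_in r A K \<longleftrightarrow> K \<subseteq> A \<and> (\<forall>a\<in>A. \<exists>b\<in>K. (a, b) \<in> r)"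

definition cf_in :: "'a rel \<Rightarrow> 'a set \<Rightarrow> 'a rel" where
  "cf_in r A = least_card {K. unbounded_in r A K}"

abbreviation cf :: "'a rel \<Rightarrow> 'a rel" where
  "cf r \<equiv> cf_in r (Field r)"

definition ctbl_infinite_subsets :: "'a set \<Rightarrow> 'a set set" where
  "ctbl_infinite_subsets A = {x. x \<subseteq> A \<and> |x| =o natLeq}"

definition cof_ctbl_subsets :: "'a rel \<Rightarrow> 'a set rel" where
  "cof_ctbl_subsets \<mu> = least_card {\<X>. \<X> \<subseteq> ctbl_infinite_subsets (Field \<mu>) \<and>
     (\<forall>x\<in>ctbl_infinite_subsets (Field \<mu>). \<exists>y\<in>\<X>. x \<subseteq> y)}"


section \<open>The square principle\<close>

text \<open>In a well-order \<open>r\<close>, the ordinals below its order type are the elements of \<open>Field r\<close>, and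
  \<open>\<alpha>\<close> as a set of smaller ordinals is \<open>underS r \<alpha>\<close>. The comparison with \<open>\<gamma>\<close> below is strict, so
  only limit points \<open>\<delta>\<close> of \<open>D\<close> are concerned.\<close>

definition closed_in :: "'a rel \<Rightarrow> 'a set \<Rightarrow> bool" where
  "closed_in r D \<longleftrightarrow> (\<forall>\<delta>\<in>Field r. underS r \<delta> \<noteq> {} \<and>
     (\<forall>\<beta>\<in>underS r \<delta>. \<exists>\<gamma>\<in>D \<inter> underS r \<delta>. \<beta> \<in> underS r \<gamma>) \<longrightarrow> \<delta> \<in> D)"

definition club :: "'a rel \<Rightarrow> 'a set \<Rightarrow> bool" where
  "club r D \<longleftrightarrow> unbounded_in r (Field r) D \<and> closed_in r D"

definition square_aleph1 :: "'a rel \<Rightarrow> bool" where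
  "square_aleph1 \<mu> \<longleftrightarrow> (let r = cardSuc \<mu> in
    \<exists>C D. club r D \<and>
      (\<forall>\<alpha>\<in>D. cardSuc natLeq \<le>o cf_in r (underS r \<alpha>) \<longrightarrow>
        unbounded_in r (underS r \<alpha>) (C \<alpha>) \<and>
        (\<forall>x. x \<subseteq> C \<alpha> \<and> countable x \<longrightarrow>
          (\<exists>y. y \<subseteq> underS r \<alpha> \<and> countable y \<and> y \<in> C ` underS r \<alpha> \<and> x \<subseteq> y))))"

end

theory Submission
  imports Defs "HOL-Library.Countable_Set_Type"
begin

text \<open>
  The equivalence rests on a covering principle for countable sets that involves neither category
  nor measure. A family of sets has \<^emph>\<open>shared covers\<close> if each member \<open>X\<close> can be given countably many
  countable sets \<open>g X\<close> in such a way that, for all members \<open>X\<close> and \<open>Y\<close>, some \<open>Z\<close> in both \<open>g X\<close> and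
  \<open>g Y\<close> contains \<open>X \<inter> Y\<close>. The hypotheses on \<open>lambda\<close> give shared covers to the countable subsets of
  every cardinal below \<open>lambda\<close> (\<open>shared_covers_countable_subsets\<close>).

  The principle lifts the weak Freese-Nation property from \<open>\<P>(\<omega>)\<close> to both algebras
  (\<open>weak_Freese_Nation_shared_covers\<close>). An element is determined, up to the ideal, by countably many
  coordinates. Let \<open>a \<le> b\<close> depend on the coordinates in \<open>X\<close> and \<open>Y\<close>, and let \<open>X \<inter> Y \<subseteq> Z\<close>. Once the
  coordinates in \<open>Z\<close> are fixed, \<open>a\<close> and \<open>b\<close> are independent of each other, and so the least element
  over \<open>Z\<close> above \<open>a\<close> lies below the greatest element over \<open>Z\<close> below \<open>b\<close>. The part of the algebra that
  lives on a countable \<open>Z\<close> is order-embedded into \<open>\<P>(\<omega>)\<close> by listing which members of a countable dense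
  set are, exactly or approximately, below a given element; and suprema turn sets of natural numbers
  back into elements. Hence the countably many interpolants that \<open>\<P>(\<omega>)\<close> provides for the codes of the
  two projections of \<open>a\<close>, for all \<open>Z \<in> g X\<close>, serve as interpolants for \<open>a\<close>. For category,
  independence means that cylinders over disjoint sets of coordinates meet (\<open>cylinder_overlap\<close>);
  for measure it is Fubini's theorem (\<open>disjoint_shadows\<close>).

  In the other direction, a sequence of disjoint nonzero elements turns \<open>\<P>(\<omega>)\<close> into a retract of
  either algebra, and the weak Freese-Nation property passes to retracts.

  The covering principle is proved by induction on the cardinal \<open>\<mu>\<close>. The tool is a ranking of the
  family along a well-order: it is enough that each rank has shared covers by itself and that, seen
  from any \<open>X\<close>, countably many sets of smaller rank stand for all of them
  (\<open>shared_covers_rank\<close>). If \<open>\<mu>\<close> has uncountable cofinality, the rank of a countable set is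
  its supremum, and its proper initial segments stand for the sets of smaller rank. If \<open>\<mu>\<close> has
  countable cofinality, the countable subsets of \<open>\<mu>\<close> have a cofinal family of size \<open>\<mu>\<^sup>+\<close>, and the square
  principle provides club many ordinals below \<open>\<mu>\<^sup>+\<close> at which countably many earlier members of the
  family stand for all earlier members.
\<close>

section \<open>Well-orders\<close>

lemma underS_trans:
  assumes "Well_order r" "a \<in> underS r b" "b \<in> underS r c"
  shows "a \<in> underS r c"
proof -
  interpret wo_rel r using assms(1) by (simp add: wo_rel_def)
  show ?thesis using assms(2,3) TRANS ANTISYM
    unfolding underS_def trans_def antisym_def by blast
qed

lemma underS_le_trans:
  assumes "Well_order r" "a \<in> underS r b" "(b, c) \<in> r"
  shows "a \<in> underS r c"
proof -
  interpret wo_rel r using assms(1) by (simp add: wo_rel_def)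
  show ?thesis using assms(2,3) TRANS ANTISYM
    unfolding underS_def trans_def antisym_def by blast
qed

lemma le_underS_trans:
  assumes "Well_order r" "(a, b) \<in> r" "b \<in> underS r c"
  shows "a \<in> underS r c"
proof -
  interpret wo_rel r using assms(1) by (simp add: wo_rel_def)
  show ?thesis using assms(2,3) TRANS ANTISYM
    unfolding underS_def trans_def antisym_def by blast
qed

lemma underS_or_le:
  assumes "Well_order r" "a \<in> Field r" "b \<in> Field r"
  shows "a \<in> underS r b \<or> (b, a) \<in> r"
proof -
  interpret wo_rel r using assms(1) by (simp add: wo_rel_def)
  show ?thesis using assms(2,3) TOTALS unfolding underS_def by blast
qed

lemma not_underS_le:
  assumes "Well_order r" "(b, a) \<in> r"
  shows "a \<notin> underS r b"
proof -
  interpret wo_rel r using assms(1) by (simp add: wo_rel_def)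
  show ?thesis using assms(2) ANTISYM unfolding underS_def antisym_def by blast
qed

lemma Well_order_least:
  assumes "Well_order r" "x \<in> Field r" "P x"
  obtains y where "y \<in> Field r" "P y" "\<And>z. z \<in> underS r y \<Longrightarrow> \<not> P z" 
    "\<And>z. z \<in> Field r \<Longrightarrow> P z \<Longrightarrow> (y, z) \<in> r"
proof -
  have wo: "wo_rel r" using assms(1) by (simp add: wo_rel_def)
  let ?B = "{x \<in> Field r. P x}" and ?m = "wo_rel.minim r {x \<in> Field r. P x}"
  have "?B \<subseteq> Field r" "?B \<noteq> {}" using assms by auto
  then have 1: "?m \<in> ?B" "\<And>b. b \<in> ?B \<Longrightarrow> (?m, b) \<in> r"
    using wo_rel.minim_in[OF wo] wo_rel.minim_least[OF wo] by blast+
  have "\<not> P z" if "z \<in> underS r ?m" for z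
  proof
    assume "P z"
    moreover have "z \<in> Field r" using that by (auto simp: underS_def Field_def)
    ultimately have "(?m, z) \<in> r" using 1(2) by blast
    then show False using that not_underS_le[OF assms(1)] by blast
  qed
  with 1 show ?thesis using that by blast
qed

section \<open>Shared covers\<close>

text \<open>The values of \<open>g\<close> may lie outside \<open>\<D>\<close>. This freedom makes the property pass to families that
  are only dominated by \<open>\<D>\<close>.\<close>

definition shared_covers :: "'a set set \<Rightarrow> bool" where
  "shared_covers \<D> \<longleftrightarrow>
    (\<exists>g. (\<forall>X\<in>\<D>. countable (g X) \<and> (\<forall>Z\<in>g X. countable Z)) \<and>
         (\<forall>X\<in>\<D>. \<forall>Y\<in>\<D>. \<exists>Z\<in>g X \<inter> g Y. X \<inter> Y \<subseteq> Z))"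

abbreviation countable_subsets :: "'a set \<Rightarrow> 'a set set" where
  "countable_subsets A \<equiv> {x. x \<subseteq> A \<and> countable x}"

lemma shared_covers_cofinal:
  assumes "shared_covers \<D>'" and "\<And>X. X \<in> \<D> \<Longrightarrow> \<exists>X'\<in>\<D>'. X \<subseteq> X'"
  shows "shared_covers \<D>"
proof -
  obtain g where g: "\<forall>X\<in>\<D>'. countable (g X) \<and> (\<forall>Z\<in>g X. countable Z)"
      "\<forall>X\<in>\<D>'. \<forall>Y\<in>\<D>'. \<exists>Z\<in>g X \<inter> g Y. X \<inter> Y \<subseteq> Z"
    using assms(1) unfolding shared_covers_def by blast
  obtain h where h: "\<And>X. X \<in> \<D> \<Longrightarrow> h X \<in> \<D>' \<and> X \<subseteq> h X"
    using assms(2) by metis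
  show ?thesis unfolding shared_covers_def
  proof (intro exI[of _ "\<lambda>X. g (h X)"] conjI ballI)
    fix X Y assume "X \<in> \<D>" "Y \<in> \<D>"
    then obtain Z where "Z \<in> g (h X) \<inter> g (h Y)" "h X \<inter> h Y \<subseteq> Z" using g h by metis
    then show "\<exists>Z\<in>g (h X) \<inter> g (h Y). X \<inter> Y \<subseteq> Z" using h \<open>X \<in> \<D>\<close> \<open>Y \<in> \<D>\<close> by blast
  qed (use g h in auto)
qed

text \<open>For \<open>X\<close> of larger rank than \<open>Y\<close>, the set \<open>X \<inter> Y\<close> is contained in \<open>Z \<inter> Y\<close> for one of the
  countably many sets \<open>Z \<in> W X\<close>, whose rank is smaller. Repeating this on whichever side has the
  larger rank leads in finitely many steps to two sets of the same rank, where the covers of that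
  rank apply. So \<open>X\<close> receives the covers of all the sets that it reaches in finitely many steps.\<close>

lemma shared_covers_rank:
  fixes \<rho> :: "'a set \<Rightarrow> 'b"
  assumes wo: "Well_order r" and rank: "\<And>X. X \<in> \<D> \<Longrightarrow> \<rho> X \<in> Field r"
    and level: "\<And>\<alpha>. \<alpha> \<in> Field r \<Longrightarrow> shared_covers {X\<in>\<D>. \<rho> X = \<alpha>}"
    and below: "\<And>X. X \<in> \<D> \<Longrightarrow> \<exists>W. countable W \<and> W \<subseteq> {Z\<in>\<D>. \<rho> Z \<in> underS r (\<rho> X)} \<and>
      (\<forall>Y\<in>\<D>. \<rho> Y \<in> underS r (\<rho> X) \<longrightarrow> (\<exists>Z\<in>W. X \<inter> Y \<subseteq> Z))"
  shows "shared_covers \<D>"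
proof -
  obtain W where W: "\<And>X. X \<in> \<D> \<Longrightarrow> countable (W X)"
      "\<And>X Z. X \<in> \<D> \<Longrightarrow> Z \<in> W X \<Longrightarrow> Z \<in> \<D> \<and> \<rho> Z \<in> underS r (\<rho> X)"
      "\<And>X Y. X \<in> \<D> \<Longrightarrow> Y \<in> \<D> \<Longrightarrow> \<rho> Y \<in> underS r (\<rho> X) \<Longrightarrow> \<exists>Z\<in>W X. X \<inter> Y \<subseteq> Z"
  proof -
    have "\<forall>X\<in>\<D>. \<exists>W. countable W \<and> W \<subseteq> {Z\<in>\<D>. \<rho> Z \<in> underS r (\<rho> X)} \<and>
      (\<forall>Y\<in>\<D>. \<rho> Y \<in> underS r (\<rho> X) \<longrightarrow> (\<exists>Z\<in>W. X \<inter> Y \<subseteq> Z))"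
      using below by blast
    from bchoice[OF this] obtain W where "\<forall>X\<in>\<D>. countable (W X) \<and> W X \<subseteq> {Z\<in>\<D>. \<rho> Z \<in> underS r (\<rho> X)} \<and>
      (\<forall>Y\<in>\<D>. \<rho> Y \<in> underS r (\<rho> X) \<longrightarrow> (\<exists>Z\<in>W X. X \<inter> Y \<subseteq> Z))" ..
    then show ?thesis by (intro that[of W]) blast+
  qed
  have "\<forall>\<alpha>\<in>Field r. \<exists>g. (\<forall>X\<in>\<D>. \<rho> X = \<alpha> \<longrightarrow> countable (g X) \<and> (\<forall>Z\<in>g X. countable Z)) \<and>
      (\<forall>X\<in>\<D>. \<forall>Y\<in>\<D>. \<rho> X = \<alpha> \<and> \<rho> Y = \<alpha> \<longrightarrow> (\<exists>Z\<in>g X \<inter> g Y. X \<inter> Y \<subseteq> Z))"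
  proof
    fix \<alpha> assume "\<alpha> \<in> Field r"
    from level[OF this] obtain g where
      "\<forall>X\<in>{X\<in>\<D>. \<rho> X = \<alpha>}. countable (g X) \<and> (\<forall>Z\<in>g X. countable Z)"
      "\<forall>X\<in>{X\<in>\<D>. \<rho> X = \<alpha>}. \<forall>Y\<in>{X\<in>\<D>. \<rho> X = \<alpha>}. \<exists>Z\<in>g X \<inter> g Y. X \<inter> Y \<subseteq> Z"
      unfolding shared_covers_def by blast
    then show "\<exists>g. (\<forall>X\<in>\<D>. \<rho> X = \<alpha> \<longrightarrow> countable (g X) \<and> (\<forall>Z\<in>g X. countable Z)) \<and>
      (\<forall>X\<in>\<D>. \<forall>Y\<in>\<D>. \<rho> X = \<alpha> \<and> \<rho> Y = \<alpha> \<longrightarrow> (\<exists>Z\<in>g X \<inter> g Y. X \<inter> Y \<subseteq> Z))"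
      by (intro exI[of _ g]) simp
  qed
  from bchoice[OF this] obtain G where G': "\<forall>\<alpha>\<in>Field r.
      (\<forall>X\<in>\<D>. \<rho> X = \<alpha> \<longrightarrow> countable (G \<alpha> X) \<and> (\<forall>Z\<in>G \<alpha> X. countable Z)) \<and>
      (\<forall>X\<in>\<D>. \<forall>Y\<in>\<D>. \<rho> X = \<alpha> \<and> \<rho> Y = \<alpha> \<longrightarrow> (\<exists>Z\<in>G \<alpha> X \<inter> G \<alpha> Y. X \<inter> Y \<subseteq> Z))" ..
  then have G_count: "countable (G (\<rho> X) X) \<and> (\<forall>Z\<in>G (\<rho> X) X. countable Z)" if "X \<in> \<D>" for X
    using bspec[OF G' rank[OF that]] that by blast
  have G: "\<exists>Z\<in>G (\<rho> X) X \<inter> G (\<rho> Y) Y. X \<inter> Y \<subseteq> Z"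
    if "X \<in> \<D>" "Y \<in> \<D>" "\<rho> X = \<rho> Y" for X Y
    using bspec[OF G' rank[OF that(1)]] that by simp
  define T where "T = {(X, Z). X \<in> \<D> \<and> Z \<in> W X}\<^sup>*"
  have T_in: "Z \<in> \<D>" if "(X, Z) \<in> T" "X \<in> \<D>" for X Z
    using that unfolding T_def by (induction rule: rtrancl_induct) (use W(2) in blast)+
  have T_count: "countable (T `` {X})" if "X \<in> \<D>" for X
    unfolding T_def
  proof (rule countable_rtrancl)
    fix Y :: "'a set set" assume "countable Y"
    moreover have "{(X, Z). X \<in> \<D> \<and> Z \<in> W X} `` Y = (\<Union>X\<in>Y \<inter> \<D>. W X)" by auto
    ultimately show "countable ({(X, Z). X \<in> \<D> \<and> Z \<in> W X} `` Y)" using W(1) by auto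
  qed simp
  define g where "g X = (\<Union>Z\<in>T `` {X}. G (\<rho> Z) Z)" for X
  have sub: "g Z \<subseteq> g X" if "X \<in> \<D>" "Z \<in> W X" for X Z
  proof -
    have "(X, Z) \<in> {(X, Z). X \<in> \<D> \<and> Z \<in> W X}" using that by auto
    then have "T `` {Z} \<subseteq> T `` {X}" unfolding T_def by (auto intro: converse_rtrancl_into_rtrancl)
    then show ?thesis unfolding g_def by blast
  qed
  have self: "G (\<rho> X) X \<subseteq> g X" for X unfolding g_def T_def by auto
  have wf: "wf (r - Id)" using wo by (simp add: well_order_on_def)
  have lt: "\<rho> Z \<in> underS r (\<rho> X) \<longleftrightarrow> (\<rho> Z, \<rho> X) \<in> r - Id" for Z X
    unfolding underS_def by auto
  have main: "p \<in> \<D> \<times> \<D> \<longrightarrow> (\<exists>Z\<in>g (fst p) \<inter> g (snd p). fst p \<inter> snd p \<subseteq> Z)" for p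
  proof (induction p rule: wf_induct_rule[OF wf_inv_image[OF wf_lex_prod[OF wf wf],
        of "\<lambda>(X, Y). (\<rho> X, \<rho> Y)"]])
    case (1 p)
    obtain X Y where p: "p = (X, Y)" by (cases p)
    show ?case
    proof (intro impI)
      assume "p \<in> \<D> \<times> \<D>"
      then have XY: "X \<in> \<D>" "Y \<in> \<D>" using p by auto
      consider (eq) "\<rho> X = \<rho> Y" | (gt) "\<rho> Y \<in> underS r (\<rho> X)" | (less) "\<rho> X \<in> underS r (\<rho> Y)"
        using underS_or_le[OF wo rank[OF XY(1)] rank[OF XY(2)]] by (cases "\<rho> X = \<rho> Y") (auto simp: underS_def)
      then show "\<exists>Z\<in>g (fst p) \<inter> g (snd p). fst p \<inter> snd p \<subseteq> Z"
      proof cases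
        case eq
        then obtain Z where "Z \<in> G (\<rho> X) X \<inter> G (\<rho> Y) Y" "X \<inter> Y \<subseteq> Z" using G[OF XY] by blast
        then show ?thesis using self p by (intro bexI[of _ Z]) auto
      next
        case gt
        then obtain Z where Z: "Z \<in> W X" "X \<inter> Y \<subseteq> Z" using W(3) XY by blast
        have "((Z, Y), p) \<in> inv_image ((r - Id) <*lex*> (r - Id)) (\<lambda>(X, Y). (\<rho> X, \<rho> Y))"
          using W(2)[OF XY(1) Z(1)] p by (simp add: lt)
        then obtain V where "V \<in> g Z \<inter> g Y" "Z \<inter> Y \<subseteq> V" using 1[of "(Z, Y)"] W(2)[OF XY(1) Z(1)] XY by auto
        then show ?thesis using sub[OF XY(1) Z(1)] p Z(2) by (intro bexI[of _ V]) auto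
      next
        case less
        then obtain Z where Z: "Z \<in> W Y" "Y \<inter> X \<subseteq> Z" using W(3) XY by blast
        have "((X, Z), p) \<in> inv_image ((r - Id) <*lex*> (r - Id)) (\<lambda>(X, Y). (\<rho> X, \<rho> Y))"
          using W(2)[OF XY(2) Z(1)] p by (simp add: lt)
        then obtain V where "V \<in> g X \<inter> g Z" "X \<inter> Z \<subseteq> V" using 1[of "(X, Z)"] W(2)[OF XY(2) Z(1)] XY by auto
        then show ?thesis using sub[OF XY(2) Z(1)] p Z(2) by (intro bexI[of _ V]) auto
      qed
    qed
  qed
  show ?thesis unfolding shared_covers_def
  proof (intro exI[of _ g] conjI ballI)
    fix X assume X: "X \<in> \<D>"
    show "countable (g X)" unfolding g_def
      using T_count[OF X] G_count T_in[OF _ X] by (intro countable_UN) auto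
    fix Z assume "Z \<in> g X"
    then obtain V where "(X, V) \<in> T" "Z \<in> G (\<rho> V) V" unfolding g_def by auto
    then show "countable Z" using G_count T_in[OF _ X] by blast
  next
    fix X Y assume "X \<in> \<D>" "Y \<in> \<D>"
    then show "\<exists>Z\<in>g X \<inter> g Y. X \<inter> Y \<subseteq> Z" using main[of "(X, Y)"] by auto
  qed
qed

text \<open>A set \<open>X\<close> is ranked by the least strict upper bound, so it meets any \<open>Y\<close> of smaller rank
  inside the initial segment of \<open>X\<close> below some \<open>\<gamma> \<in> X\<close>; there are only countably many of these.\<close>

lemma shared_covers_uncountable_cofinality:
  assumes wo: "Well_order r"
    and bounded: "\<And>x. x \<in> countable_subsets (Field r) \<Longrightarrow> \<exists>\<alpha>\<in>Field r. x \<subseteq> underS r \<alpha>"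
    and IH: "\<And>\<alpha>. \<alpha> \<in> Field r \<Longrightarrow> shared_covers (countable_subsets (underS r \<alpha>))"
  shows "shared_covers (countable_subsets (Field r))"
proof -
  have "\<exists>\<alpha>. \<alpha> \<in> Field r \<and> x \<subseteq> underS r \<alpha> \<and> (\<forall>\<beta>\<in>Field r. x \<subseteq> underS r \<beta> \<longrightarrow> (\<alpha>, \<beta>) \<in> r)"
    if x: "x \<in> countable_subsets (Field r)" for x
  proof -
    obtain \<alpha> where "\<alpha> \<in> Field r" "x \<subseteq> underS r \<alpha>" using bounded[OF x] by blast
    then show ?thesis by (rule Well_order_least[OF wo, where P = "\<lambda>\<alpha>. x \<subseteq> underS r \<alpha>"]) blast
  qed
  then obtain \<rho> where \<rho>: "\<And>x. x \<in> countable_subsets (Field r) \<Longrightarrow>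
      \<rho> x \<in> Field r \<and> x \<subseteq> underS r (\<rho> x) \<and> (\<forall>\<beta>\<in>Field r. x \<subseteq> underS r \<beta> \<longrightarrow> (\<rho> x, \<beta>) \<in> r)"
    by metis
  show ?thesis
  proof (rule shared_covers_rank[OF wo, where \<rho> = \<rho>])
    fix X assume X: "X \<in> countable_subsets (Field r)"
    then show "\<rho> X \<in> Field r" using \<rho> by blast
    have le: "\<rho> (X \<inter> underS r \<gamma>) \<in> underS r (\<rho> X)" "X \<inter> underS r \<gamma> \<in> countable_subsets (Field r)"
      if "\<gamma> \<in> X" for \<gamma>
    proof -
      show 1: "X \<inter> underS r \<gamma> \<in> countable_subsets (Field r)" using X by auto
      have "\<gamma> \<in> Field r" using that X by auto
      then have "(\<rho> (X \<inter> underS r \<gamma>), \<gamma>) \<in> r" using \<rho>[OF 1] by auto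
      moreover have "\<gamma> \<in> underS r (\<rho> X)" using \<rho>[OF X] that by auto
      ultimately show "\<rho> (X \<inter> underS r \<gamma>) \<in> underS r (\<rho> X)" by (rule le_underS_trans[OF wo])
    qed
    show "\<exists>W. countable W \<and> W \<subseteq> {Z \<in> countable_subsets (Field r). \<rho> Z \<in> underS r (\<rho> X)} \<and>
        (\<forall>Y\<in>countable_subsets (Field r). \<rho> Y \<in> underS r (\<rho> X) \<longrightarrow> (\<exists>Z\<in>W. X \<inter> Y \<subseteq> Z))"
    proof (intro exI[of _ "(\<lambda>\<gamma>. X \<inter> underS r \<gamma>) ` X"] conjI ballI impI)
      show "countable ((\<lambda>\<gamma>. X \<inter> underS r \<gamma>) ` X)" using X by auto
      show "(\<lambda>\<gamma>. X \<inter> underS r \<gamma>) ` X \<subseteq> {Z \<in> countable_subsets (Field r). \<rho> Z \<in> underS r (\<rho> X)}"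
        using le by blast
      fix Y assume Y: "Y \<in> countable_subsets (Field r)" "\<rho> Y \<in> underS r (\<rho> X)"
      have "\<not> X \<subseteq> underS r (\<rho> Y)"
        using \<rho>[OF X] \<rho>[OF Y(1)] Y(2) not_underS_le[OF wo] by blast
      then obtain \<gamma> where g: "\<gamma> \<in> X" "\<gamma> \<notin> underS r (\<rho> Y)" by blast
      then have "(\<rho> Y, \<gamma>) \<in> r" using underS_or_le[OF wo, of \<gamma> "\<rho> Y"] X \<rho>[OF Y(1)] by auto
      then have "Y \<subseteq> underS r \<gamma>" using \<rho>[OF Y(1)] underS_le_trans[OF wo] by blast
      then show "\<exists>Z\<in>(\<lambda>\<gamma>. X \<inter> underS r \<gamma>) ` X. X \<inter> Y \<subseteq> Z" using g(1) by blast
    qed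
  next
    fix \<alpha> assume "\<alpha> \<in> Field r"
    then show "shared_covers {X \<in> countable_subsets (Field r). \<rho> X = \<alpha>}"
      using \<rho> by (intro shared_covers_cofinal[OF IH]) auto
  qed
qed

section \<open>Cardinals of countable cofinality\<close>

lemma card_of_UN_countable_ordLess:
  assumes \<mu>: "Card_order \<mu>" "\<not> countable (Field \<mu>)" and J: "|J| <o \<mu>"
    and A: "\<And>j. j \<in> J \<Longrightarrow> countable (A j)"
  shows "|\<Union>j\<in>J. A j| <o \<mu>"
proof -
  have inf: "\<not> finite (Field \<mu>)" using \<mu>(2) countable_finite by blast
  have "\<not> \<mu> \<le>o |UNIV :: nat set|"
  proof
    assume "\<mu> \<le>o |UNIV :: nat set|"
    with card_of_Field_ordIso[OF \<mu>(1)] have "|Field \<mu>| \<le>o |UNIV :: nat set|"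
      by (rule ordIso_ordLeq_trans)
    then show False using \<mu>(2) countable_card_of_nat by blast
  qed
  then have nat: "|UNIV :: nat set| <o \<mu>"
    using iffD1[OF not_ordLeq_iff_ordLess[OF card_of_Well_order]] \<mu>(1) card_order_on_def by blast
  let ?B = "J <+> (UNIV :: nat set)"
  have B: "|?B| <o \<mu>" using card_of_Plus_ordLess_infinite_Field[OF inf \<mu>(1) J nat] .
  have "|\<Union>j\<in>J. A j| \<le>o |?B|"
  proof (rule card_of_UNION_ordLeq_infinite)
    show "\<not> finite ?B" by (simp add: finite_Plus_iff)
    show "|J| \<le>o |?B|" by (rule card_of_Plus1)
    show "\<forall>j\<in>J. |A j| \<le>o |?B|"
    proof
      fix j assume "j \<in> J"
      then have "|A j| \<le>o |UNIV :: nat set|" using A countable_card_of_nat by blast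
      then show "|A j| \<le>o |?B|" using card_of_Plus2 by (rule ordLeq_transitive)
    qed
  qed
  then show ?thesis using B ordLeq_ordLess_trans by blast
qed

lemma Card_order_no_max:
  assumes "Card_order \<mu>" "infinite (Field \<mu>)" "a \<in> Field \<mu>"
  shows "\<exists>b\<in>Field \<mu>. a \<in> underS \<mu> b"
  using infinite_Card_order_limit[OF assms] unfolding underS_def by blast

text \<open>Successor cardinals are regular.\<close>

lemma ordLeq_cardSuc_bounded:
  assumes \<mu>: "Card_order \<mu>" "infinite (Field \<mu>)" and B: "B \<subseteq> Field (cardSuc \<mu>)" "|B| \<le>o \<mu>"
  shows "\<exists>\<alpha>\<in>Field (cardSuc \<mu>). B \<subseteq> underS (cardSuc \<mu>) \<alpha>"
proof -
  have r: "Card_order (cardSuc \<mu>)" "infinite (Field (cardSuc \<mu>))"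
    using cardSuc_Card_order[OF \<mu>(1)] cardSuc_finite[OF \<mu>(1)] \<mu>(2) by auto
  have wo: "Well_order (cardSuc \<mu>)" using r(1) by (simp add: card_order_on_def)
  show ?thesis
  proof (rule cardSuc_UNION[OF \<mu>(1) _ _ _ B(2)])
    show "relChain (cardSuc \<mu>) (underS (cardSuc \<mu>))"
      unfolding relChain_def using underS_le_trans[OF wo] by blast
    show "B \<subseteq> (\<Union>i\<in>Field (cardSuc \<mu>). underS (cardSuc \<mu>) i)"
      using B(1) Card_order_no_max[OF r] by blast
  qed (use \<mu> in auto)
qed

text \<open>Cut the index set \<open>J\<close> into countably many pieces \<open>L k\<close> of size less than \<open>\<mu>\<close>, increasing with
  \<open>k\<close>. The members indexed by \<open>L k\<close> lie in a union \<open>A k\<close> of size less than \<open>\<mu>\<close>, so its countable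
  subsets have shared covers. Any two members are caught at a common stage \<open>k\<close>, so it suffices to collect the
  covers over all \<open>k\<close>.\<close>

lemma shared_covers_small_image:
  fixes \<mu> :: "'a rel" and X :: "'b \<Rightarrow> 'a set"
  assumes \<mu>: "Card_order \<mu>" "\<not> countable (Field \<mu>)"
    and K: "countable K" "unbounded_in \<mu> (Field \<mu>) K"
    and IH: "\<And>A :: 'a set. |A| <o \<mu> \<Longrightarrow> shared_covers (countable_subsets A)"
    and X: "\<And>\<beta>. \<beta> \<in> J \<Longrightarrow> countable (X \<beta>)"
    and J: "|J| \<le>o \<mu>"
  shows "shared_covers (X ` J)"
proof -
  have wo: "Well_order \<mu>" using \<mu>(1) by (simp add: card_order_on_def)
  have inf: "infinite (Field \<mu>)" using \<mu>(2) countable_finite by blast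
  have "|J| \<le>o |Field \<mu>|" using J card_of_Field_ordIso[OF \<mu>(1)] ordLeq_ordIso_trans ordIso_symmetric by blast
  then obtain t where t: "inj_on t J" "t ` J \<subseteq> Field \<mu>" using card_of_ordLeq[of J "Field \<mu>"] by blast
  define L where "L k = {\<beta>\<in>J. t \<beta> \<in> underS \<mu> k}" for k
  define A where "A k = (\<Union>\<beta>\<in>L k. X \<beta>)" for k
  have K': "k \<in> Field \<mu>" if "k \<in> K" for k using K(2) that unfolding unbounded_in_def by blast
  have "|L k| <o \<mu>" if "k \<in> K" for k
  proof -
    have "inj_on t (L k)" "t ` L k \<subseteq> underS \<mu> k" using t(1) unfolding L_def inj_on_def by auto
    then have "|L k| \<le>o |underS \<mu> k|" using card_of_ordLeq[of "L k" "underS \<mu> k"] by blast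
    then show ?thesis using card_of_underS[OF \<mu>(1) K'[OF that]] ordLeq_ordLess_trans by blast
  qed
  then have A: "|A k| <o \<mu>" if "k \<in> K" for k
    unfolding A_def using that X by (intro card_of_UN_countable_ordLess[OF \<mu>]) (auto simp: L_def)
  have "\<forall>k\<in>K. \<exists>g. (\<forall>x\<in>countable_subsets (A k). countable (g x) \<and> (\<forall>Z\<in>g x. countable Z)) \<and>
      (\<forall>x\<in>countable_subsets (A k). \<forall>y\<in>countable_subsets (A k). \<exists>Z\<in>g x \<inter> g y. x \<inter> y \<subseteq> Z)"
  proof
    fix k assume "k \<in> K"
    from IH[OF A[OF this]] show "\<exists>g. (\<forall>x\<in>countable_subsets (A k). countable (g x) \<and> (\<forall>Z\<in>g x. countable Z)) \<and>
      (\<forall>x\<in>countable_subsets (A k). \<forall>y\<in>countable_subsets (A k). \<exists>Z\<in>g x \<inter> g y. x \<inter> y \<subseteq> Z)"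
      unfolding shared_covers_def .
  qed
  from bchoice[OF this] obtain g where g: "\<forall>k\<in>K.
      (\<forall>x\<in>countable_subsets (A k). countable (g k x) \<and> (\<forall>Z\<in>g k x. countable Z)) \<and>
      (\<forall>x\<in>countable_subsets (A k). \<forall>y\<in>countable_subsets (A k). \<exists>Z\<in>g k x \<inter> g k y. x \<inter> y \<subseteq> Z)" ..
  have AJ: "Y \<inter> A k \<in> countable_subsets (A k)" if "Y \<in> X ` J" for Y k using X that by auto
  have ex: "\<exists>k\<in>K. \<beta> \<in> L k \<and> \<beta>' \<in> L k" if b: "\<beta> \<in> J" "\<beta>' \<in> J" for \<beta> \<beta>'
  proof -
    have f: "t \<beta> \<in> Field \<mu>" "t \<beta>' \<in> Field \<mu>" using b t(2) by auto
    obtain m where m: "m \<in> Field \<mu>" "t \<beta> \<in> underS \<mu> m" "t \<beta>' \<in> underS \<mu> m"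
    proof (cases "t \<beta> \<in> underS \<mu> (t \<beta>')")
      case True
      then show ?thesis using that Card_order_no_max[OF \<mu>(1) inf f(2)] underS_trans[OF wo True] by blast
    next
      case False
      then have "(t \<beta>', t \<beta>) \<in> \<mu>" using underS_or_le[OF wo f] by blast
      then show ?thesis using that Card_order_no_max[OF \<mu>(1) inf f(1)] le_underS_trans[OF wo] by blast
    qed
    obtain k where "k \<in> K" "(m, k) \<in> \<mu>" using K(2) m(1) unfolding unbounded_in_def by blast
    then show ?thesis unfolding L_def using b m(2,3) underS_le_trans[OF wo] by blast
  qed
  show ?thesis unfolding shared_covers_def
  proof (intro exI[of _ "\<lambda>Y. \<Union>k\<in>K. g k (Y \<inter> A k)"] conjI ballI)
    fix Y assume Y: "Y \<in> X ` J"
    have gk: "countable (g k (Y \<inter> A k)) \<and> (\<forall>Z\<in>g k (Y \<inter> A k). countable Z)" if "k \<in> K" for k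
      using bspec[OF g that] AJ[OF Y, of k] by blast
    show "countable (\<Union>k\<in>K. g k (Y \<inter> A k))" using K(1) gk by auto
    show "countable Z" if "Z \<in> (\<Union>k\<in>K. g k (Y \<inter> A k))" for Z using gk that by blast
    fix Y' assume Y': "Y' \<in> X ` J"
    obtain \<beta> \<beta>' where b: "\<beta> \<in> J" "Y = X \<beta>" "\<beta>' \<in> J" "Y' = X \<beta>'" using Y Y' by blast
    obtain k where k: "k \<in> K" "\<beta> \<in> L k" "\<beta>' \<in> L k" using ex[OF b(1,3)] by blast
    then have s: "Y \<subseteq> A k" "Y' \<subseteq> A k" unfolding A_def b by blast+
    obtain Z where "Z \<in> g k (Y \<inter> A k) \<inter> g k (Y' \<inter> A k)" "(Y \<inter> A k) \<inter> (Y' \<inter> A k) \<subseteq> Z"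
      using bspec[OF g k(1)] AJ[OF Y, of k] AJ[OF Y', of k] by blast
    then show "\<exists>Z\<in>(\<Union>k\<in>K. g k (Y \<inter> A k)) \<inter> (\<Union>k\<in>K. g k (Y' \<inter> A k)). Y \<inter> Y' \<subseteq> Z"
      using k(1) s by (intro bexI[of _ Z]) auto
  qed
qed

text \<open>The family \<open>X\<close> is cofinal in the countable subsets of \<open>\<mu>\<close> and is enumerated along \<open>r = \<mu>\<^sup>+\<close>; \<open>E\<close>
  has size \<open>\<mu>\<close> and contains a cofinal family of countable subsets of each initial segment of \<open>\<mu>\<close> below
  a point of the countable cofinal set \<open>K\<close>.

  The set with index \<open>\<beta>\<close> is ranked by the least \<open>\<delta> > \<beta>\<close> in a club \<open>G\<close>. The point is that, for
  \<open>\<delta> \<in> G\<close> and a countable set \<open>x\<close>, countably many members of \<open>X\<close> with index below \<open>\<delta>\<close> stand for all of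
  them when they are intersected with \<open>x\<close>. Let \<open>e \<gamma>\<close> map \<open>\<mu>\<close> onto a set that includes the
  ordinals up to \<open>\<gamma>\<close>. Every \<open>\<beta> < \<delta>\<close> is \<open>e \<gamma> \<xi>\<close> for some \<open>\<gamma>\<close> in a cofinal subset \<open>M\<close> of \<open>\<delta>\<close> and some \<open>\<xi>\<close> below some \<open>k \<in> K\<close>. For
  fixed \<open>k\<close>, the part of \<open>x\<close> covered by all the sets \<open>X (e \<gamma> \<xi>)\<close> with \<open>\<gamma> \<in> M\<close> and \<open>\<xi> < k\<close> is countable,
  so it involves only countably many \<open>\<gamma>\<close> and \<open>\<xi>\<close>. These \<open>\<xi>\<close> lie in a member of \<open>E\<close>. These \<open>\<gamma>\<close> lie in
  some countable \<open>C \<alpha>\<close> with \<open>\<alpha> < \<delta>\<close> by the square principle with \<open>M = C \<delta>\<close>; if \<open>\<delta>\<close> has countable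
  cofinality, one takes the points of a countable cofinal set one by one instead. As \<open>\<delta>\<close> is closed
  under the operation that assigns to such \<open>\<alpha>\<close> and such a member of \<open>E\<close> an index of a member of \<open>X\<close>
  that covers everything in question, one member of \<open>X\<close> per \<open>k\<close> and \<open>M\<close> is enough.\<close>

lemma shared_covers_countable_cofinality:
  fixes \<mu> :: "'a rel" and C :: "'a set \<Rightarrow> 'a set set" and X :: "'a set \<Rightarrow> 'a set"
  defines "r \<equiv> cardSuc \<mu>"
  assumes \<mu>: "Card_order \<mu>" "\<not> countable (Field \<mu>)"
    and K: "countable K" "unbounded_in \<mu> (Field \<mu>) K"
    and IH: "\<And>A :: 'a set. |A| <o \<mu> \<Longrightarrow> shared_covers (countable_subsets A)"
    and X: "inj_on X (Field r)" "\<And>\<beta>. \<beta> \<in> Field r \<Longrightarrow> X \<beta> \<in> countable_subsets (Field \<mu>)"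
      "\<And>x. x \<in> countable_subsets (Field \<mu>) \<Longrightarrow> \<exists>\<beta>\<in>Field r. x \<subseteq> X \<beta>"
    and E: "|E| \<le>o \<mu>" "\<And>x. x \<in> E \<Longrightarrow> x \<in> countable_subsets (Field \<mu>)"
      "\<And>k x. k \<in> K \<Longrightarrow> x \<in> countable_subsets (underS \<mu> k) \<Longrightarrow> \<exists>y\<in>E. x \<subseteq> y"
    and D: "club r D"
    and C: "\<And>\<delta>. \<delta> \<in> D \<Longrightarrow> \<nexists>K. countable K \<and> unbounded_in r (underS r \<delta>) K \<Longrightarrow>
        unbounded_in r (underS r \<delta>) (C \<delta>) \<and>
        (\<forall>x. x \<subseteq> C \<delta> \<and> countable x \<longrightarrow>
          (\<exists>y. y \<subseteq> underS r \<delta> \<and> countable y \<and> y \<in> C ` underS r \<delta> \<and> x \<subseteq> y))"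
  shows "shared_covers (countable_subsets (Field \<mu>))"
proof -
  have inf: "infinite (Field \<mu>)" using \<mu>(2) countable_finite by blast
  have wo\<mu>: "Well_order \<mu>" using \<mu>(1) by (simp add: card_order_on_def)
  have r: "Card_order r" "infinite (Field r)" unfolding r_def
    using cardSuc_Card_order[OF \<mu>(1)] cardSuc_finite[OF \<mu>(1)] inf by auto
  have wo: "Well_order r" using r(1) by (simp add: card_order_on_def)
  have bdd: "\<exists>\<alpha>\<in>Field r. B \<subseteq> underS r \<alpha>" if "B \<subseteq> Field r" "|B| \<le>o \<mu>" for B
    using ordLeq_cardSuc_bounded[OF \<mu>(1) inf] that unfolding r_def by blast
  have small: "|underS r \<alpha>| \<le>o \<mu>" if "\<alpha> \<in> Field r" for \<alpha>
    using card_of_underS[OF r(1) that] cardSuc_ordLess_ordLeq[OF \<mu>(1)] \<mu>(1)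
    unfolding r_def by (metis card_of_Card_order cardSuc_ordLeq_ordLess)
  have smallC: "|B| \<le>o \<mu>" if "countable B" for B :: "'x set"
  proof -
    have "|B| \<le>o natLeq" using that countable_card_le_natLeq by blast
    moreover have "natLeq \<le>o \<mu>" using inf \<mu>(1) infinite_iff_natLeq_ordLeq card_of_Field_ordIso
      ordLeq_ordIso_trans by blast
    ultimately show ?thesis using ordLeq_transitive by blast
  qed
  have DF: "D \<subseteq> Field r" and Dunb: "\<And>a. a \<in> Field r \<Longrightarrow> \<exists>d\<in>D. (a, d) \<in> r"
    and Dcl: "\<And>\<delta>. \<delta> \<in> Field r \<Longrightarrow> underS r \<delta> \<noteq> {} \<Longrightarrow>
       (\<And>\<beta>. \<beta> \<in> underS r \<delta> \<Longrightarrow> \<exists>\<gamma>\<in>D \<inter> underS r \<delta>. \<beta> \<in> underS r \<gamma>) \<Longrightarrow> \<delta> \<in> D"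
    using D unfolding club_def unbounded_in_def closed_in_def by blast+
  have uF: "underS r \<alpha> \<subseteq> Field r" for \<alpha> unfolding underS_def Field_def by auto
  have "\<exists>e. insert \<alpha> (underS r \<alpha>) \<subseteq> e ` Field \<mu> \<and> e ` Field \<mu> \<subseteq> Field r" if a: "\<alpha> \<in> Field r" for \<alpha>
  proof -
    obtain \<alpha>' where a': "\<alpha>' \<in> Field r" "\<alpha> \<in> underS r \<alpha>'" using Card_order_no_max[OF r a] by blast
    then have ne: "underS r \<alpha>' \<noteq> {}" by blast
    have "|underS r \<alpha>'| \<le>o |Field \<mu>|"
      using small[OF a'(1)] card_of_Field_ordIso[OF \<mu>(1)] ordLeq_ordIso_trans ordIso_symmetric by blast
    from iffD2[OF card_of_ordLeq2[OF ne] this] obtain e where e: "e ` Field \<mu> = underS r \<alpha>'" ..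
    have "insert \<alpha> (underS r \<alpha>) \<subseteq> underS r \<alpha>'" using a'(2) underS_trans[OF wo] by blast
    then show ?thesis using e uF[of \<alpha>'] by (intro exI[of _ e]) simp
  qed
  then have "\<forall>\<alpha>\<in>Field r. \<exists>e. insert \<alpha> (underS r \<alpha>) \<subseteq> e ` Field \<mu> \<and> e ` Field \<mu> \<subseteq> Field r" ..
  from bchoice[OF this] obtain e where "\<forall>\<alpha>\<in>Field r.
      insert \<alpha> (underS r \<alpha>) \<subseteq> e \<alpha> ` Field \<mu> \<and> e \<alpha> ` Field \<mu> \<subseteq> Field r" ..
  note e = bspec[OF this]
  define U where "U c x = (\<Union>\<gamma>\<in>c. \<Union>\<xi>\<in>x. X (e \<gamma> \<xi>))" for c x
  have U_mono: "U c x \<subseteq> U c' x'" if "c \<subseteq> c'" "x \<subseteq> x'" for c c' x x' using that unfolding U_def by blast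
  have U: "U c x \<in> countable_subsets (Field \<mu>)"
    if "countable c" "c \<subseteq> Field r" "x \<in> countable_subsets (Field \<mu>)" for c x
  proof -
    have "X (e \<gamma> \<xi>) \<in> countable_subsets (Field \<mu>)" if "\<gamma> \<in> c" "\<xi> \<in> x" for \<gamma> \<xi>
      using that \<open>c \<subseteq> Field r\<close> \<open>x \<in> _\<close> e[of \<gamma>] by (intro X(2)) blast
    then show ?thesis using that unfolding U_def by (auto simp: subset_iff)
  qed
  define cls where "cls I \<longleftrightarrow> (\<forall>\<alpha>\<in>I. \<forall>c\<in>{C \<alpha>, {\<alpha>}}. countable c \<longrightarrow> c \<subseteq> Field r \<longrightarrow>
     (\<forall>x\<in>E. \<exists>\<beta>\<in>I. U c x \<subseteq> X \<beta>))" for I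
  have clsD: "\<exists>\<beta>\<in>I. U c x \<subseteq> X \<beta>" if I: "cls I" and a: "\<alpha> \<in> I" and c: "c \<in> {C \<alpha>, {\<alpha>}}"
    "countable c" "c \<subseteq> Field r" and x: "x \<in> E" for I \<alpha> c x
    using bspec[OF bspec[OF I[unfolded cls_def] a] c(1), rule_format, OF c(2,3) x] .
  \<comment> \<open>\<open>\<K>\<close> is a countable family with cofinal union: the singletons of the points of a countable cofinal
     subset of \<open>\<delta>\<close>, or just \<open>C \<delta>\<close> if there is no such subset.\<close>
  have good: "\<exists>W. countable W \<and> W \<subseteq> underS r \<delta> \<and> (\<forall>\<beta>\<in>underS r \<delta>. \<exists>\<beta>'\<in>W. x \<inter> X \<beta> \<subseteq> X \<beta>')"
    if \<delta>: "\<delta> \<in> D" "cls (underS r \<delta>)" and x: "countable x" for \<delta> x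
  proof -
    have "\<exists>\<K>. countable \<K> \<and> (\<forall>M\<in>\<K>. M \<subseteq> underS r \<delta>) \<and> (\<forall>\<beta>\<in>underS r \<delta>. \<exists>M\<in>\<K>. \<exists>\<gamma>\<in>M. (\<beta>, \<gamma>) \<in> r) \<and>
       (\<forall>M\<in>\<K>. \<forall>y. y \<subseteq> M \<and> countable y \<longrightarrow>
         (\<exists>\<alpha>\<in>underS r \<delta>. \<exists>c\<in>{C \<alpha>, {\<alpha>}}. countable c \<and> c \<subseteq> underS r \<delta> \<and> y \<subseteq> c))"
    proof (cases "\<exists>K. countable K \<and> unbounded_in r (underS r \<delta>) K")
      case True
      then obtain K' where K': "countable K'" "unbounded_in r (underS r \<delta>) K'" by blast
      show ?thesis
      proof (intro exI[of _ "(\<lambda>\<gamma>. {\<gamma>}) ` K'"] conjI ballI allI impI)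
        fix M y assume "M \<in> (\<lambda>\<gamma>. {\<gamma>}) ` K'" "y \<subseteq> M \<and> countable y"
        then obtain \<gamma> where "\<gamma> \<in> K'" "y \<subseteq> {\<gamma>}" by blast
        then show "\<exists>\<alpha>\<in>underS r \<delta>. \<exists>c\<in>{C \<alpha>, {\<alpha>}}. countable c \<and> c \<subseteq> underS r \<delta> \<and> y \<subseteq> c"
          using K'(2) unfolding unbounded_in_def by (intro bexI[of _ \<gamma>] bexI[of _ "{\<gamma>}"]) auto
      qed (use K' in \<open>auto simp: unbounded_in_def\<close>)
    next
      case False
      have c1: "unbounded_in r (underS r \<delta>) (C \<delta>)"
        and c2: "\<And>x. x \<subseteq> C \<delta> \<Longrightarrow> countable x \<Longrightarrow>
          (\<exists>y. y \<subseteq> underS r \<delta> \<and> countable y \<and> y \<in> C ` underS r \<delta> \<and> x \<subseteq> y)"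
        using C[OF \<delta>(1) False] by auto
      show ?thesis
      proof (intro exI[of _ "{C \<delta>}"] conjI ballI allI impI)
        fix M y assume "M \<in> {C \<delta>}" "y \<subseteq> M \<and> countable y"
        then have "y \<subseteq> C \<delta>" "countable y" by auto
        from c2[OF this] show "\<exists>\<alpha>\<in>underS r \<delta>. \<exists>c\<in>{C \<alpha>, {\<alpha>}}. countable c \<and> c \<subseteq> underS r \<delta> \<and> y \<subseteq> c"
          by blast
      qed (use c1 in \<open>auto simp: unbounded_in_def\<close>)
    qed
    then obtain \<K> where \<K>: "countable \<K>" "\<forall>M\<in>\<K>. M \<subseteq> underS r \<delta>"
       "\<forall>\<beta>\<in>underS r \<delta>. \<exists>M\<in>\<K>. \<exists>\<gamma>\<in>M. (\<beta>, \<gamma>) \<in> r"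
       "\<forall>M\<in>\<K>. \<forall>y. y \<subseteq> M \<and> countable y \<longrightarrow>
         (\<exists>\<alpha>\<in>underS r \<delta>. \<exists>c\<in>{C \<alpha>, {\<alpha>}}. countable c \<and> c \<subseteq> underS r \<delta> \<and> y \<subseteq> c)"
      by (elim exE conjE) (rule that)
    have "\<exists>\<beta>\<in>underS r \<delta>. x \<inter> U M (underS \<mu> k) \<subseteq> X \<beta>" if Mk: "M \<in> \<K>" "k \<in> K" for M k
    proof -
      have "\<forall>p\<in>x \<inter> U M (underS \<mu> k). \<exists>q. q \<in> M \<times> underS \<mu> k \<and> p \<in> X (e (fst q) (snd q))"
        unfolding U_def by auto
      from bchoice[OF this] obtain q where q: "\<forall>p\<in>x \<inter> U M (underS \<mu> k).
         q p \<in> M \<times> underS \<mu> k \<and> p \<in> X (e (fst (q p)) (snd (q p)))" ..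
      define y where "y = (fst \<circ> q) ` (x \<inter> U M (underS \<mu> k))"
      define z where "z = (snd \<circ> q) ` (x \<inter> U M (underS \<mu> k))"
      have yz: "countable y" "y \<subseteq> M" "z \<in> countable_subsets (underS \<mu> k)"
        using q x unfolding y_def z_def by (auto simp: mem_Times_iff)
      have 1: "x \<inter> U M (underS \<mu> k) \<subseteq> U y z"
      proof
        fix p assume p: "p \<in> x \<inter> U M (underS \<mu> k)"
        then have "p \<in> X (e ((fst \<circ> q) p) ((snd \<circ> q) p))" using q by simp
        moreover have "(fst \<circ> q) p \<in> y" "(snd \<circ> q) p \<in> z" using p unfolding y_def z_def by blast+
        ultimately show "p \<in> U y z" unfolding U_def by blast
      qed
      obtain z' where z': "z' \<in> E" "z \<subseteq> z'" using E(3)[OF Mk(2) yz(3)] by blast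
      obtain \<alpha> c where c: "\<alpha> \<in> underS r \<delta>" "c \<in> {C \<alpha>, {\<alpha>}}" "countable c" "c \<subseteq> underS r \<delta>" "y \<subseteq> c"
        using spec[OF bspec[OF \<K>(4) Mk(1)], THEN mp, OF conjI[OF yz(2,1)]]
        by (elim bexE conjE) (rule that)
      have "c \<subseteq> Field r" using c(4) uF by (rule subset_trans)
      then obtain \<beta> where b: "\<beta> \<in> underS r \<delta>" "U c z' \<subseteq> X \<beta>"
        using clsD[OF \<delta>(2) c(1-3) _ z'(1)] by blast
      have "U y z \<subseteq> U c z'" using c(5) z'(2) by (rule U_mono)
      then have "x \<inter> U M (underS \<mu> k) \<subseteq> X \<beta>" using b(2) 1 by (meson subset_trans)
      then show ?thesis using b(1) by (rule bexI)
    qed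
    then have "\<forall>p\<in>\<K> \<times> K. \<exists>\<beta>. \<beta> \<in> underS r \<delta> \<and> x \<inter> U (fst p) (underS \<mu> (snd p)) \<subseteq> X \<beta>"
      by (simp add: Bex_def split_beta)
    from bchoice[OF this] obtain w where
      w': "\<forall>p\<in>\<K> \<times> K. w p \<in> underS r \<delta> \<and> x \<inter> U (fst p) (underS \<mu> (snd p)) \<subseteq> X (w p)" ..
    have w: "w (M, k) \<in> underS r \<delta>" "x \<inter> U M (underS \<mu> k) \<subseteq> X (w (M, k))"
      if "M \<in> \<K>" "k \<in> K" for M k using bspec[OF w', of "(M, k)"] that by auto
    show ?thesis
    proof (intro exI[of _ "w ` (\<K> \<times> K)"] conjI ballI)
      show "countable (w ` (\<K> \<times> K))" using \<K>(1) K(1) by auto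
      show "w ` (\<K> \<times> K) \<subseteq> underS r \<delta>" using w(1) by auto
      fix \<beta> assume b: "\<beta> \<in> underS r \<delta>"
      obtain M \<gamma> where M: "M \<in> \<K>" "\<gamma> \<in> M" "(\<beta>, \<gamma>) \<in> r" using bspec[OF \<K>(3) b] by blast
      have g: "\<gamma> \<in> Field r" using M(3) by (rule FieldI2)
      have "\<beta> \<in> insert \<gamma> (underS r \<gamma>)" using M(3) by (auto simp: underS_def)
      then obtain \<xi> where xi: "\<xi> \<in> Field \<mu>" "\<beta> = e \<gamma> \<xi>" using e[OF g] by blast
      obtain \<xi>' where "\<xi>' \<in> Field \<mu>" "\<xi> \<in> underS \<mu> \<xi>'" using Card_order_no_max[OF \<mu>(1) inf xi(1)] by blast
      moreover from this(1) obtain k where "k \<in> K" "(\<xi>', k) \<in> \<mu>" using K(2) unfolding unbounded_in_def by blast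
      ultimately have k: "k \<in> K" "\<xi> \<in> underS \<mu> k" using underS_le_trans[OF wo\<mu>] by blast+
      have "X \<beta> \<subseteq> U M (underS \<mu> k)" using M(2) xi(2) k(2) unfolding U_def by blast
      then have "x \<inter> X \<beta> \<subseteq> X (w (M, k))" using w(2)[OF M(1) k(1)] by blast
      moreover have "w (M, k) \<in> w ` (\<K> \<times> K)" using M(1) k(1) by blast
      ultimately show "\<exists>\<beta>'\<in>w ` (\<K> \<times> K). x \<inter> X \<beta> \<subseteq> X \<beta>'" by (rule bexI)
    qed
  qed
  \<comment> \<open>A point of \<open>G\<close> above \<open>\<beta>\<^sub>0\<close> is the limit of an \<open>\<omega>\<close>-sequence in \<open>D\<close>, each member of which is above all
     values of the operation at ordinals up to its predecessor.\<close>
  define G where "G = {\<delta>\<in>D. cls (underS r \<delta>)}"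
  have GF: "G \<subseteq> Field r" using DF unfolding G_def by blast
  have G_unbounded: "\<exists>\<delta>\<in>G. \<beta>\<^sub>0 \<in> underS r \<delta>" if \<beta>\<^sub>0: "\<beta>\<^sub>0 \<in> Field r" for \<beta>\<^sub>0
  proof -
    define h where "h c x = (SOME \<beta>. \<beta> \<in> Field r \<and> U c x \<subseteq> X \<beta>)" for c x
    have h: "h c x \<in> Field r" "U c x \<subseteq> X (h c x)"
      if "countable c" "c \<subseteq> Field r" "x \<in> E" for c x
    proof -
      have "\<exists>\<beta>. \<beta> \<in> Field r \<and> U c x \<subseteq> X \<beta>"
        using X(3)[OF U[OF that(1,2) E(2)[OF that(3)]]] by blast
      from someI_ex[OF this] show "h c x \<in> Field r" "U c x \<subseteq> X (h c x)" unfolding h_def by auto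
    qed
    define H where "H \<alpha> = (h (C \<alpha>) ` E \<union> h {\<alpha>} ` E) \<inter> Field r" for \<alpha>
    have H_small: "|H \<alpha>| \<le>o \<mu>" for \<alpha>
    proof -
      have "|h (C \<alpha>) ` E| \<le>o \<mu>" "|h {\<alpha>} ` E| \<le>o \<mu>"
        by (rule ordLeq_transitive[OF card_of_image E(1)])+
      then have "|h (C \<alpha>) ` E \<union> h {\<alpha>} ` E| \<le>o \<mu>" by (rule card_of_Un_ordLeq_infinite_Field[OF inf _ _ \<mu>(1)])
      moreover have "|H \<alpha>| \<le>o |h (C \<alpha>) ` E \<union> h {\<alpha>} ` E|" unfolding H_def by (rule card_of_mono1) blast
      ultimately show ?thesis using ordLeq_transitive by blast
    qed
    have "\<exists>d. d \<in> D \<and> \<beta> \<in> underS r d \<and> (\<forall>\<alpha>. (\<alpha>, \<beta>) \<in> r \<longrightarrow> H \<alpha> \<subseteq> underS r d)" if b: "\<beta> \<in> Field r" for \<beta>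
    proof -
      obtain \<beta>' where b': "\<beta>' \<in> Field r" "\<beta> \<in> underS r \<beta>'" using Card_order_no_max[OF r b] by blast
      have "|\<Union>\<alpha>\<in>underS r \<beta>'. H \<alpha>| \<le>o \<mu>"
        using small[OF b'(1)] H_small by (intro card_of_UNION_ordLeq_infinite_Field[OF inf \<mu>(1)]) auto
      moreover have "(\<Union>\<alpha>\<in>underS r \<beta>'. H \<alpha>) \<subseteq> Field r" unfolding H_def by blast
      ultimately obtain \<alpha>' where a': "\<alpha>' \<in> Field r" "(\<Union>\<alpha>\<in>underS r \<beta>'. H \<alpha>) \<subseteq> underS r \<alpha>'" using bdd by blast
      obtain m where m: "m \<in> Field r" "\<beta> \<in> underS r m" "underS r \<alpha>' \<subseteq> underS r m"
      proof (cases "\<beta> \<in> underS r \<alpha>'")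
        case True
        then show ?thesis using that a'(1) by blast
      next
        case False
        then have "(\<alpha>', \<beta>) \<in> r" using underS_or_le[OF wo b a'(1)] by blast
        then have "\<alpha>' \<in> underS r \<beta>'" using b'(2) by (rule le_underS_trans[OF wo])
        then have "underS r \<alpha>' \<subseteq> underS r \<beta>'" using underS_trans[OF wo] by blast
        then show ?thesis using that b' by blast
      qed
      obtain d where d: "d \<in> D" "(m, d) \<in> r" using Dunb[OF m(1)] by blast
      then have sub: "underS r m \<subseteq> underS r d" using underS_le_trans[OF wo] by blast
      have "H \<alpha> \<subseteq> underS r d" if "(\<alpha>, \<beta>) \<in> r" for \<alpha>
      proof -
        have "\<alpha> \<in> underS r \<beta>'" using that b'(2) by (rule le_underS_trans[OF wo])
        then show ?thesis using a'(2) m(3) sub by blast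
      qed
      then show ?thesis using d(1) m(2) sub by blast
    qed
    then have "\<forall>\<beta>\<in>Field r. \<exists>d. d \<in> D \<and> \<beta> \<in> underS r d \<and> (\<forall>\<alpha>. (\<alpha>, \<beta>) \<in> r \<longrightarrow> H \<alpha> \<subseteq> underS r d)" ..
    from bchoice[OF this] obtain s where s: "\<forall>\<beta>\<in>Field r. s \<beta> \<in> D \<and> \<beta> \<in> underS r (s \<beta>) \<and>
        (\<forall>\<alpha>. (\<alpha>, \<beta>) \<in> r \<longrightarrow> H \<alpha> \<subseteq> underS r (s \<beta>))" ..
    define d where "d n = (s ^^ n) \<beta>\<^sub>0" for n
    have d_Suc: "d (Suc n) = s (d n)" for n unfolding d_def by simp
    have dF: "d n \<in> Field r" for n
    proof (induction n)
      case 0 then show ?case using \<beta>\<^sub>0 by (simp add: d_def)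
    next
      case (Suc n) then show ?case using bspec[OF s Suc] DF d_Suc by auto
    qed
    have dS: "d (Suc n) \<in> D" "d n \<in> underS r (d (Suc n))" "(\<alpha>, d n) \<in> r \<Longrightarrow> H \<alpha> \<subseteq> underS r (d (Suc n))" for n \<alpha>
      using bspec[OF s dF[of n]] unfolding d_Suc by auto
    have "|range d| \<le>o \<mu>" by (rule smallC) simp
    moreover have "range d \<subseteq> Field r" using dF by blast
    ultimately obtain \<delta>\<^sub>0 where "\<delta>\<^sub>0 \<in> Field r" "range d \<subseteq> underS r \<delta>\<^sub>0" using bdd by blast
    then obtain \<delta> where \<delta>: "\<delta> \<in> Field r" "range d \<subseteq> underS r \<delta>"
      "\<And>z. z \<in> underS r \<delta> \<Longrightarrow> \<not> range d \<subseteq> underS r z"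
      by (rule Well_order_least[OF wo, where P = "\<lambda>\<delta>. range d \<subseteq> underS r \<delta>"]) (rule that)
    have d\<delta>: "d n \<in> underS r \<delta>" for n using \<delta>(2) by blast
    have le: "\<exists>n. (\<beta>, d n) \<in> r" if b: "\<beta> \<in> underS r \<delta>" for \<beta>
    proof -
      obtain n where "d n \<notin> underS r \<beta>" using \<delta>(3)[OF b] by blast
      moreover have "\<beta> \<in> Field r" using b uF by blast
      ultimately show ?thesis using underS_or_le[OF wo dF] by blast
    qed
    have "\<delta> \<in> D"
    proof (rule Dcl[OF \<delta>(1)])
      show "underS r \<delta> \<noteq> {}" using d\<delta> by blast
      fix \<beta> assume "\<beta> \<in> underS r \<delta>"
      then obtain n where "(\<beta>, d n) \<in> r" using le by blast
      then have "\<beta> \<in> underS r (d (Suc n))" using dS(2) by (rule le_underS_trans[OF wo])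
      then show "\<exists>\<gamma>\<in>D \<inter> underS r \<delta>. \<beta> \<in> underS r \<gamma>" using dS(1) d\<delta> by blast
    qed
    moreover have "cls (underS r \<delta>)" unfolding cls_def
    proof (intro ballI impI)
      fix \<alpha> c x assume a: "\<alpha> \<in> underS r \<delta>" and c: "c \<in> {C \<alpha>, {\<alpha>}}" "countable c" "c \<subseteq> Field r" and x: "x \<in> E"
      obtain n where "(\<alpha>, d n) \<in> r" using le[OF a] by blast
      then have "H \<alpha> \<subseteq> underS r (d (Suc n))" by (rule dS(3))
      moreover have "h c x \<in> H \<alpha>" using h(1)[OF c(2,3) x] c(1) x unfolding H_def by blast
      ultimately have "h c x \<in> underS r (d (Suc n))" by blast
      then have "h c x \<in> underS r \<delta>" using d\<delta> by (rule underS_trans[OF wo])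
      then show "\<exists>\<beta>\<in>underS r \<delta>. U c x \<subseteq> X \<beta>" using h(2)[OF c(2,3) x] by blast
    qed
    ultimately have "\<delta> \<in> G" unfolding G_def by blast
    moreover have "\<beta>\<^sub>0 \<in> underS r \<delta>" using d\<delta>[of 0] by (simp add: d_def)
    ultimately show ?thesis by blast
  qed
  \<comment> \<open>The indices with rank below \<open>\<alpha>\<close> form the initial segment \<open>I\<close> of all ordinals below some point of
     \<open>G\<close> that is below \<open>\<alpha>\<close>. If these points have no maximum, then \<open>I\<close> is given by a limit of them.
     That limit belongs to \<open>D\<close>, because \<open>D\<close> is closed, and it is closed under the operation.\<close>
  have good_below: "\<exists>W. countable W \<and> W \<subseteq> I \<and> (\<forall>\<beta>\<in>I. \<exists>\<beta>'\<in>W. x \<inter> X \<beta> \<subseteq> X \<beta>')"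
    if \<alpha>: "\<alpha> \<in> Field r" and I: "I = (\<Union>\<delta>\<in>G \<inter> underS r \<alpha>. underS r \<delta>)" and x: "countable x" for \<alpha> I x
  proof (cases "\<exists>\<delta>\<in>G \<inter> underS r \<alpha>. \<forall>\<delta>'\<in>G \<inter> underS r \<alpha>. (\<delta>', \<delta>) \<in> r")
    case True
    then obtain \<delta> where d: "\<delta> \<in> G" "\<delta> \<in> underS r \<alpha>" "\<And>\<delta>'. \<delta>' \<in> G \<inter> underS r \<alpha> \<Longrightarrow> (\<delta>', \<delta>) \<in> r" by blast
    have "I = underS r \<delta>" unfolding I using d underS_le_trans[OF wo] by blast
    then show ?thesis using good[OF _ _ x] d(1) unfolding G_def by blast
  next
    case False
    have next_G: "\<exists>\<delta>'\<in>G \<inter> underS r \<alpha>. \<delta> \<in> underS r \<delta>'" if d: "\<delta> \<in> G \<inter> underS r \<alpha>" for \<delta>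
    proof -
      obtain \<delta>' where "\<delta>' \<in> G \<inter> underS r \<alpha>" "(\<delta>', \<delta>) \<notin> r" using False d by blast
      then show ?thesis using underS_or_le[OF wo, of \<delta> \<delta>'] GF d by blast
    qed
    have I_in: "\<delta> \<in> I" if "\<delta> \<in> G \<inter> underS r \<alpha>" for \<delta> using next_G[OF that] unfolding I by blast
    have "\<alpha> \<notin> I"
    proof
      assume "\<alpha> \<in> I"
      then obtain \<delta> where "\<alpha> \<in> underS r \<delta>" "\<delta> \<in> underS r \<alpha>" unfolding I by blast
      then have "\<alpha> \<in> underS r \<alpha>" by (rule underS_trans[OF wo])
      then show False by (simp add: underS_def)
    qed
    with \<alpha> obtain \<delta> where \<delta>: "\<delta> \<in> Field r" "\<delta> \<notin> I" "\<And>z. z \<in> underS r \<delta> \<Longrightarrow> \<not> z \<notin> I"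
      by (rule Well_order_least[OF wo, where P = "\<lambda>z. z \<notin> I"]) (rule that)
    have "z \<in> underS r \<delta>" if "z \<in> I" for z
    proof (rule ccontr)
      assume "z \<notin> underS r \<delta>"
      moreover have "z \<in> Field r" using that uF unfolding I by blast
      ultimately have "(\<delta>, z) \<in> r" using underS_or_le[OF wo _ \<delta>(1)] by blast
      then show False using that \<delta>(2) le_underS_trans[OF wo] unfolding I by blast
    qed
    then have I': "I = underS r \<delta>" using \<delta>(3) by blast
    show ?thesis
    proof (cases "I = {}")
      case True
      then show ?thesis by (intro exI[of _ "{}"]) auto
    next
      case False
      have "\<delta> \<in> D"
      proof (rule Dcl[OF \<delta>(1)])
        show "underS r \<delta> \<noteq> {}" using False I' by blast
        fix \<beta> assume "\<beta> \<in> underS r \<delta>"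
        then have "\<beta> \<in> I" using I' by blast
        then obtain \<delta>' where d': "\<delta>' \<in> G \<inter> underS r \<alpha>" "\<beta> \<in> underS r \<delta>'" unfolding I by blast
        then show "\<exists>\<gamma>\<in>D \<inter> underS r \<delta>. \<beta> \<in> underS r \<gamma>" using I_in[OF d'(1)] I' unfolding G_def by blast
      qed
      moreover have "cls I" unfolding cls_def
      proof (intro ballI impI)
        fix \<alpha>' c z assume a: "\<alpha>' \<in> I" and c: "c \<in> {C \<alpha>', {\<alpha>'}}" "countable c" "c \<subseteq> Field r" and z: "z \<in> E"
        obtain \<delta>' where d': "\<delta>' \<in> G" "\<delta>' \<in> underS r \<alpha>" "\<alpha>' \<in> underS r \<delta>'" using a unfolding I by blast
        then have "cls (underS r \<delta>')" unfolding G_def by blast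
        then obtain \<beta> where "\<beta> \<in> underS r \<delta>'" "U c z \<subseteq> X \<beta>" using clsD[OF _ d'(3) c z] by blast
        then show "\<exists>\<beta>\<in>I. U c z \<subseteq> X \<beta>" using d' unfolding I by blast
      qed
      ultimately show ?thesis using good[OF _ _ x, of \<delta>] I' by simp
    qed
  qed
  define idx where "idx = inv_into (Field r) X"
  have idx: "idx Y \<in> Field r" "X (idx Y) = Y" if "Y \<in> X ` Field r" for Y
    using that unfolding idx_def by (rule inv_into_into, rule f_inv_into_f)
  have idx_X: "idx (X \<beta>) = \<beta>" if "\<beta> \<in> Field r" for \<beta> unfolding idx_def using X(1) that by (rule inv_into_f_f)
  have "\<exists>\<delta>. \<delta> \<in> G \<and> \<beta> \<in> underS r \<delta> \<and> (\<forall>\<delta>'\<in>G. \<beta> \<in> underS r \<delta>' \<longrightarrow> (\<delta>, \<delta>') \<in> r)" if b: "\<beta> \<in> Field r" for \<beta>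
  proof -
    obtain \<delta> where d: "\<delta> \<in> G" "\<beta> \<in> underS r \<delta>" using G_unbounded[OF b] by blast
    show ?thesis
      by (rule Well_order_least[OF wo, of \<delta> "\<lambda>\<delta>. \<delta> \<in> G \<and> \<beta> \<in> underS r \<delta>"]) (use d GF in blast)+
  qed
  then have "\<forall>\<beta>\<in>Field r. \<exists>\<delta>. \<delta> \<in> G \<and> \<beta> \<in> underS r \<delta> \<and> (\<forall>\<delta>'\<in>G. \<beta> \<in> underS r \<delta>' \<longrightarrow> (\<delta>, \<delta>') \<in> r)" ..
  from bchoice[OF this] obtain \<rho> where \<rho>': "\<forall>\<beta>\<in>Field r. \<rho> \<beta> \<in> G \<and> \<beta> \<in> underS r (\<rho> \<beta>) \<and>
      (\<forall>\<delta>'\<in>G. \<beta> \<in> underS r \<delta>' \<longrightarrow> (\<rho> \<beta>, \<delta>') \<in> r)" ..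
  have \<rho>: "\<rho> \<beta> \<in> G" "\<beta> \<in> underS r (\<rho> \<beta>)" "\<delta>' \<in> G \<Longrightarrow> \<beta> \<in> underS r \<delta>' \<Longrightarrow> (\<rho> \<beta>, \<delta>') \<in> r"
    if "\<beta> \<in> Field r" for \<beta> \<delta>' using bspec[OF \<rho>' that] by auto
  have \<rho>_less: "\<rho> \<beta> \<in> underS r \<alpha> \<longleftrightarrow> \<beta> \<in> (\<Union>\<delta>\<in>G \<inter> underS r \<alpha>. underS r \<delta>)" if b: "\<beta> \<in> Field r" for \<alpha> \<beta>
  proof
    assume "\<rho> \<beta> \<in> underS r \<alpha>"
    then show "\<beta> \<in> (\<Union>\<delta>\<in>G \<inter> underS r \<alpha>. underS r \<delta>)" using \<rho>(1,2)[OF b] by blast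
  next
    assume "\<beta> \<in> (\<Union>\<delta>\<in>G \<inter> underS r \<alpha>. underS r \<delta>)"
    then obtain \<delta> where d: "\<delta> \<in> G" "\<delta> \<in> underS r \<alpha>" "\<beta> \<in> underS r \<delta>" by blast
    from \<rho>(3)[OF b d(1,3)] d(2) show "\<rho> \<beta> \<in> underS r \<alpha>" by (rule le_underS_trans[OF wo])
  qed
  have "shared_covers (X ` Field r)"
  proof (rule shared_covers_rank[OF wo, where \<rho> = "\<lambda>Y. \<rho> (idx Y)"])
    fix Y assume Y: "Y \<in> X ` Field r"
    show F: "\<rho> (idx Y) \<in> Field r" using \<rho>(1)[OF idx(1)[OF Y]] GF by blast
    let ?I = "\<Union>\<delta>\<in>G \<inter> underS r (\<rho> (idx Y)). underS r \<delta>"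
    have "countable Y" using X(2) Y by blast
    from good_below[OF F refl this] obtain W where W: "countable W" "W \<subseteq> ?I"
        "\<forall>\<beta>\<in>?I. \<exists>\<beta>'\<in>W. Y \<inter> X \<beta> \<subseteq> X \<beta>'" by blast
    have WF: "W \<subseteq> Field r" using W(2) uF by blast
    show "\<exists>W. countable W \<and> W \<subseteq> {Z \<in> X ` Field r. \<rho> (idx Z) \<in> underS r (\<rho> (idx Y))} \<and>
        (\<forall>Y'\<in>X ` Field r. \<rho> (idx Y') \<in> underS r (\<rho> (idx Y)) \<longrightarrow> (\<exists>Z\<in>W. Y \<inter> Y' \<subseteq> Z))"
    proof (intro exI[of _ "X ` W"] conjI ballI impI subsetI)
      show "countable (X ` W)" using W(1) by simp
      fix Z assume "Z \<in> X ` W"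
      then obtain \<beta> where b: "\<beta> \<in> W" "Z = X \<beta>" by blast
      then have "\<beta> \<in> Field r" "\<beta> \<in> ?I" using WF W(2) by blast+
      then show "Z \<in> {Z \<in> X ` Field r. \<rho> (idx Z) \<in> underS r (\<rho> (idx Y))}"
        using \<rho>_less[of \<beta>] b(2) by (simp add: idx_X)
    next
      fix Y' assume Y': "Y' \<in> X ` Field r" "\<rho> (idx Y') \<in> underS r (\<rho> (idx Y))"
      then have "idx Y' \<in> ?I" using \<rho>_less[OF idx(1)[OF Y'(1)]] by blast
      then obtain \<beta>' where "\<beta>' \<in> W" "Y \<inter> X (idx Y') \<subseteq> X \<beta>'" using W(3) by blast
      then show "\<exists>Z\<in>X ` W. Y \<inter> Y' \<subseteq> Z" using idx(2)[OF Y'(1)] by auto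
    qed
  next
    fix \<alpha> assume a: "\<alpha> \<in> Field r"
    have "shared_covers (X ` underS r \<alpha>)"
      using X(2) uF small[OF a] by (intro shared_covers_small_image[OF \<mu> K IH]) auto
    moreover have "{Y \<in> X ` Field r. \<rho> (idx Y) = \<alpha>} \<subseteq> X ` underS r \<alpha>"
      using \<rho>(2) idx_X by auto
    ultimately show "shared_covers {Y \<in> X ` Field r. \<rho> (idx Y) = \<alpha>}"
      using shared_covers_cofinal[of "X ` underS r \<alpha>" "{Y \<in> X ` Field r. \<rho> (idx Y) = \<alpha>}"] by blast
  qed
  then show ?thesis
  proof (rule shared_covers_cofinal)
    fix x assume "x \<in> countable_subsets (Field \<mu>)"
    from X(3)[OF this] show "\<exists>X'\<in>X ` Field r. x \<subseteq> X'" by blast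
  qed
qed

section \<open>Covering all countable subsets of a cardinal\<close>

lemma cf_in_attained:
  assumes "Well_order r" "A \<subseteq> Field r"
  shows "\<exists>K. unbounded_in r A K \<and> cf_in r A = |K| \<and> (\<forall>L. unbounded_in r A L \<longrightarrow> |K| \<le>o |L| )"
proof -
  have "(a, a) \<in> r" if "a \<in> A" for a
    using assms that by (auto simp: order_on_defs refl_on_def)
  then have "unbounded_in r A A" unfolding unbounded_in_def by blast
  then have "{K. unbounded_in r A K} \<noteq> {}" by blast
  from least_card_attained[OF this] show ?thesis unfolding cf_in_def by blast
qed

text \<open>The square principle speaks only about ordinals of cofinality at least \<open>\<aleph>\<^sub>1\<close>; these include all
  those without a countable cofinal subset.\<close>

lemma uncountable_cf_in:
  assumes "Well_order r" "A \<subseteq> Field r" "\<nexists>K. countable K \<and> unbounded_in r A K"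
  shows "cardSuc natLeq \<le>o cf_in r A"
proof -
  obtain K where K: "unbounded_in r A K" "cf_in r A = |K|" using cf_in_attained[OF assms(1,2)] by blast
  then have "\<not> |K| \<le>o natLeq" using assms(3) countable_card_le_natLeq by blast
  then have "natLeq <o |K|"
    using not_ordLeq_iff_ordLess[OF natLeq_Well_order card_of_Well_order] by blast
  then show ?thesis unfolding K(2) by (rule cardSuc_least[OF natLeq_Card_order card_of_Card_order])
qed

lemma uncountable_natLeq_ordLess:
  assumes "Card_order \<mu>" "\<not> countable (Field \<mu>)"
  shows "natLeq <o \<mu>"
proof -
  have "\<not> \<mu> \<le>o natLeq"
  proof
    assume "\<mu> \<le>o natLeq"
    with card_of_Field_ordIso[OF assms(1)] have "|Field \<mu>| \<le>o natLeq" by (rule ordIso_ordLeq_trans)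
    then show False using assms(2) countable_card_le_natLeq by blast
  qed
  then show ?thesis
    using iffD1[OF not_ordLeq_iff_ordLess[OF natLeq_Well_order]] assms(1) card_order_on_def by blast
qed

text \<open>An uncountable cardinal with a countable cofinal subset is singular of cofinality \<open>\<omega>\<close>, which is
  the case that the hypotheses on \<open>lambda\<close> address. A finite set is not cofinal, as it would
  contain the maximum of an infinite cardinal.\<close>

lemma countable_cofinality:
  assumes \<mu>: "Card_order \<mu>" "\<not> countable (Field \<mu>)"
    and K: "countable K" "unbounded_in \<mu> (Field \<mu>) K"
  shows "cf \<mu> =o natLeq" "cf \<mu> <o \<mu>"
proof -
  have wo: "Well_order \<mu>" using \<mu>(1) by (simp add: card_order_on_def)
  have inf: "infinite (Field \<mu>)" using \<mu>(2) countable_finite by blast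
  obtain L where L: "unbounded_in \<mu> (Field \<mu>) L" "cf \<mu> = |L|" "|L| \<le>o |K|"
    using cf_in_attained[OF wo subset_refl] K(2) by blast
  have "|K| \<le>o natLeq" using K(1) countable_card_le_natLeq by blast
  with L(3) have le: "|L| \<le>o natLeq" by (rule ordLeq_transitive)
  have "L \<noteq> {}" using L(1) inf unfolding unbounded_in_def by (metis all_not_in_conv finite.emptyI)
  have "infinite L"
  proof
    assume "finite L"
    moreover have "\<forall>F. F \<subseteq> L \<longrightarrow> F \<noteq> {} \<longrightarrow> finite F \<longrightarrow> (\<exists>m\<in>F. \<forall>x\<in>F. (x, m) \<in> \<mu>)"
    proof (intro allI impI)
      fix F assume F: "F \<subseteq> L" "F \<noteq> {}" "finite F"
      from F(3,2,1) show "\<exists>m\<in>F. \<forall>x\<in>F. (x, m) \<in> \<mu>"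
      proof (induction rule: finite_ne_induct)
        case (singleton x)
        then show ?case using L(1) wo by (auto simp: unbounded_in_def order_on_defs refl_on_def)
      next
        case (insert x F)
        then obtain m where m: "m \<in> F" "\<forall>y\<in>F. (y, m) \<in> \<mu>" by blast
        have f: "x \<in> Field \<mu>" "m \<in> Field \<mu>" using insert.prems m(1) L(1) unfolding unbounded_in_def by blast+
        show ?case
        proof (cases "(x, m) \<in> \<mu>")
          case True then show ?thesis using m by blast
        next
          case False
          then have "m \<in> underS \<mu> x" using underS_or_le[OF wo f(2) f(1)] by blast
          then have "\<forall>y\<in>F. y \<in> underS \<mu> x" using m(2) le_underS_trans[OF wo] by blast
          moreover have "(x, x) \<in> \<mu>" using f(1) wo by (auto simp: order_on_defs refl_on_def)
          ultimately show ?thesis by (intro bexI[of _ x]) (auto simp: underS_def)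
        qed
      qed
    qed
    ultimately obtain m where m: "m \<in> L" "\<forall>x\<in>L. (x, m) \<in> \<mu>" using \<open>L \<noteq> {}\<close> by blast
    have "m \<in> Field \<mu>" using m(1) L(1) unfolding unbounded_in_def by blast
    from Card_order_no_max[OF \<mu>(1) inf this] obtain b where "b \<in> Field \<mu>" "m \<in> underS \<mu> b" by blast
    moreover from this(1) obtain x where "x \<in> L" "(b, x) \<in> \<mu>" using L(1) unfolding unbounded_in_def by blast
    ultimately have "m \<in> underS \<mu> m" using m(2) underS_le_trans[OF wo] by blast
    then show False by (simp add: underS_def)
  qed
  then have "natLeq \<le>o |L|" using infinite_iff_natLeq_ordLeq by blast
  with le show "cf \<mu> =o natLeq" unfolding L(2) using ordIso_iff_ordLeq by blast
  show "cf \<mu> <o \<mu>" unfolding L(2) using le uncountable_natLeq_ordLess[OF \<mu>] by (rule ordLeq_ordLess_trans)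
qed

lemma cofinal_ctbl_infinite_subsets:
  assumes inf: "infinite A" and \<X>: "\<forall>x\<in>ctbl_infinite_subsets A. \<exists>y\<in>\<X>. x \<subseteq> y"
    and x: "x \<in> countable_subsets A"
  shows "\<exists>y\<in>\<X>. x \<subseteq> y"
proof -
  obtain N where N: "N \<subseteq> A" "countable N" "infinite N" using infinite_countable_subset'[OF inf] by blast
  have "infinite (x \<union> N)" "countable (x \<union> N)" using N x by auto
  then have "|x \<union> N| =o natLeq"
    using infinite_iff_natLeq_ordLeq countable_card_le_natLeq ordIso_iff_ordLeq by blast
  then have "x \<union> N \<in> ctbl_infinite_subsets A" using x N(1) unfolding ctbl_infinite_subsets_def by blast
  from bspec[OF \<X> this] show ?thesis by blast
qed

lemma cof_ctbl_subsets_attained: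
  assumes inf: "infinite (Field \<mu>)"
  shows "\<exists>\<X>. \<X> \<subseteq> countable_subsets (Field \<mu>) \<and> |\<X>| =o cof_ctbl_subsets \<mu> \<and>
    (\<forall>x\<in>countable_subsets (Field \<mu>). \<exists>y\<in>\<X>. x \<subseteq> y)"
proof -
  let ?F = "{\<X>. \<X> \<subseteq> ctbl_infinite_subsets (Field \<mu>) \<and> (\<forall>x\<in>ctbl_infinite_subsets (Field \<mu>). \<exists>y\<in>\<X>. x \<subseteq> y)}"
  have "ctbl_infinite_subsets (Field \<mu>) \<in> ?F" by blast
  then have "?F \<noteq> {}" by blast
  from least_card_attained[OF this] obtain \<X> where \<X>: "\<X> \<in> ?F" "cof_ctbl_subsets \<mu> = |\<X>|"
    unfolding cof_ctbl_subsets_def by blast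
  show ?thesis
  proof (intro exI[of _ \<X>] conjI ballI)
    have "countable x" if "|x| =o natLeq" for x :: "'a set"
      using that countable_card_le_natLeq ordIso_iff_ordLeq by blast
    then have "ctbl_infinite_subsets (Field \<mu>) \<subseteq> countable_subsets (Field \<mu>)"
      unfolding ctbl_infinite_subsets_def by blast
    then show "\<X> \<subseteq> countable_subsets (Field \<mu>)" using \<X>(1) by blast
    show "|\<X>| =o cof_ctbl_subsets \<mu>" unfolding \<X>(2) by (rule card_of_refl)
    show "\<exists>y\<in>\<X>. x \<subseteq> y" if "x \<in> countable_subsets (Field \<mu>)" for x
      using cofinal_ctbl_infinite_subsets[OF inf _ that] \<X>(1) by simp
  qed
qed

text \<open>By induction on \<open>\<nu>\<close>, the countable subsets of \<open>\<nu>\<close> have a cofinal family of size at most \<open>\<nu>\<^sup>+\<close>: in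
  countable cofinality this is assumed, and in uncountable cofinality every countable subset is
  bounded. Stating the bound as \<open>\<mu> > \<nu>\<close> keeps all cardinals on the same type.\<close>

lemma small_cofinal_family:
  fixes lambda \<mu> \<nu> :: "'a rel"
  assumes cof: "\<And>\<mu> :: 'a rel. Card_order \<mu> \<Longrightarrow> \<mu> <o lambda \<Longrightarrow> cf \<mu> <o \<mu> \<Longrightarrow> cf \<mu> =o natLeq \<Longrightarrow>
      cof_ctbl_subsets \<mu> =o cardSuc \<mu>"
    and \<nu>: "Card_order \<nu>" "\<nu> <o lambda" and \<mu>: "Card_order \<mu>" "\<nu> <o \<mu>" "infinite (Field \<mu>)"
  shows "\<exists>\<X>. \<X> \<subseteq> countable_subsets (Field \<nu>) \<and> |\<X>| \<le>o \<mu> \<and> (\<forall>x\<in>countable_subsets (Field \<nu>). \<exists>y\<in>\<X>. x \<subseteq> y)"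
  using \<nu> \<mu>(2)
proof (induction \<nu> rule: wf_induct_rule[OF wf_ordLess])
  case (1 \<nu>)
  note \<nu> = 1(2-4)
  have wo: "Well_order \<nu>" using \<nu>(1) by (simp add: card_order_on_def)
  show ?case
  proof (cases "countable (Field \<nu>)")
    case True
    have "|{Field \<nu>}| \<le>o \<mu>" using Card_order_singl_ordLeq[OF \<mu>(1)] \<mu>(3) by (metis finite.emptyI)
    then show ?thesis using True by (intro exI[of _ "{Field \<nu>}"]) auto
  next
    case unc: False
    have inf: "infinite (Field \<nu>)" using unc countable_finite by blast
    show ?thesis
    proof (cases "\<exists>K. countable K \<and> unbounded_in \<nu> (Field \<nu>) K")
      case True
      then obtain K where K: "countable K" "unbounded_in \<nu> (Field \<nu>) K" by blast
      have "cof_ctbl_subsets \<nu> =o cardSuc \<nu>"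
        using cof[OF \<nu>(1,2)] countable_cofinality[OF \<nu>(1) unc K] by blast
      moreover have "cardSuc \<nu> \<le>o \<mu>" using cardSuc_least[OF \<nu>(1) \<mu>(1) \<nu>(3)] .
      ultimately have le: "cof_ctbl_subsets \<nu> \<le>o \<mu>" by (rule ordIso_ordLeq_trans)
      obtain \<X> where \<X>: "\<X> \<subseteq> countable_subsets (Field \<nu>)" "|\<X>| =o cof_ctbl_subsets \<nu>"
        "\<forall>x\<in>countable_subsets (Field \<nu>). \<exists>y\<in>\<X>. x \<subseteq> y"
        using cof_ctbl_subsets_attained[OF inf] by (elim exE conjE) (rule that)
      have "|\<X>| \<le>o \<mu>" using \<X>(2) le by (rule ordIso_ordLeq_trans)
      then show ?thesis using \<X>(1,3) by (intro exI[of _ \<X>] conjI)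
    next
      case False
      have ex: "\<exists>\<X>. \<X> \<subseteq> countable_subsets (underS \<nu> \<alpha>) \<and> |\<X>| \<le>o \<mu> \<and>
          (\<forall>x\<in>countable_subsets (underS \<nu> \<alpha>). \<exists>y\<in>\<X>. x \<subseteq> y)" if a: "\<alpha> \<in> Field \<nu>" for \<alpha>
      proof -
        have lt: "|underS \<nu> \<alpha>| <o \<nu>" using card_of_underS[OF \<nu>(1) a] .
        have "|underS \<nu> \<alpha>| <o lambda" "|underS \<nu> \<alpha>| <o \<mu>" using lt \<nu>(2,3) ordLess_transitive by blast+
        from 1(1)[OF lt card_of_Card_order this] show ?thesis by (simp add: Field_card_of)
      qed
      then have "\<forall>\<alpha>\<in>Field \<nu>. \<exists>\<X>. \<X> \<subseteq> countable_subsets (underS \<nu> \<alpha>) \<and> |\<X>| \<le>o \<mu> \<and>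
          (\<forall>x\<in>countable_subsets (underS \<nu> \<alpha>). \<exists>y\<in>\<X>. x \<subseteq> y)" ..
      from bchoice[OF this] obtain \<X> where \<X>: "\<forall>\<alpha>\<in>Field \<nu>. \<X> \<alpha> \<subseteq> countable_subsets (underS \<nu> \<alpha>) \<and>
          |\<X> \<alpha>| \<le>o \<mu> \<and> (\<forall>x\<in>countable_subsets (underS \<nu> \<alpha>). \<exists>y\<in>\<X> \<alpha>. x \<subseteq> y)" ..
      show ?thesis
      proof (intro exI[of _ "\<Union>\<alpha>\<in>Field \<nu>. \<X> \<alpha>"] conjI ballI)
        have "countable_subsets (underS \<nu> \<alpha>) \<subseteq> countable_subsets (Field \<nu>)" for \<alpha>
          by (auto simp: underS_def Field_def)
        then show "(\<Union>\<alpha>\<in>Field \<nu>. \<X> \<alpha>) \<subseteq> countable_subsets (Field \<nu>)"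
          using \<X> by (intro UN_least) (meson subset_trans)
        have "|Field \<nu>| \<le>o \<mu>"
          using card_of_Field_ordIso[OF \<nu>(1)] \<nu>(3) ordIso_ordLess_trans ordLess_imp_ordLeq by blast
        then show "|\<Union>\<alpha>\<in>Field \<nu>. \<X> \<alpha>| \<le>o \<mu>"
          using \<X> by (intro card_of_UNION_ordLeq_infinite_Field[OF \<mu>(3,1)]) auto
        fix x assume x: "x \<in> countable_subsets (Field \<nu>)"
        then have "\<not> unbounded_in \<nu> (Field \<nu>) x" using False by blast
        then obtain \<alpha> where a: "\<alpha> \<in> Field \<nu>" "\<forall>b\<in>x. (\<alpha>, b) \<notin> \<nu>" using x unfolding unbounded_in_def by blast
        then have "x \<subseteq> underS \<nu> \<alpha>" using underS_or_le[OF wo _ a(1)] x by blast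
        then show "\<exists>y\<in>\<Union>\<alpha>\<in>Field \<nu>. \<X> \<alpha>. x \<subseteq> y" using bspec[OF \<X> a(1)] x a(1) by blast
      qed
    qed
  qed
qed

text \<open>In uncountable cofinality, the shared covers of the smaller initial segments suffice. Cofinal
  families and the square principle enter only when \<open>\<mu>\<close> has countable cofinality.\<close>

theorem shared_covers_countable_subsets:
  fixes lambda \<mu> :: "'a rel"
  assumes cof: "\<And>\<mu> :: 'a rel. Card_order \<mu> \<Longrightarrow> \<mu> <o lambda \<Longrightarrow> cf \<mu> <o \<mu> \<Longrightarrow> cf \<mu> =o natLeq \<Longrightarrow>
      cof_ctbl_subsets \<mu> =o cardSuc \<mu>"
    and square: "\<And>\<mu> :: 'a rel. Card_order \<mu> \<Longrightarrow> \<mu> <o lambda \<Longrightarrow> cf \<mu> <o \<mu> \<Longrightarrow> cf \<mu> =o natLeq \<Longrightarrow>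
      square_aleph1 \<mu>"
    and \<mu>: "Card_order \<mu>" "\<mu> <o lambda"
  shows "shared_covers (countable_subsets (Field \<mu>))"
  using \<mu>
proof (induction \<mu> rule: wf_induct_rule[OF wf_ordLess])
  case (1 \<mu>)
  note \<mu> = 1(2,3)
  have wo: "Well_order \<mu>" using \<mu>(1) by (simp add: card_order_on_def)
  have IH: "shared_covers (countable_subsets A)" if lt: "|A| <o \<mu>" for A :: "'a set"
  proof -
    have "|A| <o lambda" using lt \<mu>(2) by (rule ordLess_transitive)
    from 1(1)[OF lt card_of_Card_order this] show ?thesis by (simp add: Field_card_of)
  qed
  show ?case
  proof (cases "countable (Field \<mu>)")
    case True
    then show ?thesis unfolding shared_covers_def by (intro exI[of _ "\<lambda>_. {Field \<mu>}"]) auto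
  next
    case unc: False
    have inf: "infinite (Field \<mu>)" using unc countable_finite by blast
    show ?thesis
    proof (cases "\<exists>K. countable K \<and> unbounded_in \<mu> (Field \<mu>) K")
      case False
      show ?thesis
      proof (rule shared_covers_uncountable_cofinality[OF wo])
        fix x assume x: "x \<in> countable_subsets (Field \<mu>)"
        then have "\<not> unbounded_in \<mu> (Field \<mu>) x" using False by blast
        then obtain \<alpha> where a: "\<alpha> \<in> Field \<mu>" "\<forall>b\<in>x. (\<alpha>, b) \<notin> \<mu>" using x unfolding unbounded_in_def by blast
        then have "x \<subseteq> underS \<mu> \<alpha>" using underS_or_le[OF wo _ a(1)] x by blast
        then show "\<exists>\<alpha>\<in>Field \<mu>. x \<subseteq> underS \<mu> \<alpha>" using a(1) by blast
      next
        fix \<alpha> assume "\<alpha> \<in> Field \<mu>"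
        then show "shared_covers (countable_subsets (underS \<mu> \<alpha>))"
          using card_of_underS[OF \<mu>(1)] IH by blast
      qed
    next
      case True
      then obtain K where K: "countable K" "unbounded_in \<mu> (Field \<mu>) K" by blast
      note cf = countable_cofinality[OF \<mu>(1) unc K]
      let ?r = "cardSuc \<mu>"
      have rc: "Card_order ?r" by (rule cardSuc_Card_order[OF \<mu>(1)])
      have rwo: "Well_order ?r" using rc by (simp add: card_order_on_def)
      obtain \<X> where \<X>: "\<X> \<subseteq> countable_subsets (Field \<mu>)" "|\<X>| =o cof_ctbl_subsets \<mu>"
        "\<forall>x\<in>countable_subsets (Field \<mu>). \<exists>y\<in>\<X>. x \<subseteq> y"
        using cof_ctbl_subsets_attained[OF inf] by (elim exE conjE) (rule that)
      have "|\<X>| =o ?r" using \<X>(2) cof[OF \<mu> cf(2,1)] by (rule ordIso_transitive)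
      then have "|Field ?r| =o |\<X>|"
        using card_of_Field_ordIso[OF rc] ordIso_symmetric ordIso_transitive by blast
      then obtain X where X: "bij_betw X (Field ?r) \<X>" using card_of_ordIso[of "Field ?r" \<X>] by blast
      obtain C D where D: "club ?r D" and C: "\<forall>\<alpha>\<in>D. cardSuc natLeq \<le>o cf_in ?r (underS ?r \<alpha>) \<longrightarrow>
          unbounded_in ?r (underS ?r \<alpha>) (C \<alpha>) \<and>
          (\<forall>x. x \<subseteq> C \<alpha> \<and> countable x \<longrightarrow>
            (\<exists>y. y \<subseteq> underS ?r \<alpha> \<and> countable y \<and> y \<in> C ` underS ?r \<alpha> \<and> x \<subseteq> y))"
        using square[OF \<mu> cf(2,1)] unfolding square_aleph1_def Let_def by blast
      have Kf: "k \<in> Field \<mu>" if "k \<in> K" for k using K(2) that unfolding unbounded_in_def by blast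
      have "\<exists>\<Y>. \<Y> \<subseteq> countable_subsets (underS \<mu> k) \<and> |\<Y>| \<le>o \<mu> \<and>
          (\<forall>x\<in>countable_subsets (underS \<mu> k). \<exists>y\<in>\<Y>. x \<subseteq> y)" if k: "k \<in> K" for k
      proof -
        have lt: "|underS \<mu> k| <o \<mu>" using card_of_underS[OF \<mu>(1) Kf[OF k]] .
        have "|underS \<mu> k| <o lambda" using lt \<mu>(2) by (rule ordLess_transitive)
        from small_cofinal_family[OF cof card_of_Card_order this \<mu>(1) lt inf] show ?thesis
          by (simp add: Field_card_of)
      qed
      then have "\<forall>k\<in>K. \<exists>\<Y>. \<Y> \<subseteq> countable_subsets (underS \<mu> k) \<and> |\<Y>| \<le>o \<mu> \<and>
          (\<forall>x\<in>countable_subsets (underS \<mu> k). \<exists>y\<in>\<Y>. x \<subseteq> y)" ..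
      from bchoice[OF this] obtain \<Y> where \<Y>: "\<forall>k\<in>K. \<Y> k \<subseteq> countable_subsets (underS \<mu> k) \<and> |\<Y> k| \<le>o \<mu> \<and>
          (\<forall>x\<in>countable_subsets (underS \<mu> k). \<exists>y\<in>\<Y> k. x \<subseteq> y)" ..
      show ?thesis
      proof (rule shared_covers_countable_cofinality[OF \<mu>(1) unc K IH _ _ _ _ _ _ D])
        show "inj_on X (Field ?r)" using X by (simp add: bij_betw_def)
        have im: "X ` Field ?r = \<X>" using X by (simp add: bij_betw_def)
        show "X \<beta> \<in> countable_subsets (Field \<mu>)" if "\<beta> \<in> Field ?r" for \<beta> using that im \<X>(1) by blast
        show "\<exists>\<beta>\<in>Field ?r. x \<subseteq> X \<beta>" if "x \<in> countable_subsets (Field \<mu>)" for x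
          using bspec[OF \<X>(3) that] im by blast
        have "|K| \<le>o natLeq" using K(1) countable_card_le_natLeq by blast
        then have "|K| \<le>o \<mu>" using uncountable_natLeq_ordLess[OF \<mu>(1) unc] ordLess_imp_ordLeq ordLeq_transitive by blast
        then show "|\<Union>k\<in>K. \<Y> k| \<le>o \<mu>" using \<Y> by (intro card_of_UNION_ordLeq_infinite_Field[OF inf \<mu>(1)]) auto
        show "x \<in> countable_subsets (Field \<mu>)" if x: "x \<in> (\<Union>k\<in>K. \<Y> k)" for x
        proof -
          obtain k where k: "k \<in> K" "x \<in> \<Y> k" using x by blast
          have "x \<in> countable_subsets (underS \<mu> k)"
            by (rule subsetD[OF conjunct1[OF bspec[OF \<Y> k(1)]] k(2)])
          then show ?thesis by (auto simp: underS_def Field_def)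
        qed
        show "\<exists>y\<in>\<Union>k\<in>K. \<Y> k. x \<subseteq> y" if "k \<in> K" "x \<in> countable_subsets (underS \<mu> k)" for k x
        proof -
          have "\<exists>y\<in>\<Y> k. x \<subseteq> y"
            by (rule bspec[OF conjunct2[OF conjunct2[OF bspec[OF \<Y> that(1)]]] that(2)])
          then show ?thesis using that(1) by blast
        qed
        fix \<delta> assume d: "\<delta> \<in> D" "\<nexists>K. countable K \<and> unbounded_in ?r (underS ?r \<delta>) K"
        have "underS ?r \<delta> \<subseteq> Field ?r" by (auto simp: underS_def Field_def)
        from uncountable_cf_in[OF rwo this d(2)] 
        show "unbounded_in ?r (underS ?r \<delta>) (C \<delta>) \<and>
          (\<forall>x. x \<subseteq> C \<delta> \<and> countable x \<longrightarrow>
            (\<exists>y. y \<subseteq> underS ?r \<delta> \<and> countable y \<and> y \<in> C ` underS ?r \<delta> \<and> x \<subseteq> y))"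
          using bspec[OF C d(1)] by blast
      qed
    qed
  qed
qed

section \<open>The weak Freese-Nation property\<close>

text \<open>For \<open>i\<close> and \<open>j\<close> monotone with \<open>j (i p) = p\<close>, this says that the property passes to retracts. The
  conditions on \<open>j\<close> are phrased as inequalities in order to fit preorders of representatives.\<close>

lemma weak_Freese_Nation_transfer:
  assumes wfn: "weak_Freese_Nation Q leQ"
    and i: "\<And>p. p \<in> P \<Longrightarrow> i p \<in> Q" and j: "\<And>q. q \<in> Q \<Longrightarrow> j q \<in> P"
    and mono: "\<And>p p'. p \<in> P \<Longrightarrow> p' \<in> P \<Longrightarrow> leP p p' \<Longrightarrow> leQ (i p) (i p')"
    and up: "\<And>p q. p \<in> P \<Longrightarrow> q \<in> Q \<Longrightarrow> leQ (i p) q \<Longrightarrow> leP p (j q)"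
    and low: "\<And>p q. p \<in> P \<Longrightarrow> q \<in> Q \<Longrightarrow> leQ q (i p) \<Longrightarrow> leP (j q) p"
  shows "weak_Freese_Nation P leP"
proof -
  obtain f where f': "\<forall>q\<in>Q. f q \<subseteq> Q \<and> countable (f q)"
      "\<forall>p\<in>Q. \<forall>q\<in>Q. leQ p q \<longrightarrow> (\<exists>r\<in>f p \<inter> f q. leQ p r \<and> leQ r q)"
    using wfn unfolding weak_Freese_Nation_def by (elim exE conjE) (rule that)
  note f = bspec[OF f'(1)] bspec[OF bspec[OF f'(2)], rule_format]
  show ?thesis unfolding weak_Freese_Nation_def
  proof (intro exI[of _ "\<lambda>p. j ` f (i p)"] conjI ballI impI)
    fix p assume p: "p \<in> P"
    show "j ` f (i p) \<subseteq> P" using f(1)[OF i[OF p]] j by blast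
    show "countable (j ` f (i p))" using f(1)[OF i[OF p]] by simp
    fix q assume q: "q \<in> P" "leP p q"
    obtain r where r: "r \<in> f (i p)" "r \<in> f (i q)" "leQ (i p) r" "leQ r (i q)"
      using f(2)[OF i[OF p] i[OF q(1)] mono[OF p q]] by blast
    then have "r \<in> Q" using f(1)[OF i[OF p]] by blast
    then show "\<exists>r\<in>j ` f (i p) \<inter> j ` f (i q). leP p r \<and> leP r q"
      using r up[OF p] low[OF q(1)] by (intro bexI[of _ "j r"]) auto
  qed
qed

text \<open>Classes can be replaced by representatives, so that the algebras are studied as families of sets
  preordered modulo an ideal.\<close>

lemma weak_Freese_Nation_quotient:
  assumes sub: "\<And>A B. B \<in> \<I> \<Longrightarrow> A \<subseteq> B \<Longrightarrow> A \<in> \<I>"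
    and un: "\<And>A B. A \<in> \<I> \<Longrightarrow> B \<in> \<I> \<Longrightarrow> A \<union> B \<in> \<I>"
    and emp: "{} \<in> \<I>"
    and int: "\<And>A B. A \<in> \<B> \<Longrightarrow> B \<in> \<B> \<Longrightarrow> A \<inter> B \<in> \<B>"
  shows "weak_Freese_Nation (quotient_algebra \<B> \<I>) (quotient_le \<I>) \<longleftrightarrow>
    weak_Freese_Nation \<B> (\<lambda>A B. A - B \<in> \<I>)"
proof -
  let ?cls = "\<lambda>A. mod_rel \<B> \<I> `` {A}"
  have "\<forall>a\<in>quotient_algebra \<B> \<I>. \<exists>A. A \<in> \<B> \<and> a = ?cls A"
    unfolding quotient_algebra_def by (auto elim: quotientE)
  from bchoice[OF this] obtain rep where
    rep: "\<forall>a\<in>quotient_algebra \<B> \<I>. rep a \<in> \<B> \<and> a = ?cls (rep a)" ..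
  have cls: "?cls A \<in> quotient_algebra \<B> \<I>" if "A \<in> \<B>" for A
    using that unfolding quotient_algebra_def by (rule quotientI)
  have le: "quotient_le \<I> (?cls A) (?cls B) \<longleftrightarrow> A - B \<in> \<I>" if "A \<in> \<B>" "B \<in> \<B>" for A B
    by (rule quotient_le_class[OF sub un emp int that])
  have le': "quotient_le \<I> a b \<longleftrightarrow> rep a - rep b \<in> \<I>"
    if "a \<in> quotient_algebra \<B> \<I>" "b \<in> quotient_algebra \<B> \<I>" for a b
    using le[of "rep a" "rep b"] bspec[OF rep that(1)] bspec[OF rep that(2)] by simp
  have le1: "quotient_le \<I> a (?cls B) \<longleftrightarrow> rep a - B \<in> \<I>" "quotient_le \<I> (?cls B) a \<longleftrightarrow> B - rep a \<in> \<I>"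
    if "a \<in> quotient_algebra \<B> \<I>" "B \<in> \<B>" for a B
    using le[of "rep a" B] le[of B "rep a"] bspec[OF rep that(1)] that(2) by simp_all
  show ?thesis
  proof
    assume *: "weak_Freese_Nation (quotient_algebra \<B> \<I>) (quotient_le \<I>)"
    show "weak_Freese_Nation \<B> (\<lambda>A B. A - B \<in> \<I>)"
      by (rule weak_Freese_Nation_transfer[OF *, of _ ?cls rep]) (use rep cls le le1 in auto)
  next
    assume *: "weak_Freese_Nation \<B> (\<lambda>A B. A - B \<in> \<I>)"
    show "weak_Freese_Nation (quotient_algebra \<B> \<I>) (quotient_le \<I>)"
      by (rule weak_Freese_Nation_transfer[OF *, of _ rep ?cls]) (use rep cls le' le1 in auto)
  qed
qed

text \<open>Sending \<open>X\<close> to the union of the \<open>a n\<close> with \<open>n \<in> X\<close> embeds \<open>\<P>(\<omega>)\<close>, and sending \<open>b\<close> to the set of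
  all \<open>n\<close> with \<open>a n\<close> below \<open>b\<close> is a retraction.\<close>

lemma weak_Freese_Nation_Pow_nat:
  fixes a :: "nat \<Rightarrow> 'a set"
  assumes wfn: "weak_Freese_Nation \<B> (\<lambda>A B. A - B \<in> \<I>)"
    and sub: "\<And>A B. B \<in> \<I> \<Longrightarrow> A \<subseteq> B \<Longrightarrow> A \<in> \<I>"
    and un: "\<And>A B. A \<in> \<I> \<Longrightarrow> B \<in> \<I> \<Longrightarrow> A \<union> B \<in> \<I>"
    and emp: "{} \<in> \<I>"
    and UN: "\<And>X. (\<Union>n\<in>X. a n) \<in> \<B>"
    and disj: "\<And>m n. m \<noteq> n \<Longrightarrow> a m \<inter> a n = {}" and pos: "\<And>n. a n \<notin> \<I>"
  shows "weak_Freese_Nation (UNIV :: nat set set) (\<subseteq>)"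
proof (rule weak_Freese_Nation_transfer[OF wfn, of _ "\<lambda>X. \<Union>n\<in>X. a n" "\<lambda>b. {n. a n - b \<in> \<I>}"])
  fix X Y :: "nat set" and b
  show "(\<Union>n\<in>X. a n) - (\<Union>n\<in>Y. a n) \<in> \<I>" if "X \<subseteq> Y" by (rule sub[OF emp]) (use that in blast)
  show "X \<subseteq> {n. a n - b \<in> \<I>}" if "(\<Union>n\<in>X. a n) - b \<in> \<I>"
  proof
    fix n assume "n \<in> X"
    then have "a n - b \<subseteq> (\<Union>n\<in>X. a n) - b" by blast
    from sub[OF that this] show "n \<in> {n. a n - b \<in> \<I>}" by simp
  qed
  show "{n. a n - b \<in> \<I>} \<subseteq> X" if b: "b - (\<Union>n\<in>X. a n) \<in> \<I>"
  proof (rule ccontr)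
    assume "\<not> {n. a n - b \<in> \<I>} \<subseteq> X"
    then obtain n where n: "a n - b \<in> \<I>" "n \<notin> X" by blast
    have "a n \<inter> a m = {}" if "m \<in> X" for m
    proof (rule disj)
      show "n \<noteq> m" using n(2) that by auto
    qed
    then have "a n \<inter> (\<Union>n\<in>X. a n) = {}" by blast
    then have "a n \<subseteq> (a n - b) \<union> (b - (\<Union>n\<in>X. a n))" by auto
    from sub[OF un[OF n(1) b] this] show False using pos[of n] by simp
  qed
qed (simp_all add: UN)

text \<open>The sets \<open>up Z p\<close> and \<open>low Z p\<close> code the two projections of \<open>p\<close> to \<open>Z\<close>, and \<open>j Z\<close> decodes. If
  \<open>p \<le> q\<close>, a common cover \<open>Z\<close> of the two supports gives \<open>up Z p \<subseteq> low Z q\<close>; an interpolant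
  between these two sets of natural numbers decodes to an interpolant between \<open>p\<close> and \<open>q\<close>.\<close>

lemma weak_Freese_Nation_shared_covers:
  fixes P :: "'b set" and supp :: "'b \<Rightarrow> 'a set" and up low :: "'a set \<Rightarrow> 'b \<Rightarrow> nat set"
    and j :: "'a set \<Rightarrow> nat set \<Rightarrow> 'b"
  assumes wfn: "weak_Freese_Nation (UNIV :: nat set set) (\<subseteq>)"
    and covers: "shared_covers (countable_subsets I)"
    and supp: "\<And>p. p \<in> P \<Longrightarrow> supp p \<in> countable_subsets I"
    and j: "\<And>Z R. Z \<in> countable_subsets I \<Longrightarrow> j Z R \<in> P"
    and inter: "\<And>p q Z. p \<in> P \<Longrightarrow> q \<in> P \<Longrightarrow> Z \<in> countable_subsets I \<Longrightarrow> le p q \<Longrightarrow>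
      supp p \<inter> supp q \<subseteq> Z \<Longrightarrow> up Z p \<subseteq> low Z q"
    and up: "\<And>p Z R. p \<in> P \<Longrightarrow> Z \<in> countable_subsets I \<Longrightarrow> up Z p \<subseteq> R \<Longrightarrow> le p (j Z R)"
    and low: "\<And>p Z R. p \<in> P \<Longrightarrow> Z \<in> countable_subsets I \<Longrightarrow> R \<subseteq> low Z p \<Longrightarrow> le (j Z R) p"
  shows "weak_Freese_Nation P le"
proof -
  obtain F :: "nat set \<Rightarrow> nat set set" where F': "\<forall>X\<in>UNIV. F X \<subseteq> UNIV \<and> countable (F X)"
      "\<forall>X\<in>UNIV. \<forall>Y\<in>UNIV. X \<subseteq> Y \<longrightarrow> (\<exists>R\<in>F X \<inter> F Y. X \<subseteq> R \<and> R \<subseteq> Y)"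
    using wfn unfolding weak_Freese_Nation_def by (elim exE conjE) (rule that)
  have F: "countable (F X)" "X \<subseteq> Y \<Longrightarrow> \<exists>R\<in>F X \<inter> F Y. X \<subseteq> R \<and> R \<subseteq> Y" for X Y
    using F' by simp_all
  obtain g where g: "\<forall>X\<in>countable_subsets I. countable (g X) \<and> (\<forall>Z\<in>g X. countable Z)"
      "\<forall>X\<in>countable_subsets I. \<forall>Y\<in>countable_subsets I. \<exists>Z\<in>g X \<inter> g Y. X \<inter> Y \<subseteq> Z"
    using covers unfolding shared_covers_def by (elim exE conjE) (rule that)
  define f where "f p = (\<Union>Z\<in>g (supp p). j (Z \<inter> I) ` (F (up (Z \<inter> I) p) \<union> F (low (Z \<inter> I) p)))" for p
  have gp: "countable (g (supp p))" "Z \<in> g (supp p) \<Longrightarrow> Z \<inter> I \<in> countable_subsets I" if "p \<in> P" for p Z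
    using bspec[OF g(1) supp[OF that]] by auto
  show ?thesis unfolding weak_Freese_Nation_def
  proof (intro exI[of _ f] conjI ballI impI)
    fix p assume p: "p \<in> P"
    show "f p \<subseteq> P" unfolding f_def using gp(2)[OF p] j by blast
    show "countable (f p)" unfolding f_def using gp(1)[OF p] F(1) by auto
    fix q assume q: "q \<in> P" "le p q"
    obtain Z where Z: "Z \<in> g (supp p)" "Z \<in> g (supp q)" "supp p \<inter> supp q \<subseteq> Z"
      using bspec[OF bspec[OF g(2) supp[OF p]] supp[OF q(1)]] by blast
    let ?Z = "Z \<inter> I"
    have Z': "?Z \<in> countable_subsets I" using gp(2)[OF p Z(1)] .
    have "supp p \<inter> supp q \<subseteq> ?Z" using Z(3) supp[OF p] by blast
    then obtain R where R: "R \<in> F (up ?Z p)" "R \<in> F (low ?Z q)" "up ?Z p \<subseteq> R" "R \<subseteq> low ?Z q"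
      using F(2)[OF inter[OF p q(1) Z' q(2)]] by blast
    then have "j ?Z R \<in> f p \<inter> f q" unfolding f_def using Z(1,2) by blast
    moreover have "le p (j ?Z R)" "le (j ?Z R) q" using up[OF p Z' R(3)] low[OF q(1) Z' R(4)] by auto
    ultimately show "\<exists>r\<in>f p \<inter> f q. le p r \<and> le r q" by blast
  qed
qed

section \<open>Essential unions\<close>

text \<open>Choose countable subfamilies whose unions come arbitrarily close to the supremum of all such
  measures. The union of their unions attains the supremum, so adding a further member cannot
  increase its measure.\<close>

lemma (in finite_measure) essential_union:
  assumes S: "\<S> \<subseteq> sets M"
  shows "\<exists>\<T>. \<T> \<subseteq> \<S> \<and> countable \<T> \<and> (\<forall>A\<in>\<S>. A - \<Union>\<T> \<in> null_sets M)"
proof -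
  let ?C = "{\<T>. \<T> \<subseteq> \<S> \<and> countable \<T>}"
  define v where "v \<T> = measure M (\<Union>\<T>)" for \<T>
  have bdd: "bdd_above (v ` ?C)"
    unfolding v_def by (rule bdd_aboveI[of _ "measure M (space M)"]) (auto intro: bounded_measure)
  have sets: "\<Union>\<T> \<in> sets M" if "\<T> \<in> ?C" for \<T> using that S by (intro sets.countable_Union) auto
  have ne: "?C \<noteq> {}" by (auto intro: exI[of _ "{}"])
  have "\<exists>\<T>. \<T> \<in> ?C \<and> (SUP \<T>\<in>?C. v \<T>) - 1 / real (Suc n) < v \<T>" for n
    using less_cSUP_iff[OF ne bdd, of "(SUP \<T>\<in>?C. v \<T>) - 1 / real (Suc n)"] by simp
  then have "\<forall>n. \<exists>\<T>. \<T> \<in> ?C \<and> (SUP \<T>\<in>?C. v \<T>) - 1 / real (Suc n) < v \<T>" ..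
  from choice[OF this] obtain T where "\<forall>n. T n \<in> ?C \<and> (SUP \<T>\<in>?C. v \<T>) - 1 / real (Suc n) < v (T n)" ..
  then have T: "T n \<in> ?C" "(SUP \<T>\<in>?C. v \<T>) - 1 / real (Suc n) < v (T n)" for n
    by (rule allE[of _ n], simp)+
  let ?T = "\<Union>n. T n"
  have T_C: "?T \<in> ?C" using T(1) by auto
  have ge: "(SUP \<T>\<in>?C. v \<T>) \<le> v ?T"
  proof (rule field_le_epsilon)
    fix e :: real assume "e > 0"
    then obtain n where n: "1 / real (Suc n) < e" using nat_approx_posE by blast
    have "v (T n) \<le> v ?T" unfolding v_def by (rule finite_measure_mono[OF _ sets[OF T_C]]) blast
    then show "(SUP \<T>\<in>?C. v \<T>) \<le> v ?T + e" using T(2)[of n] n by linarith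
  qed
  have "A - \<Union>?T \<in> null_sets M" if A: "A \<in> \<S>" for A
  proof -
    have C: "insert A ?T \<in> ?C" using A T_C by auto
    have AM: "A \<in> sets M" using A S by blast
    have "v (insert A ?T) \<le> v ?T" using cSUP_upper[OF C bdd] ge by linarith
    moreover have "v (insert A ?T) = v ?T + measure M (A - \<Union>?T)"
    proof -
      have "\<Union>(insert A ?T) = \<Union>?T \<union> (A - \<Union>?T)" by auto
      then show ?thesis unfolding v_def using finite_measure_Union[OF sets[OF T_C], of "A - \<Union>?T"] AM sets[OF T_C]
        by auto
    qed
    ultimately have "measure M (A - \<Union>?T) = 0" using measure_nonneg[of M "A - \<Union>?T"] by linarith
    then show ?thesis using AM sets[OF T_C] by (auto simp: null_sets_def emeasure_eq_measure)
  qed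
  then show ?thesis using T_C by blast
qed

section \<open>Meager sets\<close>

lemma nowhere_dense_subset:
  "nowhere_dense_in X S \<Longrightarrow> T \<subseteq> S \<Longrightarrow> nowhere_dense_in X T"
  unfolding nowhere_dense_in_def by (metis closure_of_mono interior_of_mono subset_empty subset_trans)

lemma nowhere_dense_meager: "nowhere_dense_in X S \<Longrightarrow> S \<in> meager_sets X"
  unfolding meager_sets_def by (intro CollectI exI[of _ "\<lambda>_. S"]) auto

lemma meager_empty: "{} \<in> meager_sets X"
  by (rule nowhere_dense_meager) (simp add: nowhere_dense_in_def)

lemma meager_subset:
  assumes "B \<in> meager_sets X" "A \<subseteq> B" shows "A \<in> meager_sets X"
proof -
  obtain S :: "nat \<Rightarrow> _" where S: "B = \<Union>(range S)" "\<forall>n. nowhere_dense_in X (S n)"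
    using assms(1) unfolding meager_sets_def by blast
  have "A = \<Union>(range (\<lambda>n. A \<inter> S n))" using assms(2) S(1) by auto
  moreover have "\<forall>n. nowhere_dense_in X (A \<inter> S n)" using S(2) by (auto intro: nowhere_dense_subset)
  ultimately show ?thesis unfolding meager_sets_def by (intro CollectI exI[of _ "\<lambda>n. A \<inter> S n"]) auto
qed

lemma meager_UN:
  assumes "countable N" "\<And>n. n \<in> N \<Longrightarrow> A n \<in> meager_sets X" shows "(\<Union>n\<in>N. A n) \<in> meager_sets X"
proof (cases "N = {}")
  case True then show ?thesis using meager_empty by simp
next
  case False
  have "\<forall>n\<in>N. \<exists>S :: nat \<Rightarrow> _. A n = \<Union>(range S) \<and> (\<forall>k. nowhere_dense_in X (S k))"
    using assms(2) unfolding meager_sets_def by blast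
  from bchoice[OF this] obtain S :: "_ \<Rightarrow> nat \<Rightarrow> _" where
    S: "\<forall>n\<in>N. A n = \<Union>(range (S n)) \<and> (\<forall>k. nowhere_dense_in X (S n k))" ..
  let ?f = "\<lambda>k. S (from_nat_into N (fst (prod_decode k))) (snd (prod_decode k))"
  have "(\<Union>n\<in>N. A n) = \<Union>(range ?f)"
  proof (intro equalityI subsetI)
    fix x assume "x \<in> (\<Union>n\<in>N. A n)"
    then obtain n k where n: "n \<in> N" "x \<in> S n k" using S by blast
    then have "x \<in> ?f (prod_encode (to_nat_on N n, k))" using assms(1) by simp
    then show "x \<in> \<Union>(range ?f)" by blast
  next
    fix x assume "x \<in> \<Union>(range ?f)"
    then obtain k where k: "x \<in> ?f k" by blast
    have "from_nat_into N (fst (prod_decode k)) \<in> N" using False by (rule from_nat_into)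
    then show "x \<in> (\<Union>n\<in>N. A n)" using S k by blast
  qed
  moreover have "\<forall>k. nowhere_dense_in X (?f k)" using S from_nat_into[OF False] by blast
  ultimately show ?thesis unfolding meager_sets_def by blast
qed

lemma meager_Un: "A \<in> meager_sets X \<Longrightarrow> B \<in> meager_sets X \<Longrightarrow> A \<union> B \<in> meager_sets X"
  using meager_UN[of "{A, B}" "\<lambda>x. x" X] by auto

section \<open>The Cantor space\<close>

context fixes \<kappa> :: "'a rel"
begin

private abbreviation "\<E> \<equiv> Field \<kappa> \<rightarrow>\<^sub>E (UNIV :: bool set)"
private abbreviation (input) "\<M> \<equiv> cantor_measure \<kappa>"
private abbreviation (input) "\<J> \<equiv> meager_sets (cantor_topology \<kappa>)"
private abbreviation (input) "\<C> \<equiv> cantor_topology \<kappa>"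

definition cylinder :: "('a \<Rightarrow> bool) \<Rightarrow> 'a set \<Rightarrow> ('a \<Rightarrow> bool) set" where
  "cylinder x J = {y\<in>\<E>. \<forall>i\<in>J. y i = x i}"

definition cylinders :: "'a set \<Rightarrow> ('a \<Rightarrow> bool) set set" where
  "cylinders Z = {cylinder x J |x J. x \<in> \<E> \<and> finite J \<and> J \<subseteq> Z}"

definition depends_on :: "'a set \<Rightarrow> ('a \<Rightarrow> bool) set \<Rightarrow> bool" where
  "depends_on Z A \<longleftrightarrow> A \<subseteq> \<E> \<and>
    (\<forall>x\<in>A. \<forall>y\<in>\<E>. (\<forall>i\<in>Z. x i = y i) \<longrightarrow> y \<in> A)"

text \<open>Pasting two points along \<open>Z\<close>. Resampling the coordinates outside \<open>Z\<close> in this way lets sections of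
  a set remain subsets of the same space, instead of a product over \<open>Field \<kappa> - Z\<close>.\<close>

definition mix :: "'a set \<Rightarrow> ('a \<Rightarrow> bool) \<Rightarrow> ('a \<Rightarrow> bool) \<Rightarrow> 'a \<Rightarrow> bool" where
  "mix Z x y i = (if i \<in> Z then x i else y i)"

lemma mix_points: "x \<in> \<E> \<Longrightarrow> y \<in> \<E> \<Longrightarrow> mix Z x y \<in> \<E>"
  unfolding mix_def by (auto simp: PiE_iff extensional_def)

lemma cylinder_self: "x \<in> \<E> \<Longrightarrow> x \<in> cylinder x J"
  unfolding cylinder_def by simp

lemma cylinder_restrict:
  assumes "x \<in> \<E>" shows "cylinder x J = cylinder x (J \<inter> Field \<kappa>)"
proof -
  have "y i = x i" if "y \<in> \<E>" "i \<notin> Field \<kappa>" for y i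
    using that assms by (auto simp: PiE_iff extensional_def)
  then show ?thesis unfolding cylinder_def by blast
qed

lemma cylindersI: "x \<in> \<E> \<Longrightarrow> finite J \<Longrightarrow> J \<subseteq> Z \<Longrightarrow> cylinder x J \<in> cylinders Z"
  unfolding cylinders_def by blast

lemma cylinders_mono: "Z \<subseteq> Z' \<Longrightarrow> cylinders Z \<subseteq> cylinders Z'"
  unfolding cylinders_def by blast

text \<open>Such a set is determined by its restrictions to \<open>J\<close>.\<close>

lemma finite_depends_on: assumes "finite J" shows "finite {A. depends_on J A}"
proof (rule finite_imageD)
  let ?f = "\<lambda>A. (\<lambda>x. restrict x J) ` A"
  have "?f ` {A. depends_on J A} \<subseteq> Pow (J \<rightarrow>\<^sub>E UNIV)" by auto
  moreover have "finite (Pow (J \<rightarrow>\<^sub>E (UNIV :: bool set)))" using assms by (simp add: finite_PiE)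
  ultimately show "finite (?f ` {A. depends_on J A})" by (rule finite_subset)
  have sub: "A \<subseteq> B" if A: "depends_on J A" and B: "depends_on J B" and eq: "?f A = ?f B" for A B
  proof
    fix x assume x: "x \<in> A"
    then have "restrict x J \<in> ?f B" using eq by blast
    then obtain y where y: "y \<in> B" "restrict x J = restrict y J" by blast
    have "y i = x i" if "i \<in> J" for i using fun_cong[OF y(2), of i] that by simp
    moreover have "x \<in> \<E>" using A x unfolding depends_on_def by blast
    ultimately show "x \<in> B" using B y(1) unfolding depends_on_def by simp
  qed
  show "inj_on ?f {A. depends_on J A}" by (rule inj_onI) (use sub in blast)
qed

lemma countable_depends_on_finite:
  assumes "countable Z" shows "countable {A. \<exists>J. finite J \<and> J \<subseteq> Z \<and> depends_on J A}"
proof -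
  have "{A. \<exists>J. finite J \<and> J \<subseteq> Z \<and> depends_on J A} = (\<Union>J\<in>{J. finite J \<and> J \<subseteq> Z}. {A. depends_on J A})" by auto
  moreover have "countable {J. finite J \<and> J \<subseteq> Z}" using countable_Collect_finite_subset[OF assms] .
  moreover have "countable {A. depends_on J A}" if "finite J" for J
    by (rule countable_finite[OF finite_depends_on[OF that]])
  ultimately show ?thesis by (simp only:) (rule countable_UN, auto)
qed

lemma depends_on_cylinder: "depends_on J (cylinder x J)"
  unfolding depends_on_def cylinder_def by auto

lemma countable_cylinders: assumes "countable Z" shows "countable (cylinders Z)"
proof (rule countable_subset[OF _ countable_depends_on_finite[OF assms]])
  show "cylinders Z \<subseteq> {A. \<exists>J. finite J \<and> J \<subseteq> Z \<and> depends_on J A}"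
    unfolding cylinders_def using depends_on_cylinder by blast
qed

lemma topspace_cantor: "topspace \<C> = \<E>"
  unfolding cantor_topology_def by simp

lemma openin_cylinder:
  assumes "x \<in> \<E>" "finite J" shows "openin \<C> (cylinder x J)"
proof -
  let ?X = "\<lambda>i. if i \<in> J \<inter> Field \<kappa> then {x i} else UNIV"
  have "openin \<C> (Pi\<^sub>E (Field \<kappa>) ?X)"
    unfolding cantor_topology_def
    by (rule product_topology_basis) (auto intro: finite_subset[OF _ assms(2)] split: if_splits)
  moreover have "Pi\<^sub>E (Field \<kappa>) ?X = cylinder x J"
    unfolding cylinder_restrict[OF assms(1), of J] unfolding cylinder_def
    by (auto simp: PiE_iff extensional_def split: if_splits)
  ultimately show ?thesis by simp
qed

lemma openin_contains_cylinder:
  assumes "openin \<C> U" "x \<in> U"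
  obtains J where "finite J" "J \<subseteq> Field \<kappa>" "x \<in> \<E>" "cylinder x J \<subseteq> U"
proof -
  obtain X where X: "x \<in> Pi\<^sub>E (Field \<kappa>) X" "finite {i. X i \<noteq> UNIV}" "Pi\<^sub>E (Field \<kappa>) X \<subseteq> U"
    using product_topology_open_contains_basis[OF assms[unfolded cantor_topology_def]] by auto
  let ?J = "{i. X i \<noteq> UNIV} \<inter> Field \<kappa>"
  have x: "x \<in> \<E>" using assms openin_subset topspace_cantor by blast
  have "cylinder x ?J \<subseteq> Pi\<^sub>E (Field \<kappa>) X"
  proof
    fix y assume y: "y \<in> cylinder x ?J"
    have "y i \<in> X i" if "i \<in> Field \<kappa>" for i
      using that y X(1) by (cases "X i = UNIV") (auto simp: cylinder_def PiE_iff)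
    then show "y \<in> Pi\<^sub>E (Field \<kappa>) X" using y by (auto simp: cylinder_def PiE_iff)
  qed
  then show ?thesis using that[of ?J] X x by auto
qed

lemma prob_space_cantor: "prob_space \<M>"
  unfolding cantor_measure_def by (intro prob_space_PiM prob_space_uniform_count_measure) auto

lemma space_cantor: "space \<M> = \<E>"
  unfolding cantor_measure_def by (simp add: space_PiM space_uniform_count_measure)

lemma emeasure_cylinder:
  assumes "x \<in> \<E>" "finite J"
  shows "cylinder x J \<in> sets \<M>" "emeasure \<M> (cylinder x J) > 0"
proof -
  let ?J = "J \<inter> Field \<kappa>"
  interpret product_prob_space "\<lambda>_ :: 'a. uniform_count_measure (UNIV :: bool set)" "Field \<kappa>"
    by (intro product_prob_spaceI prob_space_uniform_count_measure) auto
  have eq: "cylinder x J = {y\<in>space \<M>. \<forall>i\<in>?J. y i \<in> {x i}}"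
    unfolding cylinder_restrict[OF assms(1), of J] unfolding cylinder_def space_cantor by auto
  have "emeasure \<M> (cylinder x J) = (\<Prod>i\<in>?J. emeasure (uniform_count_measure (UNIV :: bool set)) {x i})"
    unfolding eq unfolding cantor_measure_def using assms(2)
    by (intro emeasure_PiM_Collect) (auto simp: sets_uniform_count_measure)
  also have "\<dots> > 0"
    using assms(2) by (auto simp: emeasure_uniform_count_measure zero_less_iff_neq_zero ennreal_zero_less_divide)
  finally show pos: "emeasure \<M> (cylinder x J) > 0" .
  then show "cylinder x J \<in> sets \<M>" using emeasure_notin_sets by force
qed

lemma sets_cantor_eq:
  "sets \<M> = sigma_sets \<E> {{x\<in>\<E>. x i \<in> B} |i B. i \<in> Field \<kappa>}"
  unfolding cantor_measure_def sets_PiM_single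
  by (simp add: space_uniform_count_measure sets_uniform_count_measure)

lemma sets_cantor_induct [consumes 1, case_names empty basic compl union]:
  assumes A: "A \<in> sets \<M>"
    and empty: "P {}"
    and basic: "\<And>i B. i \<in> Field \<kappa> \<Longrightarrow> P {x\<in>\<E>. x i \<in> B}"
    and compl: "\<And>A. A \<in> sets \<M> \<Longrightarrow> P A \<Longrightarrow> P (\<E> - A)"
    and union: "\<And>A :: nat \<Rightarrow> _. (\<And>n. A n \<in> sets \<M>) \<Longrightarrow> (\<And>n. P (A n)) \<Longrightarrow> P (\<Union>n. A n)"
  shows "P A"
  using A[unfolded sets_cantor_eq]
proof (induction rule: sigma_sets.induct)
  case (Basic A)
  then show ?case using basic by blast
next
  case (Compl A)
  then show ?case using compl unfolding sets_cantor_eq by blast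
next
  case (Union A)
  then show ?case using union unfolding sets_cantor_eq by blast
qed (rule empty)

lemma cantor_points_inhabited: "(\<lambda>i\<in>Field \<kappa>. b) \<in> \<E>"
  by simp

text \<open>This replaces the countable chain condition. All cylinders have positive measure; hence the
  essential union of the cylinders inside \<open>U\<close> is dense in \<open>U\<close>, which serves category, and it contains
  almost all of each of these cylinders, which serves measure.\<close>

lemma dense_countable_subunion:
  assumes U: "openin \<C> U"
  obtains \<T> X where "\<T> \<subseteq> cylinders X" "countable \<T>" "countable X" "X \<subseteq> Field \<kappa>" "\<Union>\<T> \<subseteq> U"
    "\<And>x J. x \<in> \<E> \<Longrightarrow> finite J \<Longrightarrow> cylinder x J \<subseteq> U \<Longrightarrow>
       cylinder x J - \<Union>\<T> \<in> null_sets \<M>"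
proof -
  interpret prob_space "\<M>" by (rule prob_space_cantor)
  let ?S = "{cylinder x J |x J. x \<in> \<E> \<and> finite J \<and> cylinder x J \<subseteq> U}"
  have "?S \<subseteq> sets \<M>" using emeasure_cylinder(1) by blast
  from essential_union[OF this] obtain \<T> where \<T>: "\<T> \<subseteq> ?S" "countable \<T>"
    "\<forall>A\<in>?S. A - \<Union>\<T> \<in> null_sets \<M>" by (elim exE conjE) (rule that)
  have "\<forall>A\<in>\<T>. \<exists>J. finite J \<and> J \<subseteq> Field \<kappa> \<and> A \<in> cylinders J"
  proof
    fix A assume "A \<in> \<T>"
    then obtain x J where x: "x \<in> \<E>" "finite J" "A = cylinder x J" using \<T>(1) by blast
    have "A = cylinder x (J \<inter> Field \<kappa>)" unfolding x(3) by (rule cylinder_restrict[OF x(1)])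
    then have "A \<in> cylinders (J \<inter> Field \<kappa>)" using x(1,2) by (simp add: cylindersI)
    then show "\<exists>J. finite J \<and> J \<subseteq> Field \<kappa> \<and> A \<in> cylinders J"
      using x(2) by (intro exI[of _ "J \<inter> Field \<kappa>"]) simp
  qed
  from bchoice[OF this] obtain J where J: "\<forall>A\<in>\<T>. finite (J A) \<and> J A \<subseteq> Field \<kappa> \<and> A \<in> cylinders (J A)" ..
  have "A \<in> cylinders (\<Union>A\<in>\<T>. J A)" if "A \<in> \<T>" for A
  proof -
    have "J A \<subseteq> (\<Union>A\<in>\<T>. J A)" using that by blast
    from subsetD[OF cylinders_mono[OF this]] show ?thesis using bspec[OF J that] by blast
  qed
  then have "\<T> \<subseteq> cylinders (\<Union>A\<in>\<T>. J A)" by blast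
  moreover have "countable (\<Union>A\<in>\<T>. J A)"
    by (rule countable_UN[OF \<T>(2)]) (use J in \<open>simp add: countable_finite\<close>)
  moreover have "(\<Union>A\<in>\<T>. J A) \<subseteq> Field \<kappa>" using J by blast
  moreover have "\<Union>\<T> \<subseteq> U" using \<T>(1) by blast
  moreover have "cylinder x J - \<Union>\<T> \<in> null_sets \<M>"
    if "x \<in> \<E>" "finite J" "cylinder x J \<subseteq> U" for x J
    using that by (intro bspec[OF \<T>(3)]) blast
  ultimately show ?thesis using \<T>(2) by (intro that)
qed

lemma borel_sets_sigma: "sigma_algebra \<E> (borel_sets \<C>)"
  unfolding borel_sets_def topspace_cantor
  by (rule sigma_algebra_sigma_sets) (use openin_subset topspace_cantor in blast)

lemma open_borel: "openin \<C> U \<Longrightarrow> U \<in> borel_sets \<C>"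
  unfolding borel_sets_def by (rule sigma_sets.Basic) simp

lemma borel_subset_points:
  assumes "B \<in> borel_sets \<C>" shows "B \<subseteq> \<E>"
proof (rule sigma_sets_into_sp)
  show "{U. openin \<C> U} \<subseteq> Pow \<E>"
    using openin_subset topspace_cantor by blast
  show "B \<in> sigma_sets \<E> {U. openin \<C> U}"
    using assms unfolding borel_sets_def topspace_cantor .
qed

lemma borel_induct [consumes 1, case_names empty "open" compl union]:
  assumes A: "A \<in> borel_sets \<C>"
    and empty: "P {}"
    and basic: "\<And>U. openin \<C> U \<Longrightarrow> P U"
    and compl: "\<And>A. A \<in> borel_sets \<C> \<Longrightarrow> P A \<Longrightarrow> P (\<E> - A)"
    and union: "\<And>A :: nat \<Rightarrow> _. (\<And>n. A n \<in> borel_sets \<C>) \<Longrightarrow> (\<And>n. P (A n)) \<Longrightarrow> P (\<Union>n. A n)"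
  shows "P A"
  using A[unfolded borel_sets_def topspace_cantor]
proof (induction rule: sigma_sets.induct)
  case (Basic A)
  then show ?case using basic by blast
next
  case (Compl A)
  then show ?case using compl unfolding borel_sets_def topspace_cantor by blast
next
  case (Union A)
  then show ?case using union unfolding borel_sets_def topspace_cantor by blast
qed (rule empty)

text \<open>The points at which \<open>s n\<close> is the first of the coordinates \<open>s 0, s 1, \<dots>\<close> with value \<open>True\<close>. These
  sets are disjoint and not negligible in either sense.\<close>

definition first_difference :: "(nat \<Rightarrow> 'a) \<Rightarrow> nat \<Rightarrow> ('a \<Rightarrow> bool) set" where
  "first_difference s n = cylinder (\<lambda>i\<in>Field \<kappa>. i = s n) (s ` {..n})"

lemma first_difference_disjoint:
  assumes "inj s" "range s \<subseteq> Field \<kappa>" "m \<noteq> n"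
  shows "first_difference s m \<inter> first_difference s n = {}"
proof -
  have *: "first_difference s m \<inter> first_difference s n = {}" if "m < n" for m n
  proof (rule ccontr)
    assume "first_difference s m \<inter> first_difference s n \<noteq> {}"
    then obtain x where "x \<in> first_difference s m" "x \<in> first_difference s n" by blast
    then have "x (s m) = (s m = s m)" "x (s m) = (s m = s n)"
      using that assms(2) unfolding first_difference_def cylinder_def by (auto simp: range_subsetD)
    then show False using assms(1) that by (auto simp: inj_def)
  qed
  show ?thesis using *[of m n] *[of n m] assms(3) by (cases m n rule: linorder_cases) blast+
qed

section \<open>The Cohen algebra\<close>

text \<open>The Baire category theorem for the compact Hausdorff space \<open>2\<^sup>\<kappa>\<close>.\<close>

lemma open_not_meager:
  assumes U: "openin \<C> U" "U \<noteq> {}" shows "U \<notin> \<J>"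
proof
  assume "U \<in> \<J>"
  then obtain S :: "nat \<Rightarrow> _" where S: "U = \<Union>(range S)" "\<forall>n. nowhere_dense_in \<C> (S n)"
    unfolding meager_sets_def by blast
  have "compact_space \<C>" unfolding cantor_topology_def
    by (simp add: compact_space_product_topology compact_space_discrete_topology)
  moreover have "Hausdorff_space \<C>" unfolding cantor_topology_def
    by (simp add: Hausdorff_space_product_topology)
  ultimately have lc: "locally_compact_space \<C> \<and> regular_space \<C>"
    using compact_imp_locally_compact_space locally_compact_Hausdorff_or_regular by blast
  let ?G = "range (\<lambda>n. \<C> closure_of S n)"
  have "\<C> interior_of \<Union>?G = {}"
  proof (rule Baire_category_alt)
    fix T assume "T \<in> ?G"
    then show "closedin \<C> T \<and> \<C> interior_of T = {}"
      using S(2) unfolding nowhere_dense_in_def by auto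
  qed (use lc in auto)
  moreover have "U \<subseteq> \<Union>?G"
  proof
    fix x assume "x \<in> U"
    then obtain n where "x \<in> S n" using S(1) by blast
    moreover have "S n \<subseteq> topspace \<C>" using S(2) unfolding nowhere_dense_in_def by blast
    ultimately have "x \<in> \<C> closure_of S n" using closure_of_subset by blast
    then show "x \<in> \<Union>?G" by blast
  qed
  ultimately show False using U unfolding interior_of_eq_empty by blast
qed

lemma dense_open_meager_complement:
  assumes W: "openin \<C> W"
    and dense: "\<And>x J. x \<in> \<E> \<Longrightarrow> finite J \<Longrightarrow> cylinder x J \<inter> W \<noteq> {}"
  shows "\<E> - W \<in> \<J>"
proof (rule nowhere_dense_meager)
  have cl: "closedin \<C> (\<E> - W)"
    using W by (metis closedin_diff closedin_topspace topspace_cantor)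
  have "T = {}" if T: "openin \<C> T" "T \<subseteq> \<E> - W" for T
  proof (rule ccontr)
    assume "T \<noteq> {}"
    then obtain x where x: "x \<in> T" by blast
    obtain J where "finite J" "x \<in> \<E>" "cylinder x J \<subseteq> T"
      using openin_contains_cylinder[OF T(1) x] by metis
    then show False using dense[of x J] T(2) by blast
  qed
  then have "\<C> interior_of (\<E> - W) = {}" unfolding interior_of_eq_empty by blast
  then show "nowhere_dense_in \<C> (\<E> - W)"
    unfolding nowhere_dense_in_def topspace_cantor closure_of_closedin[OF cl] by blast
qed

lemma openin_cylinders: "\<T> \<subseteq> cylinders X \<Longrightarrow> openin \<C> (\<Union>\<T>)"
  unfolding cylinders_def by (rule openin_Union) (auto intro: openin_cylinder)

text \<open>The Baire property, with an open set that depends only on the coordinates in \<open>X\<close>.\<close>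

definition open_rep :: "'a set \<Rightarrow> ('a \<Rightarrow> bool) set \<Rightarrow> bool" where
  "open_rep X A \<longleftrightarrow> (\<exists>\<T>\<subseteq>cylinders X. A - \<Union>\<T> \<in> \<J> \<and>
     \<Union>\<T> - A \<in> \<J>)"

lemma open_rep_mono: "open_rep X A \<Longrightarrow> X \<subseteq> Y \<Longrightarrow> open_rep Y A"
  unfolding open_rep_def using cylinders_mono by (meson subset_trans)

text \<open>The cylinders over \<open>X\<close> that miss a given union of cylinders over \<open>X\<close> have a union which is the
  complement up to a nowhere dense set: any cylinder can be shrunk to decide membership by
  changing coordinates in \<open>X\<close> only.\<close>

lemma open_rep_compl:
  assumes "open_rep X A" shows "open_rep X (\<E> - A)"
proof -
  obtain \<T> where \<T>: "\<T> \<subseteq> cylinders X" "A - \<Union>\<T> \<in> \<J>"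
     "\<Union>\<T> - A \<in> \<J>" using assms unfolding open_rep_def by blast
  let ?V = "{c\<in>cylinders X. c \<inter> \<Union>\<T> = {}}"
  have "cylinder x J \<inter> (\<Union>\<T> \<union> \<Union>?V) \<noteq> {}" if x: "x \<in> \<E>" "finite J" for x J
  proof (cases "cylinder x (J \<inter> X) \<inter> \<Union>\<T> = {}")
    case True
    then have "cylinder x (J \<inter> X) \<in> ?V" using x by (auto intro: cylindersI)
    then show ?thesis using cylinder_self[OF x(1)] by blast
  next
    case False
    then obtain y c where y: "y \<in> cylinder x (J \<inter> X)" "y \<in> c" "c \<in> \<T>" by blast
    then obtain z K where c: "c = cylinder z K" "K \<subseteq> X" using \<T>(1) unfolding cylinders_def by blast
    let ?w = "mix (J \<inter> X \<union> K) y x"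
    have yp: "y \<in> \<E>" using y(1) unfolding cylinder_def by simp
    have "?w \<in> \<E>" using mix_points[OF yp x(1)] .
    moreover have "?w i = x i" if "i \<in> J" for i
      using y that c(2) unfolding c cylinder_def mix_def by auto
    moreover have "?w i = z i" if "i \<in> K" for i
      using y that unfolding c cylinder_def mix_def by auto
    ultimately have "?w \<in> cylinder x J" "?w \<in> c" unfolding c cylinder_def by auto
    then show ?thesis using y(3) by blast
  qed
  moreover have op: "openin \<C> (\<Union>\<T> \<union> \<Union>?V)"
    by (intro openin_Un openin_cylinders[OF \<T>(1)] openin_cylinders[of ?V X]) blast
  ultimately have *: "\<E> - (\<Union>\<T> \<union> \<Union>?V) \<in> \<J>"
    using dense_open_meager_complement by blast
  have "\<Union>?V \<subseteq> \<E>" unfolding cylinders_def cylinder_def by blast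
  show ?thesis unfolding open_rep_def
  proof (intro exI[of _ ?V] conjI)
    show "(\<E> - A) - \<Union>?V \<in> \<J>"
      by (rule meager_subset[OF meager_Un[OF * \<T>(3)]]) blast
    show "\<Union>?V - (\<E> - A) \<in> \<J>"
      by (rule meager_subset[OF \<T>(2)]) (use \<open>\<Union>?V \<subseteq> \<E>\<close> in blast)
  qed blast
qed

lemma open_rep_open:
  assumes U: "openin \<C> U"
  shows "\<exists>X. countable X \<and> X \<subseteq> Field \<kappa> \<and> open_rep X U"
proof -
  obtain \<T> X where \<T>: "\<T> \<subseteq> cylinders X" "countable \<T>" "countable X" "X \<subseteq> Field \<kappa>" "\<Union>\<T> \<subseteq> U"
    "\<And>x J. x \<in> \<E> \<Longrightarrow> finite J \<Longrightarrow> cylinder x J \<subseteq> U \<Longrightarrow>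
       cylinder x J - \<Union>\<T> \<in> null_sets \<M>"
    by (rule dense_countable_subunion[OF U]) (rule that)
  define V where "V = \<Union>{V. openin \<C> V \<and> V \<inter> U = {}}"
  have V: "openin \<C> V" unfolding V_def by (rule openin_Union) simp
  have V_disj: "V \<inter> U = {}" unfolding V_def by auto
  have V_max: "W \<subseteq> V" if "openin \<C> W" "W \<inter> U = {}" for W
    unfolding V_def using that by auto
  from openin_cylinders[OF \<T>(1)] V have "openin \<C> (\<Union>\<T> \<union> V)" by (rule openin_Un)
  moreover have "cylinder x J \<inter> (\<Union>\<T> \<union> V) \<noteq> {}" if x: "x \<in> \<E>" "finite J" for x J
  proof (cases "cylinder x J \<inter> U = {}")
    case True
    then have "cylinder x J \<subseteq> V" by (rule V_max[OF openin_cylinder[OF x]])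
    then show ?thesis using cylinder_self[OF x(1)] by blast
  next
    case False
    then obtain y where y: "y \<in> cylinder x J \<inter> U" by blast
    have "openin \<C> (cylinder x J \<inter> U)" using openin_cylinder[OF x] U by blast
    then obtain K where K: "finite K" "y \<in> \<E>" "cylinder y K \<subseteq> cylinder x J \<inter> U"
      using openin_contains_cylinder[OF _ y] by metis
    have "\<not> cylinder y K - \<Union>\<T> = cylinder y K"
    proof
      assume "cylinder y K - \<Union>\<T> = cylinder y K"
      then have "cylinder y K \<in> null_sets \<M>" using \<T>(6)[OF K(2,1)] K(3) by simp
      then show False using emeasure_cylinder(2)[OF K(2,1)] by (simp add: null_sets_def)
    qed
    then show ?thesis using K(3) by blast
  qed
  ultimately have *: "\<E> - (\<Union>\<T> \<union> V) \<in> \<J>"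
    by (rule dense_open_meager_complement)
  have "U \<subseteq> \<E>" using openin_subset[OF U] by (simp add: topspace_cantor)
  have "open_rep X U" unfolding open_rep_def
  proof (intro exI[of _ \<T>] conjI \<T>(1))
    show "U - \<Union>\<T> \<in> \<J>"
      by (rule meager_subset[OF *]) (use \<open>U \<subseteq> \<E>\<close> V_disj in blast)
    have "\<Union>\<T> - U = {}" using \<T>(5) by blast
    then show "\<Union>\<T> - U \<in> \<J>" by (simp only: meager_empty)
  qed
  then show ?thesis using \<T>(3,4) by blast
qed

lemma borel_open_rep:
  assumes "A \<in> borel_sets \<C>"
  shows "\<exists>X. countable X \<and> X \<subseteq> Field \<kappa> \<and> open_rep X A"
  using assms
proof (induction rule: borel_induct)
  case empty
  have "open_rep {} {}" unfolding open_rep_def using meager_empty by (intro exI[of _ "{}"]) simp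
  then show ?case by blast
next
  case ("open" U)
  then show ?case by (rule open_rep_open)
next
  case (compl A)
  then show ?case using open_rep_compl by blast
next
  case (union A)
  then have "\<forall>n. \<exists>X. countable X \<and> X \<subseteq> Field \<kappa> \<and> open_rep X (A n)" by blast
  from choice[OF this] obtain X where X: "\<forall>n. countable (X n) \<and> X n \<subseteq> Field \<kappa> \<and> open_rep (X n) (A n)" ..
  let ?X = "\<Union>n. X n"
  have "open_rep ?X (A n)" for n by (rule open_rep_mono[of "X n"]) (use X in auto)
  then have "\<forall>n. \<exists>\<T>. \<T> \<subseteq> cylinders ?X \<and> A n - \<Union>\<T> \<in> \<J> \<and>
     \<Union>\<T> - A n \<in> \<J>" unfolding open_rep_def by blast
  from choice[OF this] obtain T where T: "\<forall>n. T n \<subseteq> cylinders ?X \<and>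
     A n - \<Union>(T n) \<in> \<J> \<and> \<Union>(T n) - A n \<in> \<J>" ..
  have "open_rep ?X (\<Union>n. A n)" unfolding open_rep_def
  proof (intro exI[of _ "\<Union>n. T n"] conjI)
    show "(\<Union>n. T n) \<subseteq> cylinders ?X" using T by blast
    have 1: "(\<Union>n. A n - \<Union>(T n)) \<in> \<J>"
      using T by (intro meager_UN) auto
    show "(\<Union>n. A n) - \<Union>(\<Union>n. T n) \<in> \<J>"
      by (rule meager_subset[OF 1]) auto
    have 2: "(\<Union>n. \<Union>(T n) - A n) \<in> \<J>"
      using T by (intro meager_UN) auto
    show "\<Union>(\<Union>n. T n) - (\<Union>n. A n) \<in> \<J>"
      by (rule meager_subset[OF 2]) auto
  qed
  moreover have "countable ?X" "?X \<subseteq> Field \<kappa>" using X by auto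
  ultimately show ?case by blast
qed

lemma open_rep_cylinder_below:
  assumes "open_rep X A" "x \<in> \<E>" "cylinder x J \<inter> A \<notin> \<J>"
  shows "\<exists>e\<in>cylinders X. e \<inter> cylinder x J \<noteq> {} \<and> e - A \<in> \<J>"
proof -
  obtain \<T> where \<T>: "\<T> \<subseteq> cylinders X" "A - \<Union>\<T> \<in> \<J>"
     "\<Union>\<T> - A \<in> \<J>" using assms(1) unfolding open_rep_def by blast
  have "cylinder x J \<inter> \<Union>\<T> \<noteq> {}"
  proof
    assume "cylinder x J \<inter> \<Union>\<T> = {}"
    then have "cylinder x J \<inter> A \<subseteq> A - \<Union>\<T>" by blast
    then show False using assms(3) meager_subset[OF \<T>(2)] by blast
  qed
  then obtain e where e: "e \<in> \<T>" "e \<inter> cylinder x J \<noteq> {}" by blast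
  moreover have "e - A \<in> \<J>" by (rule meager_subset[OF \<T>(3)]) (use e in blast)
  ultimately show ?thesis using \<T>(1) by blast
qed

text \<open>Here \<open>c\<close> is below the upper projection of \<open>A\<close> to \<open>Z\<close>, and it follows that \<open>c\<close> is below \<open>B\<close>. Otherwise
  some cylinder \<open>d\<close> over \<open>Y\<close> that meets \<open>c\<close> is almost disjoint from \<open>B\<close>. Shrink \<open>c\<close> to agree with \<open>d\<close> on
  the coordinates in \<open>Z\<close>. The smaller cylinder still meets \<open>A\<close>, so it meets a cylinder \<open>e\<close> over \<open>X\<close>
  that lies almost inside \<open>A\<close>. The remaining conditions of \<open>d\<close> concern coordinates in \<open>Y - Z\<close>, about
  which neither \<open>e\<close> nor \<open>c\<close> says anything; so \<open>c\<close>, \<open>d\<close> and \<open>e\<close> have a common point. Then their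
  intersection is a nonempty open set that is almost inside \<open>A\<close> and almost disjoint from \<open>B\<close>.\<close>

lemma cylinder_overlap:
  assumes rep: "open_rep X A" "open_rep Y (\<E> - B)" and XY: "X \<inter> Y \<subseteq> Z"
    and le: "A - B \<in> \<J>"
    and c: "c \<in> cylinders Z"
    and pos: "\<And>c'. c' \<in> cylinders Z \<Longrightarrow> c' \<subseteq> c \<Longrightarrow> c' \<inter> A \<notin> \<J>"
  shows "c - B \<in> \<J>"
proof (rule ccontr)
  assume n: "c - B \<notin> \<J>"
  obtain v K where v: "c = cylinder v K" "v \<in> \<E>" "finite K" "K \<subseteq> Z" using c unfolding cylinders_def by blast
  have "c - B = c \<inter> (\<E> - B)" unfolding v(1) cylinder_def by blast
  with n have "c \<inter> (\<E> - B) \<notin> \<J>" by simp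
  from open_rep_cylinder_below[OF rep(2) v(2) this[unfolded v(1)]] obtain d where
    d: "d \<in> cylinders Y" "d \<inter> c \<noteq> {}" "d - (\<E> - B) \<in> \<J>"
    unfolding v(1) by blast
  obtain y L where y: "d = cylinder y L" "y \<in> \<E>" "finite L" "L \<subseteq> Y" using d(1) unfolding cylinders_def by blast
  obtain p where p: "p \<in> d" "p \<in> c" using d(2) by blast
  then have pp: "p \<in> \<E>" unfolding v(1) cylinder_def by simp
  let ?M = "K \<union> (L \<inter> Z)"
  have c'Z: "cylinder p ?M \<in> cylinders Z" using pp v(3,4) y(3) by (auto intro!: cylindersI)
  have c'c: "cylinder p ?M \<subseteq> c" using p(2) unfolding v(1) cylinder_def by auto
  obtain e where e: "e \<in> cylinders X" "e \<inter> cylinder p ?M \<noteq> {}" "e - A \<in> \<J>"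
    using open_rep_cylinder_below[OF rep(1) pp pos[OF c'Z c'c]] by blast
  obtain x J where x: "e = cylinder x J" "x \<in> \<E>" "finite J" "J \<subseteq> X" using e(1) unfolding cylinders_def by blast
  obtain q where q: "q \<in> e" "q \<in> cylinder p ?M" using e(2) by blast
  then have qp: "q \<in> \<E>" unfolding x(1) cylinder_def by simp
  let ?w = "mix (L - Z) p q"
  have w: "?w \<in> \<E>" by (rule mix_points[OF pp qp])
  have "?w \<in> e" using q(1) w x(4) y(4) XY unfolding x(1) cylinder_def mix_def by auto
  moreover have "?w \<in> c"
    using q(2) p(2) w v(4) unfolding v(1) cylinder_def mix_def by auto
  moreover have "?w \<in> d" using q(2) p(1) w unfolding y(1) cylinder_def mix_def by auto
  ultimately have ne: "e \<inter> c \<inter> d \<noteq> {}" by blast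
  have "openin \<C> (e \<inter> c \<inter> d)"
    unfolding x(1) v(1) y(1) by (intro openin_Int openin_cylinder x v y)
  from open_not_meager[OF this ne] have nm: "e \<inter> c \<inter> d \<notin> \<J>" .
  have "d \<inter> B \<subseteq> d - (\<E> - B)" by blast
  then have "e \<inter> c \<inter> d \<subseteq> (e - A) \<union> (A - B) \<union> (d - (\<E> - B))" by blast
  from meager_subset[OF meager_Un[OF meager_Un[OF e(3) le] d(3)] this] show False using nm by simp
qed

text \<open>Every cylinder over \<open>Z\<close> contains a cylinder over \<open>Z\<close> of one of two kinds: those that almost miss \<open>A\<close>,
  and those that belong to the upper projection. The former are countably many, so together they still
  almost miss \<open>A\<close>.\<close>

lemma upper_cylinders_cover:
  assumes Z: "countable Z" and A: "A \<subseteq> \<E>"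
  shows "A - \<Union>{c\<in>cylinders Z. \<forall>c'\<in>cylinders Z. c' \<subseteq> c \<longrightarrow> c' \<inter> A \<notin> \<J>}
    \<in> \<J>" (is "A - \<Union>?U \<in> _")
proof -
  let ?N = "{c\<in>cylinders Z. c \<inter> A \<in> \<J>}"
  have N: "\<Union>?N \<inter> A \<in> \<J>"
  proof -
    have "countable ?N" by (rule countable_subset[OF _ countable_cylinders[OF Z]]) blast
    then have "(\<Union>c\<in>?N. c \<inter> A) \<in> \<J>" by (rule meager_UN) simp
    then show ?thesis by (rule meager_subset) blast
  qed
  have "openin \<C> (\<Union>?N \<union> \<Union>?U)"
    by (intro openin_Un openin_cylinders[of ?N Z] openin_cylinders[of ?U Z]) blast+
  moreover have "cylinder x J \<inter> (\<Union>?N \<union> \<Union>?U) \<noteq> {}" if x: "x \<in> \<E>" "finite J" for x J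
  proof (cases "cylinder x (J \<inter> Z) \<in> ?U")
    case True
    then show ?thesis using cylinder_self[OF x(1)] by blast
  next
    case False
    have "cylinder x (J \<inter> Z) \<in> cylinders Z" using x by (auto intro: cylindersI)
    with False obtain c where c: "c \<in> ?N" "c \<subseteq> cylinder x (J \<inter> Z)" by blast
    then obtain y K where y: "c = cylinder y K" "y \<in> \<E>" "K \<subseteq> Z" unfolding cylinders_def by blast
    let ?w = "mix Z y x"
    have w: "?w \<in> \<E>" by (rule mix_points[OF y(2) x(1)])
    have "y \<in> cylinder x (J \<inter> Z)" using c(2) cylinder_self[OF y(2)] y(1) by blast
    then have "?w \<in> cylinder x J" using w unfolding cylinder_def mix_def by auto
    moreover have "?w \<in> c" using w y(3) unfolding y(1) cylinder_def mix_def by auto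
    ultimately show ?thesis using c(1) by blast
  qed
  ultimately have "\<E> - (\<Union>?N \<union> \<Union>?U) \<in> \<J>"
    by (rule dense_open_meager_complement)
  from meager_Un[OF this N] show ?thesis by (rule meager_subset) (use A in blast)
qed

lemma cylinders_nonempty: "cylinders Z \<noteq> {}"
  using cylindersI[OF cantor_points_inhabited, of "{}" Z] by blast

text \<open>The codes of the two projections to \<open>Z\<close> are sets of numbers of cylinders over \<open>Z\<close>, and decoding is
  the union of the cylinders.\<close>

lemma weak_Freese_Nation_borel_meager:
  assumes wfn: "weak_Freese_Nation (UNIV :: nat set set) (\<subseteq>)"
    and covers: "shared_covers (countable_subsets (Field \<kappa>))"
  shows "weak_Freese_Nation (borel_sets \<C>) (\<lambda>A B. A - B \<in> \<J>)"
proof -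
  let ?B = "borel_sets \<C>" and ?I = "\<J>"
  have "\<forall>A\<in>?B. \<exists>X. countable X \<and> X \<subseteq> Field \<kappa> \<and> open_rep X A" using borel_open_rep by blast
  from bchoice[OF this] obtain supp where supp: "\<forall>A\<in>?B. countable (supp A) \<and> supp A \<subseteq> Field \<kappa> \<and> open_rep (supp A) A" ..
  define c where "c Z n = from_nat_into (cylinders Z) n" for Z n
  have c: "c Z n \<in> cylinders Z" for Z n unfolding c_def by (rule from_nat_into[OF cylinders_nonempty])
  have c_surj: "\<exists>n. e = c Z n" if "countable Z" "e \<in> cylinders Z" for Z e
    unfolding c_def using from_nat_into_surj[OF countable_cylinders[OF that(1)] that(2)] by metis
  define up where "up Z A = {n. \<forall>c'\<in>cylinders Z. c' \<subseteq> c Z n \<longrightarrow> c' \<inter> A \<notin> ?I}" for Z A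
  define low where "low Z A = {n. c Z n - A \<in> ?I}" for Z A
  define j where "j Z R = (\<Union>n\<in>R. c Z n)" for Z and R :: "nat set"
  show ?thesis
  proof (rule weak_Freese_Nation_shared_covers[OF wfn covers, of _ supp j _ up low])
    fix A assume A: "A \<in> ?B"
    show "supp A \<in> countable_subsets (Field \<kappa>)" using bspec[OF supp A] by blast
    fix Z R assume Z: "Z \<in> countable_subsets (Field \<kappa>)"
    show "A - j Z R \<in> ?I" if "up Z A \<subseteq> R"
    proof (rule meager_subset[OF upper_cylinders_cover[of Z A]])
      show "countable Z" "A \<subseteq> \<E>" using Z borel_subset_points[OF A] by auto
      have "\<Union>{e \<in> cylinders Z. \<forall>c'\<in>cylinders Z. c' \<subseteq> e \<longrightarrow> c' \<inter> A \<notin> ?I} \<subseteq> j Z R"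
      proof
        fix x assume "x \<in> \<Union>{e \<in> cylinders Z. \<forall>c'\<in>cylinders Z. c' \<subseteq> e \<longrightarrow> c' \<inter> A \<notin> ?I}"
        then obtain e where e: "x \<in> e" "e \<in> cylinders Z" "\<forall>c'\<in>cylinders Z. c' \<subseteq> e \<longrightarrow> c' \<inter> A \<notin> ?I" by blast
        obtain n where n: "e = c Z n" using c_surj[OF _ e(2)] Z by blast
        have "n \<in> up Z A" using e(3) unfolding up_def n by blast
        then show "x \<in> j Z R" using that e(1) unfolding j_def n by blast
      qed
      then show "A - j Z R \<subseteq> A - \<Union>{e \<in> cylinders Z. \<forall>c'\<in>cylinders Z. c' \<subseteq> e \<longrightarrow> c' \<inter> A \<notin> ?I}" by blast
    qed
    show "j Z R - A \<in> ?I" if "R \<subseteq> low Z A"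
    proof -
      have "(\<Union>n\<in>R. c Z n - A) \<in> ?I" using that unfolding low_def by (intro meager_UN) auto
      then show ?thesis by (rule meager_subset) (auto simp: j_def)
    qed
  next
    fix Z R
    have "openin \<C> (\<Union>(c Z ` R))" by (rule openin_cylinders[of _ Z]) (use c in blast)
    then show "j Z R \<in> ?B" unfolding j_def by (rule open_borel)
  next
    fix A B Z assume A: "A \<in> ?B" and B: "B \<in> ?B" and le: "A - B \<in> ?I" and XY: "supp A \<inter> supp B \<subseteq> Z"
    have rA: "open_rep (supp A) A" using bspec[OF supp A] by blast
    have rB: "open_rep (supp B) (\<E> - B)" using bspec[OF supp B] open_rep_compl by blast
    show "up Z A \<subseteq> low Z B"
    proof
      fix n assume "n \<in> up Z A"
      then have "c Z n - B \<in> ?I"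
        unfolding up_def by (intro cylinder_overlap[OF rA rB XY le c]) blast
      then show "n \<in> low Z B" unfolding low_def by simp
    qed
  qed
qed

lemma Cohen_weak_Freese_Nation_iff:
  "weak_Freese_Nation (Cohen_algebra \<kappa>) (Cohen_le \<kappa>) \<longleftrightarrow>
    weak_Freese_Nation (borel_sets \<C>) (\<lambda>A B. A - B \<in> \<J>)"
  unfolding Cohen_algebra_def Cohen_le_def
proof (rule weak_Freese_Nation_quotient)
  interpret sigma_algebra "\<E>" "borel_sets \<C>" by (rule borel_sets_sigma)
  show "A \<inter> B \<in> borel_sets \<C>"
    if "A \<in> borel_sets \<C>" "B \<in> borel_sets \<C>" for A B
    using that by (rule Int)
  show "A \<in> \<J>"
    if "B \<in> \<J>" "A \<subseteq> B" for A B using that by (rule meager_subset)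
  show "A \<union> B \<in> \<J>"
    if "A \<in> \<J>" "B \<in> \<J>" for A B
    using that by (rule meager_Un)
qed (rule meager_empty)

section \<open>The measure algebra\<close>

abbreviation coin :: "bool measure" where "coin \<equiv> uniform_count_measure UNIV"

lemma cantor_point_measurable:
  assumes "i \<in> Field \<kappa>" shows "(\<lambda>x. x i) \<in> \<M> \<rightarrow>\<^sub>M coin"
  unfolding cantor_measure_def by (rule measurable_component_singleton[OF assms])

lemma measurable_into_cantor:
  assumes "\<And>x. x \<in> space N \<Longrightarrow> f x \<in> \<E>"
    and "\<And>i. i \<in> Field \<kappa> \<Longrightarrow> (\<lambda>x. f x i) \<in> N \<rightarrow>\<^sub>M coin"
  shows "f \<in> N \<rightarrow>\<^sub>M \<M>"
  unfolding cantor_measure_def using assms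
  by (intro measurable_PiM_single') (auto simp: space_uniform_count_measure)

lemma mix_measurable:
  "(\<lambda>p. mix Z (fst p) (snd p)) \<in> \<M> \<Otimes>\<^sub>M \<M> \<rightarrow>\<^sub>M \<M>"
proof (rule measurable_into_cantor)
  fix p assume "p \<in> space (\<M> \<Otimes>\<^sub>M \<M>)"
  then have "fst p \<in> \<E>" "snd p \<in> \<E>"
    unfolding space_pair_measure space_cantor by (simp_all add: mem_Times_iff)
  then show "mix Z (fst p) (snd p) \<in> \<E>" by (rule mix_points)
next
  fix i assume i: "i \<in> Field \<kappa>"
  show "(\<lambda>p. mix Z (fst p) (snd p) i) \<in> \<M> \<Otimes>\<^sub>M \<M> \<rightarrow>\<^sub>M coin"
  proof (cases "i \<in> Z")
    case True
    have "(\<lambda>p. fst p i) \<in> \<M> \<Otimes>\<^sub>M \<M> \<rightarrow>\<^sub>M coin"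
      by (rule measurable_compose[OF measurable_fst cantor_point_measurable[OF i]])
    then show ?thesis using True by (simp add: mix_def)
  next
    case False
    have "(\<lambda>p. snd p i) \<in> \<M> \<Otimes>\<^sub>M \<M> \<rightarrow>\<^sub>M coin"
      by (rule measurable_compose[OF measurable_snd cantor_point_measurable[OF i]])
    then show ?thesis using False by (simp add: mix_def)
  qed
qed

lemma mix_section_measurable:
  assumes "x \<in> \<E>" shows "mix Z x \<in> \<M> \<rightarrow>\<^sub>M \<M>"
proof -
  have "(\<lambda>y. (x, y)) \<in> \<M> \<rightarrow>\<^sub>M \<M> \<Otimes>\<^sub>M \<M>"
    using assms by (intro measurable_Pair1') (simp add: space_cantor)
  from measurable_compose[OF this mix_measurable, of Z] show ?thesis by simp
qed

lemma emeasure_finite_constraints: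
  assumes "J \<subseteq> Field \<kappa>" "finite J"
  shows "emeasure \<M> {x\<in>\<E>. \<forall>i\<in>J. x i \<in> B i} = (\<Prod>i\<in>J. emeasure coin (B i))"
    and "{x\<in>\<E>. \<forall>i\<in>J. x i \<in> B i} \<in> sets \<M>"
proof -
  interpret product_prob_space "\<lambda>_ :: 'a. coin" "Field \<kappa>"
    by (intro product_prob_spaceI prob_space_uniform_count_measure) auto
  show "emeasure \<M> {x\<in>\<E>. \<forall>i\<in>J. x i \<in> B i} = (\<Prod>i\<in>J. emeasure coin (B i))"
    using emeasure_PiM_Collect[OF assms, of B]
    unfolding space_cantor[symmetric] unfolding cantor_measure_def by (simp add: sets_uniform_count_measure)
  have "{x\<in>space \<M>. \<forall>i\<in>J. x i \<in> B i} \<in> sets \<M>"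
  proof (rule sets.sets_Collect_finite_All[OF _ assms(2)])
    fix i assume "i \<in> J"
    then have "(\<lambda>x. x i) -` B i \<inter> space \<M> \<in> sets \<M>"
      using assms(1) by (intro measurable_sets[OF cantor_point_measurable]) (auto simp: sets_uniform_count_measure)
    moreover have "(\<lambda>x. x i) -` B i \<inter> space \<M> = {x\<in>space \<M>. x i \<in> B i}" by auto
    ultimately show "{x\<in>space \<M>. x i \<in> B i} \<in> sets \<M>" by simp
  qed
  then show "{x\<in>\<E>. \<forall>i\<in>J. x i \<in> B i} \<in> sets \<M>" by (simp add: space_cantor)
qed

text \<open>Pasting two independent random points yields a random point.\<close>

lemma distr_mix:
  "distr (\<M> \<Otimes>\<^sub>M \<M>) \<M> (\<lambda>p. mix Z (fst p) (snd p)) =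
    \<M>" (is "?D = ?M")
proof -
  interpret M: prob_space ?M by (rule prob_space_cantor)
  have "?M = ?D"
  proof (rule measure_eqI_PiM_infinite[where I = "Field \<kappa>" and M = "\<lambda>_. coin"])
    show "sets ?M = sets (\<Pi>\<^sub>M i\<in>Field \<kappa>. coin)" by (simp add: cantor_measure_def)
    then show "sets ?D = sets (\<Pi>\<^sub>M i\<in>Field \<kappa>. coin)" by simp
    show "finite_measure ?M" by (rule M.finite_measure_axioms)
    fix B :: "'a \<Rightarrow> bool set" and J assume J: "finite J" "J \<subseteq> Field \<kappa>"
    let ?S = "\<lambda>J. {x\<in>\<E>. \<forall>i\<in>J. x i \<in> B i}"
    have eq: "prod_emb (Field \<kappa>) (\<lambda>_. coin) J (Pi\<^sub>E J B) = ?S J"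
      using J(2) by (auto simp: prod_emb_def PiE_iff extensional_def space_uniform_count_measure)
    have "emeasure ?D (?S J) = emeasure (?M \<Otimes>\<^sub>M ?M) ((\<lambda>p. mix Z (fst p) (snd p)) -` ?S J \<inter> space (?M \<Otimes>\<^sub>M ?M))"
      by (rule emeasure_distr[OF mix_measurable emeasure_finite_constraints(2)[OF J(2,1)]])
    also have "(\<lambda>p. mix Z (fst p) (snd p)) -` ?S J \<inter> space (?M \<Otimes>\<^sub>M ?M) = ?S (J \<inter> Z) \<times> ?S (J - Z)"
      using mix_points by (auto simp: space_pair_measure space_cantor) (auto simp: mix_def split: if_splits)
    also have "emeasure (?M \<Otimes>\<^sub>M ?M) (?S (J \<inter> Z) \<times> ?S (J - Z)) = emeasure ?M (?S (J \<inter> Z)) * emeasure ?M (?S (J - Z))"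
      using J by (intro M.emeasure_pair_measure_Times emeasure_finite_constraints) auto
    also have "\<dots> = (\<Prod>i\<in>J \<inter> Z. emeasure coin (B i)) * (\<Prod>i\<in>J - Z. emeasure coin (B i))"
      using J by (intro arg_cong2[where f = "(*)"] emeasure_finite_constraints) auto
    also have "\<dots> = (\<Prod>i\<in>J. emeasure coin (B i))"
      using J(1) by (rule prod.Int_Diff[symmetric])
    also have "\<dots> = emeasure ?M (?S J)" by (rule emeasure_finite_constraints(1)[OF J(2,1), symmetric])
    finally show "emeasure ?M (prod_emb (Field \<kappa>) (\<lambda>_. coin) J (Pi\<^sub>E J B)) =
        emeasure ?D (prod_emb (Field \<kappa>) (\<lambda>_. coin) J (Pi\<^sub>E J B))" unfolding eq by simp
  qed
  then show ?thesis by simp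
qed

definition slice :: "'a set \<Rightarrow> ('a \<Rightarrow> bool) \<Rightarrow> ('a \<Rightarrow> bool) set \<Rightarrow> ('a \<Rightarrow> bool) set" where
  "slice Z x A = {y\<in>\<E>. mix Z x y \<in> A}"

lemma slice_sets:
  assumes "x \<in> \<E>" "A \<in> sets \<M>" shows "slice Z x A \<in> sets \<M>"
proof -
  have "slice Z x A = mix Z x -` A \<inter> space \<M>" unfolding slice_def space_cantor by auto
  then show ?thesis using measurable_sets[OF mix_section_measurable[OF assms(1)] assms(2)] by simp
qed

lemma mix_preimage_sets:
  assumes "A \<in> sets \<M>"
  shows "{p\<in>\<E> \<times> \<E>. mix Z (fst p) (snd p) \<in> A} \<in> sets (\<M> \<Otimes>\<^sub>M \<M>)"
    (is "?P \<in> _")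
    and "emeasure (\<M> \<Otimes>\<^sub>M \<M>)
      {p\<in>\<E> \<times> \<E>. mix Z (fst p) (snd p) \<in> A} = emeasure \<M> A"
proof -
  have eq: "?P = (\<lambda>p. mix Z (fst p) (snd p)) -` A \<inter> space (\<M> \<Otimes>\<^sub>M \<M>)"
    by (auto simp: space_pair_measure space_cantor)
  show "?P \<in> sets (\<M> \<Otimes>\<^sub>M \<M>)"
    unfolding eq by (rule measurable_sets[OF mix_measurable assms])
  show "emeasure (\<M> \<Otimes>\<^sub>M \<M>) ?P = emeasure \<M> A"
    unfolding eq using emeasure_distr[OF mix_measurable assms, of Z] by (simp add: distr_mix)
qed

text \<open>Fubini's theorem for the pasting map.\<close>

lemma slice_emeasure_measurable:
  assumes "A \<in> sets \<M>"
  shows "(\<lambda>x. emeasure \<M> (slice Z x A)) \<in> borel_measurable \<M>"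
    and "emeasure \<M> A = (\<integral>\<^sup>+x. emeasure \<M> (slice Z x A) \<partial>\<M>)"
proof -
  interpret M: prob_space "\<M>" by (rule prob_space_cantor)
  let ?P = "{p\<in>\<E> \<times> \<E>. mix Z (fst p) (snd p) \<in> A}"
  have sec: "Pair x -` ?P = slice Z x A" if "x \<in> space \<M>" for x
    using that unfolding slice_def space_cantor by auto
  have "(\<lambda>x. emeasure \<M> (Pair x -` ?P)) \<in> borel_measurable \<M>"
    by (rule M.measurable_emeasure_Pair[OF mix_preimage_sets(1)[OF assms]])
  moreover have "(\<lambda>x. emeasure \<M> (Pair x -` ?P)) \<in> borel_measurable \<M> \<longleftrightarrow>
    (\<lambda>x. emeasure \<M> (slice Z x A)) \<in> borel_measurable \<M>"
    by (rule measurable_cong) (simp only: sec)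
  ultimately show "(\<lambda>x. emeasure \<M> (slice Z x A)) \<in> borel_measurable \<M>" by blast
  have "emeasure \<M> A = (\<integral>\<^sup>+x. emeasure \<M> (Pair x -` ?P) \<partial>\<M>)"
    using M.emeasure_pair_measure_alt[OF mix_preimage_sets(1)[OF assms]] mix_preimage_sets(2)[OF assms] by simp
  also have "\<dots> = (\<integral>\<^sup>+x. emeasure \<M> (slice Z x A) \<partial>\<M>)"
    by (rule nn_integral_cong) (simp only: sec)
  finally show "emeasure \<M> A = (\<integral>\<^sup>+x. emeasure \<M> (slice Z x A) \<partial>\<M>)" .
qed

lemma depends_on_iff:
  assumes "depends_on Z A" "x \<in> \<E>" "y \<in> \<E>" "\<And>i. i \<in> Z \<Longrightarrow> x i = y i"
  shows "x \<in> A \<longleftrightarrow> y \<in> A"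
proof -
  have "\<forall>i\<in>Z. x i = y i" "\<forall>i\<in>Z. y i = x i" using assms(4) by simp_all
  then show ?thesis using assms(1-3) unfolding depends_on_def by blast
qed

lemma depends_onI:
  assumes "A \<subseteq> \<E>"
    and "\<And>x y. x \<in> A \<Longrightarrow> y \<in> \<E> \<Longrightarrow> (\<And>i. i \<in> Z \<Longrightarrow> x i = y i) \<Longrightarrow> y \<in> A"
  shows "depends_on Z A"
  unfolding depends_on_def
proof (intro conjI ballI impI)
  fix x y assume "x \<in> A" "y \<in> \<E>" "\<forall>i\<in>Z. x i = y i"
  then show "y \<in> A" by (intro assms(2)[of x y]) simp_all
qed (rule assms(1))

lemma depends_on_subset: "depends_on Z A \<Longrightarrow> A \<subseteq> \<E>"
  unfolding depends_on_def by simp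

lemma depends_on_mono:
  assumes "depends_on Z A" "Z \<subseteq> Z'" shows "depends_on Z' A"
proof (rule depends_onI)
  show "A \<subseteq> \<E>" by (rule depends_on_subset[OF assms(1)])
  then show "y \<in> A" if "x \<in> A" "y \<in> \<E>" "\<And>i. i \<in> Z' \<Longrightarrow> x i = y i" for x y
    using depends_on_iff[OF assms(1), of x y] that assms(2) by (meson subsetD)
qed

lemma depends_on_compl:
  assumes "depends_on Z A" shows "depends_on Z (\<E> - A)"
proof (rule depends_onI)
  fix x y assume "x \<in> \<E> - A" "y \<in> \<E>" "\<And>i. i \<in> Z \<Longrightarrow> x i = y i"
  then show "y \<in> \<E> - A" using depends_on_iff[OF assms, of x y] by simp
qed simp

lemma depends_on_UN:
  assumes "\<And>n. n \<in> N \<Longrightarrow> depends_on Z (A n)" shows "depends_on Z (\<Union>n\<in>N. A n)"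
proof (rule depends_onI)
  show "(\<Union>n\<in>N. A n) \<subseteq> \<E>" using depends_on_subset[OF assms] by (rule UN_least)
  fix x y assume x: "x \<in> (\<Union>n\<in>N. A n)" and y: "y \<in> \<E>" "\<And>i. i \<in> Z \<Longrightarrow> x i = y i"
  obtain n where n: "n \<in> N" "x \<in> A n" using x by (rule UN_E)
  have "x \<in> \<E>" by (rule subsetD[OF depends_on_subset[OF assms[OF n(1)]] n(2)])
  from depends_on_iff[OF assms[OF n(1)] this y] have "y \<in> A n" using n(2) by simp
  with n(1) show "y \<in> (\<Union>n\<in>N. A n)" by (rule UN_I)
qed

lemma emeasure_independent:
  assumes A: "A \<in> sets \<M>" "depends_on U A"
    and B: "B \<in> sets \<M>" "depends_on V B" and UV: "U \<inter> V = {}"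
  shows "emeasure \<M> (A \<inter> B) = emeasure \<M> A * emeasure \<M> B"
proof -
  interpret M: prob_space "\<M>" by (rule prob_space_cantor)
  have mA: "mix U x y \<in> A \<longleftrightarrow> x \<in> A" if "x \<in> \<E>" "y \<in> \<E>" for x y
    by (rule depends_on_iff[OF A(2) mix_points[OF that] that(1)]) (simp add: mix_def)
  have mB: "mix U x y \<in> B \<longleftrightarrow> y \<in> B" if "x \<in> \<E>" "y \<in> \<E>" for x y
    by (rule depends_on_iff[OF B(2) mix_points[OF that] that(2)]) (use UV in \<open>auto simp: mix_def\<close>)
  have "{p\<in>\<E> \<times> \<E>. mix U (fst p) (snd p) \<in> A \<inter> B} = A \<times> B"
  proof (intro equalityI subsetI)
    fix p assume "p \<in> A \<times> B"
    then have "fst p \<in> A" "snd p \<in> B" by (simp_all add: mem_Times_iff)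
    moreover from this have "fst p \<in> \<E>" "snd p \<in> \<E>"
      using subsetD[OF depends_on_subset[OF A(2)]] subsetD[OF depends_on_subset[OF B(2)]] by metis+
    ultimately show "p \<in> {p\<in>\<E> \<times> \<E>. mix U (fst p) (snd p) \<in> A \<inter> B}"
      using mA mB by (simp add: mem_Times_iff)
  next
    fix p assume "p \<in> {p\<in>\<E> \<times> \<E>. mix U (fst p) (snd p) \<in> A \<inter> B}"
    then show "p \<in> A \<times> B" using mA[of "fst p" "snd p"] mB[of "fst p" "snd p"] by (simp add: mem_Times_iff)
  qed
  then have "emeasure \<M> (A \<inter> B) = emeasure (\<M> \<Otimes>\<^sub>M \<M>) (A \<times> B)"
    using mix_preimage_sets(2)[OF sets.Int[OF A(1) B(1)], of U] by simp
  then show ?thesis using M.emeasure_pair_measure_Times[OF A(1) B(1)] by simp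
qed

text \<open>The upper projection of \<open>A\<close> to \<open>Z\<close>: the set where the conditional probability of \<open>A\<close> given the
  coordinates in \<open>Z\<close> is positive.\<close>

definition shadow :: "'a set \<Rightarrow> ('a \<Rightarrow> bool) set \<Rightarrow> ('a \<Rightarrow> bool) set" where
  "shadow Z A = {x\<in>\<E>. emeasure \<M> (slice Z x A) \<noteq> 0}"

lemma shadow_sets:
  assumes "A \<in> sets \<M>" shows "shadow Z A \<in> sets \<M>"
proof -
  have "shadow Z A = (\<lambda>x. emeasure \<M> (slice Z x A)) -` (- {0}) \<inter> space \<M>"
    unfolding shadow_def space_cantor by auto
  then show ?thesis using measurable_sets[OF slice_emeasure_measurable(1)[OF assms], of "- {0}" Z] by simp
qed

lemma shadow_depends_on: "depends_on Z (shadow Z A)"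
proof (rule depends_onI)
  show "shadow Z A \<subseteq> \<E>" unfolding shadow_def by blast
  fix x y assume "x \<in> shadow Z A" "y \<in> \<E>" "\<And>i. i \<in> Z \<Longrightarrow> x i = y i"
  moreover from this(3) have "mix Z x = mix Z y" by (intro ext) (simp add: mix_def)
  ultimately show "y \<in> shadow Z A" unfolding shadow_def slice_def by simp
qed

lemma shadow_null:
  assumes A: "A \<in> sets \<M>"
  shows "shadow Z A \<in> null_sets \<M> \<longleftrightarrow> A \<in> null_sets \<M>"
proof -
  have "emeasure \<M> A = 0 \<longleftrightarrow> emeasure \<M> (shadow Z A) = 0"
    using nn_integral_0_iff[OF slice_emeasure_measurable(1)[OF A, of Z]]
    unfolding slice_emeasure_measurable(2)[OF A, of Z] shadow_def space_cantor by simp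
  then show ?thesis using A shadow_sets[OF A] by (auto simp: null_sets_def)
qed

lemma null_outside_shadow:
  assumes A: "A \<in> sets \<M>"
  shows "A - shadow Z A \<in> null_sets \<M>"
proof -
  have AM: "A - shadow Z A \<in> sets \<M>" using A shadow_sets[OF A] by blast
  have "emeasure \<M> (slice Z x (A - shadow Z A)) = 0" if x: "x \<in> \<E>" for x
  proof (cases "x \<in> shadow Z A")
    case True
    have "mix Z x y \<in> shadow Z A" if "y \<in> \<E>" for y
      using depends_on_iff[OF shadow_depends_on[of Z A] x mix_points[OF x that, of Z]] True
      by (simp add: mix_def)
    then have "slice Z x (A - shadow Z A) = {}" unfolding slice_def by blast
    then show ?thesis by simp
  next
    case False
    then have 0: "emeasure \<M> (slice Z x A) = 0" using x unfolding shadow_def by simp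
    have "slice Z x (A - shadow Z A) \<subseteq> slice Z x A" unfolding slice_def by blast
    from emeasure_mono[OF this slice_sets[OF x A]] show ?thesis using 0 by simp
  qed
  then have "shadow Z (A - shadow Z A) = {}" unfolding shadow_def by blast
  then show ?thesis using shadow_null[OF AM, of Z] by simp
qed

text \<open>Once the coordinates in \<open>Z\<close> are fixed, the slices of \<open>A\<close> and \<open>B\<close> depend on the disjoint sets
  \<open>X - Z\<close> and \<open>Y - Z\<close>, so the measure of their intersection is the product of their measures. It
  vanishes almost everywhere, and then one of the two factors vanishes.\<close>

lemma disjoint_shadows:
  assumes A: "A \<in> sets \<M>" "depends_on X A"
    and B: "B \<in> sets \<M>" "depends_on Y B" and XY: "X \<inter> Y \<subseteq> Z"
    and null: "A \<inter> B \<in> null_sets \<M>"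
  shows "shadow Z A \<inter> shadow Z B \<in> null_sets \<M>"
proof -
  have dep: "depends_on (X - Z) (slice Z x A)" if "depends_on X A" "x \<in> \<E>" for A X x
  proof (rule depends_onI)
    fix y z assume yz: "y \<in> slice Z x A" "z \<in> \<E>" "\<And>i. i \<in> X - Z \<Longrightarrow> y i = z i"
    have y: "y \<in> \<E>" using yz(1) unfolding slice_def by simp
    have "mix Z x y i = mix Z x z i" if "i \<in> X" for i using yz(3)[of i] that by (simp add: mix_def)
    from depends_on_iff[OF that(1) mix_points[OF that(2) y] mix_points[OF that(2) yz(2)] this]
    show "z \<in> slice Z x A" using yz(1,2) unfolding slice_def by simp
  qed (auto simp: slice_def)
  have "shadow Z A \<inter> shadow Z B \<subseteq> shadow Z (A \<inter> B)"
  proof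
    fix x assume x: "x \<in> shadow Z A \<inter> shadow Z B"
    then have xp: "x \<in> \<E>" unfolding shadow_def by simp
    have "slice Z x (A \<inter> B) = slice Z x A \<inter> slice Z x B" unfolding slice_def by auto
    moreover have "emeasure \<M> (slice Z x A \<inter> slice Z x B) =
        emeasure \<M> (slice Z x A) * emeasure \<M> (slice Z x B)"
      by (rule emeasure_independent[OF slice_sets[OF xp A(1)] dep[OF A(2) xp] slice_sets[OF xp B(1)] dep[OF B(2) xp]])
        (use XY in blast)
    ultimately show "x \<in> shadow Z (A \<inter> B)" using x unfolding shadow_def by simp
  qed
  moreover have "shadow Z (A \<inter> B) \<in> null_sets \<M>" using shadow_null[of "A \<inter> B" Z] A B null by blast
  ultimately show ?thesis using shadow_sets[OF A(1)] shadow_sets[OF B(1)] by (meson null_sets_subset sets.Int)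
qed

lemma depends_on_countable:
  assumes "A \<in> sets \<M>"
  shows "\<exists>X. countable X \<and> X \<subseteq> Field \<kappa> \<and> depends_on X A"
  using assms
proof (induction rule: sets_cantor_induct)
  case empty
  have "depends_on {} {}" by (simp add: depends_on_def)
  then show ?case by blast
next
  case (basic i B)
  have "depends_on {i} {x\<in>\<E>. x i \<in> B}" by (auto simp: depends_on_def)
  then show ?case using basic by (intro exI[of _ "{i}"]) auto
next
  case (compl A)
  then show ?case using depends_on_compl by blast
next
  case (union A)
  then have "\<forall>n. \<exists>X. countable X \<and> X \<subseteq> Field \<kappa> \<and> depends_on X (A n)" by blast
  from choice[OF this] obtain X where X: "\<forall>n. countable (X n) \<and> X n \<subseteq> Field \<kappa> \<and> depends_on (X n) (A n)" ..
  have "depends_on (\<Union>n. X n) (\<Union>n. A n)"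
    by (rule depends_on_UN, rule depends_on_mono[of "X _"]) (use X in auto)
  then show ?case using X by (intro exI[of _ "\<Union>n. X n"]) auto
qed

definition clopens :: "'a set \<Rightarrow> ('a \<Rightarrow> bool) set set" where
  "clopens Z = {C\<in>sets \<M>. \<exists>J. finite J \<and> J \<subseteq> Z \<and> depends_on J C}"

lemma countable_clopens: "countable Z \<Longrightarrow> countable (clopens Z)"
  by (rule countable_subset[OF _ countable_depends_on_finite[of Z]]) (auto simp: clopens_def)

lemma clopens_empty: "{} \<in> clopens Z"
  unfolding clopens_def by (auto intro!: exI[of _ "{}"] simp: depends_on_def)

lemma clopens_sets: "C \<in> clopens Z \<Longrightarrow> C \<in> sets \<M>"
  unfolding clopens_def by simp

lemma clopens_compl:
  assumes "C \<in> clopens Z" shows "\<E> - C \<in> clopens Z"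
proof -
  obtain J where "finite J" "J \<subseteq> Z" "depends_on J C" using assms unfolding clopens_def by blast
  moreover have "\<E> - C \<in> sets \<M>"
    using clopens_sets[OF assms] sets.compl_sets[of C "\<M>"] by (simp add: space_cantor)
  ultimately show ?thesis unfolding clopens_def using depends_on_compl by blast
qed

lemma clopens_UN:
  assumes "finite N" "\<And>n. n \<in> N \<Longrightarrow> C n \<in> clopens Z" shows "(\<Union>n\<in>N. C n) \<in> clopens Z"
proof -
  have "\<forall>n\<in>N. \<exists>J. finite J \<and> J \<subseteq> Z \<and> depends_on J (C n)" using assms(2) unfolding clopens_def by blast
  from bchoice[OF this] obtain J where J: "\<forall>n\<in>N. finite (J n) \<and> J n \<subseteq> Z \<and> depends_on (J n) (C n)" ..
  have "depends_on (\<Union>n\<in>N. J n) (\<Union>n\<in>N. C n)"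
  proof (rule depends_on_UN)
    fix n assume n: "n \<in> N"
    show "depends_on (\<Union>n\<in>N. J n) (C n)"
      by (rule depends_on_mono[of "J n"]) (use J n in auto)
  qed
  moreover have "finite (\<Union>n\<in>N. J n)" "(\<Union>n\<in>N. J n) \<subseteq> Z" using J assms(1) by auto
  moreover have "(\<Union>n\<in>N. C n) \<in> sets \<M>"
    using assms clopens_sets by (intro sets.finite_UN) auto
  ultimately show ?thesis unfolding clopens_def by blast
qed

lemma measure_sym_diff_triangle:
  assumes "A \<in> sets \<M>" "B \<in> sets \<M>" "C \<in> sets \<M>"
  shows "measure \<M> (A - C) \<le> measure \<M> (A - B) + measure \<M> (B - C)"
proof -
  interpret prob_space "\<M>" by (rule prob_space_cantor)
  have "measure \<M> (A - C) \<le> measure \<M> ((A - B) \<union> (B - C))"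
    using assms by (intro finite_measure_mono) auto
  also have "\<dots> \<le> measure \<M> (A - B) + measure \<M> (B - C)"
    using assms by (intro measure_Un_le) auto
  finally show ?thesis .
qed

definition approximable :: "'a set \<Rightarrow> ('a \<Rightarrow> bool) set \<Rightarrow> bool" where
  "approximable Z A \<longleftrightarrow> A \<in> sets \<M> \<and>
    (\<forall>e>0. \<exists>C\<in>clopens Z. measure \<M> (A - C) < e \<and> measure \<M> (C - A) < e)"

lemma approximable_clopen: "C \<in> clopens Z \<Longrightarrow> approximable Z C"
  unfolding approximable_def using clopens_sets by (auto intro!: bexI[of _ C])

lemma approximable_compl:
  assumes "approximable Z A" shows "approximable Z (\<E> - A)"
  unfolding approximable_def
proof (intro conjI allI impI)
  have A: "A \<in> sets \<M>" using assms unfolding approximable_def by simp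
  then show "\<E> - A \<in> sets \<M>"
    using sets.compl_sets[of A "\<M>"] by (simp add: space_cantor)
  fix e :: real assume "e > 0"
  then obtain C where C: "C \<in> clopens Z" "measure \<M> (A - C) < e" "measure \<M> (C - A) < e"
    using assms unfolding approximable_def by blast
  have "(\<E> - A) - (\<E> - C) = C - A" "(\<E> - C) - (\<E> - A) = A - C"
    using sets.sets_into_space[OF A] sets.sets_into_space[OF clopens_sets[OF C(1)]] unfolding space_cantor by auto
  then show "\<exists>C\<in>clopens Z. measure \<M> (\<E> - A - C) < e \<and>
      measure \<M> (C - (\<E> - A)) < e"
    using C by (intro bexI[OF _ clopens_compl[OF C(1)]]) simp
qed

lemma approximable_UN:
  fixes A :: "nat \<Rightarrow> _"
  assumes A: "\<And>n. approximable Z (A n)" shows "approximable Z (\<Union>n. A n)"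
  unfolding approximable_def
proof (intro conjI allI impI)
  interpret prob_space "\<M>" by (rule prob_space_cantor)
  have AM: "A n \<in> sets \<M>" for n using A unfolding approximable_def by simp
  then show UM: "(\<Union>n. A n) \<in> sets \<M>" by blast
  fix e :: real assume e: "e > 0"
  have "(\<lambda>N. measure \<M> (\<Union>n<N. A n)) \<longlonglongrightarrow> measure \<M> (\<Union>N. \<Union>n<N. A n)"
  proof (rule finite_Lim_measure_incseq)
    show "range (\<lambda>N. \<Union>n<N. A n) \<subseteq> sets \<M>" using AM by auto
    show "incseq (\<lambda>N. \<Union>n<N. A n)" by (intro incseq_SucI UN_mono) auto
  qed
  moreover have "(\<Union>N. \<Union>n<N. A n) = (\<Union>n. A n)" by auto
  ultimately have "(\<lambda>N. measure \<M> (\<Union>n<N. A n)) \<longlonglongrightarrow> measure \<M> (\<Union>n. A n)" by simp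
  from LIMSEQ_D[OF this, of "e/2"] e obtain N where
    "norm (measure \<M> (\<Union>n<N. A n) - measure \<M> (\<Union>n. A n)) < e/2" by auto
  then have N: "measure \<M> (\<Union>n. A n) - measure \<M> (\<Union>n<N. A n) < e/2"
    unfolding real_norm_def by linarith
  have FM: "(\<Union>n<N. A n) \<in> sets \<M>" using AM by blast
  have N': "measure \<M> ((\<Union>n. A n) - (\<Union>n<N. A n)) < e/2"
  proof -
    have "(\<Union>n<N. A n) \<subseteq> (\<Union>n. A n)" by auto
    from finite_measure_Diff[OF UM FM this] show ?thesis using N by simp
  qed
  \<comment> \<open>\<open>N\<close> errors of at most \<open>?d\<close> add up to less than \<open>e/2\<close>; the other half of \<open>e\<close> is for the sets
     from the \<open>N\<close>-th on.\<close>
  let ?d = "e / (2 * (real N + 1))"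
  have d: "?d > 0" using e by simp
  have "\<forall>n. \<exists>C. C \<in> clopens Z \<and> measure \<M> (A n - C) < ?d \<and> measure \<M> (C - A n) < ?d"
    using A d unfolding approximable_def by blast
  from choice[OF this] obtain C where C: "\<forall>n. C n \<in> clopens Z \<and> measure \<M> (A n - C n) < ?d \<and>
      measure \<M> (C n - A n) < ?d" ..
  have CM: "C n \<in> sets \<M>" for n using C clopens_sets by blast
  let ?C = "\<Union>n<N. C n"
  have CZ: "?C \<in> clopens Z" using C by (intro clopens_UN) auto
  have Nd: "real N * ?d < e/2" using e by (simp add: field_simps)
  have sum: "measure \<M> (\<Union>n<N. D n) < e/2"
    if "\<And>n. D n \<in> sets \<M>" "\<And>n. measure \<M> (D n) < ?d" for D
  proof -
    have "measure \<M> (\<Union>n<N. D n) \<le> (\<Sum>n<N. measure \<M> (D n))"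
      using that(1) by (intro measure_UNION_le) auto
    also have "\<dots> \<le> (\<Sum>n<N. ?d)" by (intro sum_mono less_imp_le that(2))
    also have "\<dots> = real N * ?d" by simp
    finally show ?thesis using Nd by linarith
  qed
  have "measure \<M> ((\<Union>n<N. A n) - ?C) \<le> measure \<M> (\<Union>n<N. A n - C n)"
    using AM CM by (intro finite_measure_mono) auto
  also have "\<dots> < e/2" by (rule sum) (use AM CM C in auto)
  finally have "measure \<M> ((\<Union>n. A n) - ?C) < e"
    using measure_sym_diff_triangle[OF UM FM clopens_sets[OF CZ]] N' by linarith
  moreover have "measure \<M> (?C - (\<Union>n. A n)) \<le> measure \<M> (\<Union>n<N. C n - A n)"
    using AM CM by (intro finite_measure_mono) auto
  moreover have "measure \<M> (\<Union>n<N. C n - A n) < e/2" by (rule sum) (use AM CM C in auto)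
  ultimately show "\<exists>C\<in>clopens Z. measure \<M> ((\<Union>n. A n) - C) < e \<and> measure \<M> (C - (\<Union>n. A n)) < e"
    using CZ e by (intro bexI[of _ ?C]) auto
qed

text \<open>Measurable sets are approximated by clopen ones. To keep the clopen sets over \<open>Z\<close>, replace
  the coordinates outside \<open>Z\<close> by those of a fixed point \<open>b\<close>; this does not change a set that depends
  only on \<open>Z\<close>.\<close>

lemma depends_on_approximable:
  assumes A: "A \<in> sets \<M>" "depends_on Z A"
  shows "approximable Z A"
proof -
  define b where "b = (\<lambda>i\<in>Field \<kappa>. False)"
  have b: "b \<in> \<E>" unfolding b_def by (rule cantor_points_inhabited)
  define R where "R A = {x\<in>\<E>. mix Z x b \<in> A}" for A
  have "approximable Z (R A)" using A(1)
  proof (induction rule: sets_cantor_induct)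
    case empty
    have "R {} = {}" unfolding R_def by simp
    then show ?case using approximable_clopen[OF clopens_empty] by simp
  next
    case (basic i B)
    let ?S = "R {x\<in>\<E>. x i \<in> B}"
    have S: "?S = {x\<in>\<E>. mix Z x b i \<in> B}"
      unfolding R_def using mix_points[OF _ b] by auto
    show ?case
    proof (cases "i \<in> Z")
      case True
      have "?S = {x\<in>\<E>. \<forall>i\<in>{i}. x i \<in> B}" unfolding S mix_def using True by simp
      moreover have "{x\<in>\<E>. \<forall>i\<in>{i}. x i \<in> B} \<in> sets \<M>"
        using basic by (intro emeasure_finite_constraints(2)) auto
      moreover have "depends_on {i} {x\<in>\<E>. \<forall>i\<in>{i}. x i \<in> B}" by (auto simp: depends_on_def)
      ultimately have "?S \<in> clopens Z" unfolding clopens_def using True by (auto intro!: exI[of _ "{i}"])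
      then show ?thesis by (rule approximable_clopen)
    next
      case False
      have "?S = \<E> \<or> ?S = {}" unfolding S mix_def using False by auto
      moreover have "\<E> \<in> clopens Z" using clopens_compl[OF clopens_empty] by simp
      ultimately have "?S \<in> clopens Z" using clopens_empty by auto
      then show ?thesis by (rule approximable_clopen)
    qed
  next
    case (compl A)
    have "R (\<E> - A) = \<E> - R A" unfolding R_def using mix_points[OF _ b] by auto
    then show ?case using approximable_compl[OF compl(2)] by simp
  next
    case (union A)
    have "R (\<Union>n. A n) = (\<Union>n. R (A n))" unfolding R_def by auto
    then show ?case using approximable_UN[of Z "\<lambda>n. R (A n)"] union(2) by simp
  qed
  moreover have "R A = A"
  proof -
    have "mix Z x b \<in> A \<longleftrightarrow> x \<in> A" if "x \<in> \<E>" for x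
      by (rule depends_on_iff[OF A(2) mix_points[OF that b] that]) (simp add: mix_def)
    then show ?thesis unfolding R_def using depends_on_subset[OF A(2)] by auto
  qed
  ultimately show ?thesis by simp
qed

text \<open>A number codes a clopen set \<open>C\<close> over \<open>Z\<close> and a bound \<open>1 / (m + 1)\<close>, and it belongs to the code of
  \<open>A\<close> if \<open>C - A\<close> has measure below that bound. This is monotone in \<open>A\<close>, and since the clopen sets
  are dense, it reflects the order on sets that depend on \<open>Z\<close>.\<close>

definition code :: "'a set \<Rightarrow> ('a \<Rightarrow> bool) set \<Rightarrow> nat set" where
  "code Z A = {k. measure \<M> (from_nat_into (clopens Z) (fst (prod_decode k)) - A)
     < 1 / real (Suc (snd (prod_decode k)))}"

lemma code_mono:
  assumes A: "A \<in> sets \<M>" "B \<in> sets \<M>" "A - B \<in> null_sets \<M>"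
  shows "code Z A \<subseteq> code Z B"
proof
  fix k assume k: "k \<in> code Z A"
  let ?C = "from_nat_into (clopens Z) (fst (prod_decode k))"
  have "?C \<in> clopens Z" using clopens_empty by (intro from_nat_into) blast
  from measure_sym_diff_triangle[OF clopens_sets[OF this] A(1,2)] k
  show "k \<in> code Z B" using A(3) unfolding code_def by (simp add: measure_eq_0_null_sets)
qed

lemma code_reflects:
  assumes Z: "countable Z" and A: "A \<in> sets \<M>" "depends_on Z A"
    and B: "B \<in> sets \<M>" and sub: "code Z A \<subseteq> code Z B"
  shows "A - B \<in> null_sets \<M>"
proof -
  interpret prob_space "\<M>" by (rule prob_space_cantor)
  have "measure \<M> (A - B) \<le> 0"
  proof (rule field_le_epsilon)
    fix e :: real assume "e > 0"
    then have "e/2 > 0" by simp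
    then obtain m where m: "1 / real (Suc m) < e/2" using nat_approx_posE by blast
    have "1 / real (Suc m) > 0" by simp
    then obtain C where C: "C \<in> clopens Z" "measure \<M> (A - C) < 1 / real (Suc m)"
        "measure \<M> (C - A) < 1 / real (Suc m)"
      using depends_on_approximable[OF A] unfolding approximable_def by blast
    obtain n where n: "from_nat_into (clopens Z) n = C"
      using from_nat_into_surj[OF countable_clopens[OF Z] C(1)] by blast
    have "prod_encode (n, m) \<in> code Z A" using C(3) n unfolding code_def by simp
    then have "prod_encode (n, m) \<in> code Z B" using sub by (rule subsetD[rotated])
    then have "measure \<M> (C - B) < 1 / real (Suc m)" using n unfolding code_def by simp
    then show "measure \<M> (A - B) \<le> 0 + e"
      using measure_sym_diff_triangle[OF A(1) clopens_sets[OF C(1)] B] C(2) m by linarith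
  qed
  then have "measure \<M> (A - B) = 0" using measure_nonneg[of "\<M>" "A - B"] by linarith
  then show ?thesis using A(1) B by (auto simp: null_sets_def emeasure_eq_measure)
qed

text \<open>Kakutani's theorem. Let the union of \<open>\<T>\<close>, which depends on a countable set \<open>X\<close> of coordinates,
  contain almost all of each cylinder inside \<open>U\<close>. Take such a cylinder around a point of \<open>U\<close> and split
  it into a cylinder \<open>c\<close> over \<open>X\<close> and a cylinder over the complement of \<open>X\<close>. By independence, \<open>c\<close>
  itself is almost contained in the union of \<open>\<T>\<close>. There are only countably many such \<open>c\<close>, and so
  the rest of \<open>U\<close> lies in a null set.\<close>

lemma open_in_completion:
  assumes U: "openin \<C> U"
  shows "U \<in> sets (completion \<M>)"
proof -
  obtain \<T> X where \<T>: "\<T> \<subseteq> cylinders X" "countable \<T>" "countable X" "X \<subseteq> Field \<kappa>" "\<Union>\<T> \<subseteq> U"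
    "\<And>x J. x \<in> \<E> \<Longrightarrow> finite J \<Longrightarrow> cylinder x J \<subseteq> U \<Longrightarrow>
       cylinder x J - \<Union>\<T> \<in> null_sets \<M>"
    by (rule dense_countable_subunion[OF U]) (rule that)
  have cyl_sets: "c \<in> sets \<M>" if "c \<in> cylinders X" for c
    using that emeasure_cylinder(1) unfolding cylinders_def by blast
  have TM: "\<Union>\<T> \<in> sets \<M>" using \<T>(1,2) cyl_sets by (intro sets.countable_Union) auto
  have Tdep: "depends_on X (\<Union>\<T>)"
  proof -
    have "depends_on X (\<Union>c\<in>\<T>. c)"
    proof (rule depends_on_UN)
      fix c assume "c \<in> \<T>"
      then obtain x J where "c = cylinder x J" "J \<subseteq> X" using \<T>(1) unfolding cylinders_def by blast
      then show "depends_on X c" using depends_on_mono[OF depends_on_cylinder] by simp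
    qed
    then show ?thesis by simp
  qed
  let ?N = "{c - \<Union>\<T> |c. c \<in> cylinders X \<and> c - \<Union>\<T> \<in> null_sets \<M>}"
  have "countable ?N"
    by (rule countable_subset[OF _ countable_image[OF countable_cylinders[OF \<T>(3)], of "\<lambda>c. c - \<Union>\<T>"]]) blast
  then have N: "\<Union>?N \<in> null_sets \<M>" using null_sets_UN'[of ?N "\<lambda>c. c"] by auto
  have "U - \<Union>\<T> \<subseteq> \<Union>?N"
  proof
    fix x assume x: "x \<in> U - \<Union>\<T>"
    have "x \<in> U" using x by simp
    then obtain J where J: "finite J" "x \<in> \<E>" "cylinder x J \<subseteq> U"
      by (rule openin_contains_cylinder[OF U]) (rule that)
    let ?c = "cylinder x (J \<inter> X)" and ?d = "cylinder x (J - X)"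
    have cM: "?c - \<Union>\<T> \<in> sets \<M>" using emeasure_cylinder(1)[OF J(2), of "J \<inter> X"] J(1) TM by blast
    have dM: "?d \<in> sets \<M>" "emeasure \<M> ?d > 0"
      using emeasure_cylinder[OF J(2), of "J - X"] J(1) by auto
    have cd: "(?c - \<Union>\<T>) \<inter> ?d = cylinder x J - \<Union>\<T>" unfolding cylinder_def by auto
    have "depends_on X (?c - \<Union>\<T>)"
    proof -
      have c: "depends_on X ?c" by (rule depends_on_mono[OF depends_on_cylinder]) blast
      show ?thesis
      proof (rule depends_onI)
        fix y z assume yz: "y \<in> ?c - \<Union>\<T>" "z \<in> \<E>" "\<And>i. i \<in> X \<Longrightarrow> y i = z i"
        then have "y \<in> \<E>" unfolding cylinder_def by simp
        from depends_on_iff[OF c this yz(2,3)] depends_on_iff[OF Tdep this yz(2,3)]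
        show "z \<in> ?c - \<Union>\<T>" using yz(1) by simp
      qed (auto simp: cylinder_def)
    qed
    from emeasure_independent[OF cM this dM(1) depends_on_cylinder]
    have "emeasure \<M> (cylinder x J - \<Union>\<T>) =
        emeasure \<M> (?c - \<Union>\<T>) * emeasure \<M> ?d"
      unfolding cd by (simp add: Diff_disjoint Int_Diff)
    moreover have "emeasure \<M> (cylinder x J - \<Union>\<T>) = 0"
      using \<T>(6)[OF J(2,1,3)] by (simp add: null_sets_def)
    ultimately have "emeasure \<M> (?c - \<Union>\<T>) = 0" using dM(2) by auto
    then have "?c - \<Union>\<T> \<in> null_sets \<M>" using cM by (simp add: null_sets_def)
    moreover have "?c \<in> cylinders X" using J by (intro cylindersI) auto
    moreover have "x \<in> ?c - \<Union>\<T>" using x cylinder_self[OF J(2)] by simp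
    ultimately show "x \<in> \<Union>?N" by blast
  qed
  moreover have "U = \<Union>\<T> \<union> (U - \<Union>\<T>)" using \<T>(5) by blast
  ultimately show ?thesis using TM N by (intro sets_completionI[of U "\<Union>\<T>" "U - \<Union>\<T>" "\<Union>?N"])
qed

lemma borel_in_completion:
  assumes "A \<in> borel_sets \<C>" shows "A \<in> sets (completion \<M>)"
  using assms
proof (induction rule: borel_induct)
  case ("open" U)
  then show ?case by (rule open_in_completion)
next
  case (compl A)
  then show ?case using sets.compl_sets[of A "completion \<M>"] by (simp add: space_cantor)
qed auto

lemma sets_cantor_borel:
  assumes "A \<in> sets \<M>" shows "A \<in> borel_sets \<C>"
proof -
  interpret sigma_algebra "\<E>" "borel_sets \<C>" by (rule borel_sets_sigma)
  show ?thesis using assms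
  proof (induction rule: sets_cantor_induct)
    case empty then show ?case by simp
  next
    case (basic i B)
    have "openin \<C> {x\<in>\<E>. x i \<in> B}"
    proof -
      have "{x\<in>\<E>. x i \<in> B} = \<Union>{cylinder x {i} |x. x \<in> \<E> \<and> x i \<in> B}"
        unfolding cylinder_def by auto
      then show ?thesis by (auto intro!: openin_Union openin_cylinder)
    qed
    then show ?case by (rule open_borel)
  next
    case (compl A) then show ?case by blast
  next
    case (union A) then show ?case by blast
  qed
qed

text \<open>A Borel set is replaced by a measurable subset \<open>rep A\<close> of the same measure, which has a countable
  support. The lower projection \<open>core Z A\<close> is the complement of the upper projection of the complement.
  Decoding \<open>R\<close> takes the essential union of all sets over \<open>Z\<close> whose code is contained in \<open>R\<close>.\<close>

lemma weak_Freese_Nation_borel_null: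
  assumes wfn: "weak_Freese_Nation (UNIV :: nat set set) (\<subseteq>)"
    and covers: "shared_covers (countable_subsets (Field \<kappa>))"
  shows "weak_Freese_Nation (borel_sets \<C>)
    (\<lambda>A B. A - B \<in> null_sets (completion \<M>))"
proof -
  let ?B = "borel_sets \<C>" and ?M = "\<M>"
  let ?N = "null_sets (completion ?M)" and ?E = "\<E>"
  interpret prob_space ?M by (rule prob_space_cantor)
  have N_sub: "A \<in> ?N" if "C \<in> ?N" "A \<subseteq> C" for A C using null_sets_completion_subset[OF that(2,1)] .
  have N_M: "A \<in> ?N \<longleftrightarrow> A \<in> null_sets ?M" if "A \<in> sets ?M" for A by (rule null_sets_completion_iff[OF that])
  have N_I: "A \<in> ?N" if "A \<in> null_sets ?M" for A using that by (rule null_sets_completionI)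
  have "\<forall>A\<in>?B. \<exists>S. S \<in> sets ?M \<and> S \<subseteq> A \<and> A - S \<in> ?N"
  proof
    fix A assume "A \<in> ?B"
    from borel_in_completion[OF this] obtain S D D' where
      S: "A = S \<union> D" "D \<subseteq> D'" "D' \<in> null_sets ?M" "S \<in> sets ?M" by (rule sets_completionE)
    have "A - S \<in> ?N" by (rule N_sub[OF N_I[OF S(3)]]) (use S(1,2) in blast)
    then show "\<exists>S. S \<in> sets ?M \<and> S \<subseteq> A \<and> A - S \<in> ?N" using S(1,4) by blast
  qed
  from bchoice[OF this] obtain rep where rep: "\<forall>A\<in>?B. rep A \<in> sets ?M \<and> rep A \<subseteq> A \<and> A - rep A \<in> ?N" ..
  have "\<forall>A\<in>?B. \<exists>X. countable X \<and> X \<subseteq> Field \<kappa> \<and> depends_on X (rep A)"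
    by (intro ballI depends_on_countable) (use rep in simp)
  from bchoice[OF this] obtain supp where
    supp: "\<forall>A\<in>?B. countable (supp A) \<and> supp A \<subseteq> Field \<kappa> \<and> depends_on (supp A) (rep A)" ..
  have compl: "?E - A \<in> sets ?M" if "A \<in> sets ?M" for A
    using sets.compl_sets[OF that] by (simp add: space_cantor)
  define core where "core Z A = ?E - shadow Z (?E - A)" for Z A
  have core_sets: "core Z A \<in> sets ?M" if "A \<in> sets ?M" for Z A
    unfolding core_def by (intro compl shadow_sets that)
  have core_null: "core Z A - A \<in> null_sets ?M" if "A \<in> sets ?M" for Z A
  proof -
    have "core Z A - A = (?E - A) - shadow Z (?E - A)" unfolding core_def by blast
    then show ?thesis using null_outside_shadow[OF compl[OF that], of Z] by simp
  qed
  define \<S> where "\<S> Z R = {A\<in>sets ?M. depends_on Z A \<and> code Z A \<subseteq> R}" for Z R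
  have "\<exists>\<T>. \<T> \<subseteq> \<S> Z R \<and> countable \<T> \<and> (\<forall>A\<in>\<S> Z R. A - \<Union>\<T> \<in> null_sets ?M)" for Z R
    by (rule essential_union) (auto simp: \<S>_def)
  then have "\<forall>p. \<exists>\<T>. \<T> \<subseteq> \<S> (fst p) (snd p) \<and> countable \<T> \<and> (\<forall>A\<in>\<S> (fst p) (snd p). A - \<Union>\<T> \<in> null_sets ?M)" ..
  from choice[OF this] obtain T' where "\<forall>p. T' p \<subseteq> \<S> (fst p) (snd p) \<and> countable (T' p) \<and>
     (\<forall>A\<in>\<S> (fst p) (snd p). A - \<Union>(T' p) \<in> null_sets ?M)" ..
  then have T: "T' (Z, R) \<subseteq> \<S> Z R" "countable (T' (Z, R))" "A \<in> \<S> Z R \<Longrightarrow> A - \<Union>(T' (Z, R)) \<in> null_sets ?M" for Z R A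
    by (auto dest!: spec[of _ "(Z, R)"])
  define j where "j Z R = \<Union>(T' (Z, R))" for Z R
  have jM: "j Z R \<in> sets ?M" for Z R
    unfolding j_def using T(1)[of Z R] T(2)[of Z R] by (intro sets.countable_Union) (auto simp: \<S>_def)
  show ?thesis
  proof (rule weak_Freese_Nation_shared_covers[OF wfn covers, of _ supp j _
        "\<lambda>Z A. code Z (shadow Z (rep A))" "\<lambda>Z A. code Z (core Z (rep A))"])
    fix A assume A: "A \<in> ?B"
    have rA: "rep A \<in> sets ?M" "rep A \<subseteq> A" "A - rep A \<in> ?N" using bspec[OF rep A] by auto
    show "supp A \<in> countable_subsets (Field \<kappa>)" using bspec[OF supp A] by blast
    fix Z R assume Z: "Z \<in> countable_subsets (Field \<kappa>)"
    show "A - j Z R \<in> ?N" if up: "code Z (shadow Z (rep A)) \<subseteq> R"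
    proof -
      have "shadow Z (rep A) \<in> \<S> Z R"
        unfolding \<S>_def using up shadow_sets[OF rA(1)] shadow_depends_on by blast
      from N_I[OF T(3)[OF this]] have 1: "shadow Z (rep A) - j Z R \<in> ?N" unfolding j_def .
      have 2: "rep A - shadow Z (rep A) \<in> ?N" by (rule N_I[OF null_outside_shadow[OF rA(1)]])
      have "A - j Z R \<subseteq> (A - rep A) \<union> (rep A - shadow Z (rep A)) \<union> (shadow Z (rep A) - j Z R)" by blast
      with null_sets.Un[OF null_sets.Un[OF rA(3) 2] 1] show ?thesis by (rule N_sub)
    qed
    show "j Z R - A \<in> ?N" if low: "R \<subseteq> code Z (core Z (rep A))"
    proof -
      have "s - core Z (rep A) \<in> null_sets ?M" if "s \<in> T' (Z, R)" for s
      proof -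
        have "s \<in> \<S> Z R" using T(1) that by blast
        then have s: "s \<in> sets ?M" "depends_on Z s" "code Z s \<subseteq> code Z (core Z (rep A))"
          using low unfolding \<S>_def by auto
        show ?thesis using Z by (intro code_reflects[OF _ s(1,2) core_sets[OF rA(1)] s(3)]) simp
      qed
      then have "(\<Union>s\<in>T' (Z, R). s - core Z (rep A)) \<in> null_sets ?M" using T(2) by (intro null_sets_UN') auto
      moreover have "(\<Union>s\<in>T' (Z, R). s - core Z (rep A)) = j Z R - core Z (rep A)" unfolding j_def by blast
      ultimately have 1: "j Z R - core Z (rep A) \<in> ?N" using N_I by simp
      have 2: "core Z (rep A) - rep A \<in> ?N" by (rule N_I[OF core_null[OF rA(1)]])
      have "j Z R - A \<subseteq> (j Z R - core Z (rep A)) \<union> (core Z (rep A) - rep A)" using rA(2) by blast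
      with null_sets.Un[OF 1 2] show ?thesis by (rule N_sub)
    qed
  next
    show "j Z R \<in> ?B" for Z R by (rule sets_cantor_borel[OF jM])
  next
    fix A B Z assume A: "A \<in> ?B" and B: "B \<in> ?B" and le: "A - B \<in> ?N" and XY: "supp A \<inter> supp B \<subseteq> Z"
    have rA: "rep A \<in> sets ?M" "rep A \<subseteq> A" "depends_on (supp A) (rep A)"
      using bspec[OF rep A] bspec[OF supp A] by auto
    have rB: "rep B \<in> sets ?M" "B - rep B \<in> ?N" "depends_on (supp B) (rep B)"
      using bspec[OF rep B] bspec[OF supp B] by auto
    have "rep A \<inter> (?E - rep B) \<subseteq> (A - B) \<union> (B - rep B)" using rA(2) by blast
    with null_sets.Un[OF le rB(2)] have "rep A \<inter> (?E - rep B) \<in> ?N" by (rule N_sub)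
    then have null: "rep A \<inter> (?E - rep B) \<in> null_sets ?M" using N_M rA(1) compl[OF rB(1)] by blast
    have "shadow Z (rep A) \<inter> shadow Z (?E - rep B) \<in> null_sets ?M"
      by (rule disjoint_shadows[OF rA(1,3) compl[OF rB(1)] depends_on_compl[OF rB(3)] XY null])
    moreover have "shadow Z (rep A) \<inter> shadow Z (?E - rep B) = shadow Z (rep A) - core Z (rep B)"
      using depends_on_subset[OF shadow_depends_on[of Z "rep A"]] unfolding core_def by blast
    ultimately show "code Z (shadow Z (rep A)) \<subseteq> code Z (core Z (rep B))"
      by (intro code_mono shadow_sets[OF rA(1)] core_sets[OF rB(1)]) simp
  qed
qed

lemma measure_algebra_weak_Freese_Nation_iff:
  "weak_Freese_Nation (measure_algebra \<kappa>) (measure_algebra_le \<kappa>) \<longleftrightarrow>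
    weak_Freese_Nation (borel_sets \<C>) (\<lambda>A B. A - B \<in> null_sets (completion \<M>))"
  unfolding measure_algebra_def measure_algebra_le_def
proof (rule weak_Freese_Nation_quotient)
  interpret sigma_algebra "\<E>" "borel_sets \<C>" by (rule borel_sets_sigma)
  show "A \<inter> B \<in> borel_sets \<C>"
    if "A \<in> borel_sets \<C>" "B \<in> borel_sets \<C>" for A B
    using that by (rule Int)
  show "A \<in> null_sets (completion \<M>)"
    if "B \<in> null_sets (completion \<M>)" "A \<subseteq> B" for A B
    using null_sets_completion_subset[OF that(2,1)] .
  show "A \<union> B \<in> null_sets (completion \<M>)"
    if "A \<in> null_sets (completion \<M>)" "B \<in> null_sets (completion \<M>)" for A B
    using that by (rule null_sets.Un)
qed simp

lemma first_difference_not_negligible: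
  shows "openin \<C> (first_difference s n)"
    and "openin \<C> (\<Union>n\<in>N. first_difference s n)"
    and "first_difference s n \<notin> null_sets (completion \<M>)"
    and "first_difference s n \<noteq> {}"
proof -
  have p: "(\<lambda>i\<in>Field \<kappa>. i = s n) \<in> \<E>" for n by simp
  show 1: "openin \<C> (first_difference s n)" for n
    unfolding first_difference_def by (rule openin_cylinder[OF p]) simp
  then show "openin \<C> (\<Union>n\<in>N. first_difference s n)" by blast
  have "first_difference s n \<in> sets \<M>"
    "emeasure \<M> (first_difference s n) > 0"
    unfolding first_difference_def by (rule emeasure_cylinder[OF p]; simp)+
  then show "first_difference s n \<notin> null_sets (completion \<M>)"
    by (simp add: null_sets_completion_iff null_sets_def)
  show "first_difference s n \<noteq> {}"
    unfolding first_difference_def using cylinder_self[OF p] by blast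
qed

end

section \<open>The equivalence\<close>

theorem corollary5p4:
  fixes lambda \<kappa> :: "'a rel"
  assumes "Card_order lambda"
    and "\<And>\<mu> :: 'a rel. Card_order \<mu> \<Longrightarrow> \<mu> <o lambda \<Longrightarrow> cf \<mu> <o \<mu> \<Longrightarrow> cf \<mu> =o natLeq \<Longrightarrow>
      cof_ctbl_subsets \<mu> =o cardSuc \<mu>"
    and "\<And>\<mu> :: 'a rel. Card_order \<mu> \<Longrightarrow> \<mu> <o lambda \<Longrightarrow> cf \<mu> <o \<mu> \<Longrightarrow> cf \<mu> =o natLeq \<Longrightarrow>
      square_aleph1 \<mu>"
    and "Card_order \<kappa>" and "natLeq \<le>o \<kappa>" and "\<kappa> <o lambda"
  shows "(weak_Freese_Nation (UNIV :: nat set set) (\<subseteq>) \<longleftrightarrow>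
            weak_Freese_Nation (Cohen_algebra \<kappa>) (Cohen_le \<kappa>)) \<and>
         (weak_Freese_Nation (Cohen_algebra \<kappa>) (Cohen_le \<kappa>) \<longleftrightarrow>
            weak_Freese_Nation (measure_algebra \<kappa>) (measure_algebra_le \<kappa>))"
proof -
  let ?B = "borel_sets (cantor_topology \<kappa>)"
  let ?I = "meager_sets (cantor_topology \<kappa>)" and ?N = "null_sets (completion (cantor_measure \<kappa>))"
  have covers: "shared_covers (countable_subsets (Field \<kappa>))"
    by (rule shared_covers_countable_subsets[OF assms(2,3,4,6)])
  have "natLeq \<le>o |Field \<kappa>|"
    using assms(5) ordIso_symmetric[OF card_of_Field_ordIso[OF assms(4)]] by (rule ordLeq_ordIso_trans)
  then have "infinite (Field \<kappa>)" using infinite_iff_natLeq_ordLeq by blast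
  then obtain s :: "nat \<Rightarrow> 'a" where s: "inj s" "range s \<subseteq> Field \<kappa>"
    using infinite_countable_subset by blast
  have disj: "first_difference \<kappa> s m \<inter> first_difference \<kappa> s n = {}" if "m \<noteq> n" for m n
    by (rule first_difference_disjoint[OF s that])
  have UN: "(\<Union>n\<in>X. first_difference \<kappa> s n) \<in> ?B" for X
    by (rule open_borel[OF first_difference_not_negligible(2)])
  have Cohen: "weak_Freese_Nation (UNIV :: nat set set) (\<subseteq>)"
    if "weak_Freese_Nation (Cohen_algebra \<kappa>) (Cohen_le \<kappa>)"
  proof (rule weak_Freese_Nation_Pow_nat[OF that[unfolded Cohen_weak_Freese_Nation_iff] _ _ meager_empty UN disj])
    show "A \<in> ?I" if "C \<in> ?I" "A \<subseteq> C" for A C using that by (rule meager_subset)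
    show "A \<union> C \<in> ?I" if "A \<in> ?I" "C \<in> ?I" for A C using that by (rule meager_Un)
    show "first_difference \<kappa> s n \<notin> ?I" for n
      by (rule open_not_meager[OF first_difference_not_negligible(1,4)])
  qed
  have random: "weak_Freese_Nation (UNIV :: nat set set) (\<subseteq>)"
    if "weak_Freese_Nation (measure_algebra \<kappa>) (measure_algebra_le \<kappa>)"
  proof (rule weak_Freese_Nation_Pow_nat[OF that[unfolded measure_algebra_weak_Freese_Nation_iff] _ _ _ UN disj])
    show "A \<in> ?N" if "C \<in> ?N" "A \<subseteq> C" for A C using null_sets_completion_subset[OF that(2,1)] .
    show "A \<union> C \<in> ?N" if "A \<in> ?N" "C \<in> ?N" for A C using that by (rule null_sets.Un)
    show "{} \<in> ?N" by simp
    show "first_difference \<kappa> s n \<notin> ?N" for n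
      by (rule first_difference_not_negligible(3))
  qed
  show ?thesis
    using Cohen random weak_Freese_Nation_borel_meager[OF _ covers] weak_Freese_Nation_borel_null[OF _ covers]
    unfolding Cohen_weak_Freese_Nation_iff measure_algebra_weak_Freese_Nation_iff by blast
qed

end
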